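(* Let $(\gamma^{(n)},\beta^{(n)},\nu^{(n)})\in\mathscr{Q}$, $n\ge1$, converge to $(\gamma,\beta,\nu)\in\mathscr{Q}_F$ (as triples, in the sense defined in the context), and let $X^{(n)}$, $X$ be the corresponding $Q$-processes. If $\lambda^{(n)}\in\mathcal{P}(\mathbb{N}_\partial)$ converges weakly to $\lambda\in\mathcal{P}(\mathbb{N}_\partial)$, then $\mathbb{P}^{(n)}_{\lambda^{(n)}}$ converges weakly to $\mathbb{P}_\lambda$ on the Skorohod topological space $D_{\overline{\mathbb{N}}_\partial}[0,\infty)$, i.e. $$\lim_{n\to\infty}\int_{D_{\overline{\mathbb{N}}_\partial}[0,\infty)}F(w)\,\mathbb{P}^{(n)}_{\lambda^{(n)}}(dw)=\int_{D_{\overline{\mathbb{N}}_\partial}[0,\infty)}F(w)\,\mathbb{P}_\lambda(dw)$$ for all bounded functions $F$ on $D_{\overline{\mathbb{N}}_\partial}[0,\infty)$ that are continuous in the Skorohod topology.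
   Context: Setting. $\mathbb{N}=\{0,1,2,\dots\}$. Fix a birth-death matrix $Q=(q_{ij})_{i,j\in\mathbb{N}}$: $q_{k,k-1}=a_k>0$ ($k\ge1$), $q_{k,k+1}=b_k>0$ ($k\ge0$), $q_{kk}=-q_k$ with $q_k=a_k+b_k$ and $a_0:=0$, all other entries $0$. Put $c_0=0$, $c_1=\frac1{2b_0}$, $c_k=\frac1{2b_0}+\sum_{i=2}^k\frac{a_1\cdots a_{i-1}}{2b_0\cdots b_{i-1}}$ ($k\ge2$); $\mu_0=1$, $\mu_k=\frac{b_0\cdots b_{k-1}}{a_1\cdots a_k}$ ($k\ge1$); $R=\sum_{k\ge0}(c_{k+1}-c_k)\sum_{i=0}^k\mu_i$, $S=\sum_{k\ge0}c_k\mu_k$. The point $\infty$ is regular if $R,S<\infty$ and an exit if $R<\infty,S=\infty$. Standing assumption: $\infty$ is regular or an exit. A $Q$-process is a continuous-time Markov chain on $\mathbb{N}$ (possibly non-honest) with standard transition matrix $(p_{ij}(t))$ such that $p'_{ij}(0)=q_{ij}$. The minimal $Q$-process has transition matrix $p^{\min}_{ij}(t)$, the minimal nonnegative solution of the Kolmogorov backward equation; $\Phi^{\min}_{ij}(\alpha)=\int_0^\infty e^{-\alpha t}p^{\min}_{ij}(t)\,dt$ and $u^{\min}_\alpha(i)=1-\alpha\sum_j\Phi^{\min}_{ij}(\alpha)$. $\mathscr{Q}$ is the set of triples $(\gamma,\beta,\nu)$ with $\gamma,\beta\ge0$ constants and $\nu=(\nu_k)_{k\in\mathbb{N}}$ a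 nonnegative measure on $\mathbb{N}$, $|\nu|:=\sum_k\nu_k$, such that $\sum_k\nu_k\big(\sum_{j\ge k}(c_{j+1}-c_j)\sum_{i=0}^j\mu_i\big)<\infty$, $|\nu|+\beta\ne0$, and $\beta=0$ if $\infty$ is an exit. The $Q$-process determined by $(\gamma,\beta,\nu)$ is the one whose resolvent matrix $\Phi_{ij}(\alpha)=\int_0^\infty e^{-\alpha t}p_{ij}(t)\,dt$ is $$\Phi_{ij}(\alpha)=\Phi^{\min}_{ij}(\alpha)+u^{\min}_\alpha(i)\frac{\sum_k\nu_k\Phi^{\min}_{kj}(\alpha)+\beta\mu_ju^{\min}_\alpha(j)}{\gamma+\sum_k\nu_k(1-u^{\min}_\alpha(k))+\beta\alpha\sum_k\mu_ku^{\min}_\alpha(k)}.$$ $\mathscr{Q}_D=\{(\gamma,\beta,\nu)\in\mathscr{Q}:\beta=0,\ 0<|\nu|<\infty\}$ and $\mathscr{Q}_F=\mathscr{Q}\setminus\mathscr{Q}_D$. Convergence of triples. $(\gamma^{(n)},\beta^{(n)},\nu^{(n)})\in\mathscr{Q}$ converges to $(\gamma,\beta,\nu)\in\mathscr{Q}$ if $\gamma^{(n)}\to\gamma$, $\beta^{(n)}\to\beta$, $\nu^{(n)}_k\to\nu_k$ for every $k\in\mathbb{N}$, and $\lim_n\sum_k\nu^{(n)}_k(1-u^{\min}_\alpha(k))=\sum_k\nu_k(1-u^{\min}_\alpha(k))$ for all $\alpha>0$ (equivalently, for some $\alpha>0$). State spaces. $\overline{\mathbb{N}}_\partial=\mathbb{N}\cup\{\infty\}\cup\{\partial\}$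 is the compact metric space obtained by identifying $n\in\mathbb{N}$ with $\frac1{n+1}$, $\infty$ with $0$, and the cemetery $\partial$ with $-1$ in $\mathbb{R}$; $\mathbb{N}_\partial=\mathbb{N}\cup\{\partial\}$ (discrete). $\mathcal{P}(\mathbb{N}_\partial)$ is the set of probability measures on $\mathbb{N}_\partial$; weak convergence $\lambda^{(n)}\to\lambda$ means $\lambda^{(n)}(f)\to\lambda(f)$ for all bounded functions $f$ on $\mathbb{N}_\partial$. Path space and laws. $D_{\overline{\mathbb{N}}_\partial}[0,\infty)$ is the space of càdlàg functions $[0,\infty)\to\overline{\mathbb{N}}_\partial$ with the Skorohod ($J_1$) topology; its Borel $\sigma$-algebra is generated by the coordinate maps $\pi_t(w)=w(t)$. Extend $(p_{ij}(t))$ to $\mathbb{N}_\partial$ by $p_{i\partial}(t)=1-\sum_{j\in\mathbb{N}}p_{ij}(t)$, $p_{\partial\partial}(t)=1$. For $\lambda\in\mathcal{P}(\mathbb{N}_\partial)$, $\mathbb{P}_\lambda$ is the law on $D_{\overline{\mathbb{N}}_\partial}[0,\infty)$ of the càdlàg $\overline{\mathbb{N}}_\partial$-valued realization (Ray-Knight realization) of the $Q$-process $X$ with initial distribution $\lambda$, absorbed at $\partial$: its finite-dimensional distributions are those of the Markov chain on $\mathbb{N}_\partial$ with initial law $\lambda$ and transition probabilities the extended $(p_{ij}(t))$. $\mathbb{P}^{(n)}_{\lambda^{(n)}}$ is the same object for $X^{(n)}$ and initial distribution $\lambda^{(n)}$. *)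

theory Defs
  imports "HOL-Probability.Probability"
begin

section \<open>Birth-death matrices and the boundary point at infinity\<close>

definition birth_death :: "(nat \<Rightarrow> real) \<Rightarrow> (nat \<Rightarrow> real) \<Rightarrow> bool" where
  "birth_death a b \<longleftrightarrow> a 0 = 0 \<and> (\<forall>k\<ge>1. a k > 0) \<and> (\<forall>k. b k > 0)"

definition bd_Q :: "(nat \<Rightarrow> real) \<Rightarrow> (nat \<Rightarrow> real) \<Rightarrow> nat \<Rightarrow> nat \<Rightarrow> real" where
  "bd_Q a b i j =
     (if j + 1 = i then a i else if j = i + 1 then b i else if j = i then - (a i + b i) else 0)"

definition bd_c :: "(nat \<Rightarrow> real) \<Rightarrow> (nat \<Rightarrow> real) \<Rightarrow> nat \<Rightarrow> real" where
  "bd_c a b k =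
     (if k = 0 then 0
      else 1 / (2 * b 0) + (\<Sum>i=2..k. (\<Prod>m\<in>{1..<i}. a m) / (2 * (\<Prod>m<i. b m))))"

definition bd_mu :: "(nat \<Rightarrow> real) \<Rightarrow> (nat \<Rightarrow> real) \<Rightarrow> nat \<Rightarrow> real" where
  "bd_mu a b k = (\<Prod>m<k. b m) / (\<Prod>m=1..k. a m)"

text \<open>The tail \<open>\<Sum>j\<ge>k. (c (j+1) - c j) * (\<Sum>i\<le>j. \<mu> i)\<close>, with the summation index shifted by \<open>k\<close>.\<close>

definition bd_tail :: "(nat \<Rightarrow> real) \<Rightarrow> (nat \<Rightarrow> real) \<Rightarrow> nat \<Rightarrow> ennreal" where
  "bd_tail a b k =
     (\<Sum>j. ennreal ((bd_c a b (k + j + 1) - bd_c a b (k + j)) * (\<Sum>i\<le>k + j. bd_mu a b i)))"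

definition bd_R :: "(nat \<Rightarrow> real) \<Rightarrow> (nat \<Rightarrow> real) \<Rightarrow> ennreal" where
  "bd_R a b = (\<Sum>k. ennreal ((bd_c a b (k + 1) - bd_c a b k) * (\<Sum>i\<le>k. bd_mu a b i)))"

definition bd_S :: "(nat \<Rightarrow> real) \<Rightarrow> (nat \<Rightarrow> real) \<Rightarrow> ennreal" where
  "bd_S a b = (\<Sum>k. ennreal (bd_c a b k * bd_mu a b k))"

definition infinity_regular :: "(nat \<Rightarrow> real) \<Rightarrow> (nat \<Rightarrow> real) \<Rightarrow> bool" where
  "infinity_regular a b \<longleftrightarrow> bd_R a b < \<infinity> \<and> bd_S a b < \<infinity>"

definition infinity_exit :: "(nat \<Rightarrow> real) \<Rightarrow> (nat \<Rightarrow> real) \<Rightarrow> bool" where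
  "infinity_exit a b \<longleftrightarrow> bd_R a b < \<infinity> \<and> bd_S a b = \<infinity>"


section \<open>Transition matrices and resolvents\<close>

text \<open>A family of matrices is a function \<open>p i j t\<close>; only its values at times \<open>t \<ge> 0\<close> matter.
  Row sums may be strictly smaller than 1.\<close>

definition standard_transition :: "(nat \<Rightarrow> nat \<Rightarrow> real \<Rightarrow> real) \<Rightarrow> bool" where
  "standard_transition p \<longleftrightarrow>
     (\<forall>i j. \<forall>t\<ge>0. p i j t \<ge> 0) \<and>
     (\<forall>i. \<forall>t\<ge>0. summable (\<lambda>j. p i j t) \<and> (\<Sum>j. p i j t) \<le> 1) \<and>
     (\<forall>i j. p i j 0 = of_bool (i = j)) \<and>
     (\<forall>i j. \<forall>s\<ge>0. \<forall>t\<ge>0. p i j (s + t) = (\<Sum>k. p i k s * p k j t)) \<and>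
     (\<forall>i j. (p i j \<longlongrightarrow> of_bool (i = j)) (at_right 0))"

definition Q_transition ::
  "(nat \<Rightarrow> real) \<Rightarrow> (nat \<Rightarrow> real) \<Rightarrow> (nat \<Rightarrow> nat \<Rightarrow> real \<Rightarrow> real) \<Rightarrow> bool" where
  "Q_transition a b p \<longleftrightarrow>
     standard_transition p \<and>
     (\<forall>i j. (p i j has_real_derivative bd_Q a b i j) (at 0 within {0..}))"

definition backward_solution ::
  "(nat \<Rightarrow> real) \<Rightarrow> (nat \<Rightarrow> real) \<Rightarrow> (nat \<Rightarrow> nat \<Rightarrow> real \<Rightarrow> real) \<Rightarrow> bool" where
  "backward_solution a b p \<longleftrightarrow>
     (\<forall>i j. \<forall>t\<ge>0. p i j t \<ge> 0) \<and>
     (\<forall>i j. p i j 0 = of_bool (i = j)) \<and>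
     (\<forall>i j. \<forall>t\<ge>0. (p i j has_real_derivative (\<Sum>k. bd_Q a b i k * p k j t)) (at t within {0..}))"

definition minimal_transition ::
  "(nat \<Rightarrow> real) \<Rightarrow> (nat \<Rightarrow> real) \<Rightarrow> (nat \<Rightarrow> nat \<Rightarrow> real \<Rightarrow> real) \<Rightarrow> bool" where
  "minimal_transition a b p \<longleftrightarrow>
     backward_solution a b p \<and>
     (\<forall>p'. backward_solution a b p' \<longrightarrow> (\<forall>i j. \<forall>t\<ge>0. p i j t \<le> p' i j t))"

definition resolvent :: "(nat \<Rightarrow> nat \<Rightarrow> real \<Rightarrow> real) \<Rightarrow> real \<Rightarrow> nat \<Rightarrow> nat \<Rightarrow> real" where
  "resolvent p \<alpha> i j = (LINT t:{0..}|lborel. exp (- \<alpha> * t) * p i j t)"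

definition u_fun :: "(nat \<Rightarrow> nat \<Rightarrow> real \<Rightarrow> real) \<Rightarrow> real \<Rightarrow> nat \<Rightarrow> real" where
  "u_fun p \<alpha> i = 1 - \<alpha> * (\<Sum>j. resolvent p \<alpha> i j)"


section \<open>Parameter triples and the processes they determine\<close>

type_synonym triple = "real \<times> real \<times> (nat \<Rightarrow> real)"

text \<open>The total mass of \<open>\<nu>\<close> may be infinite; the individual masses \<open>\<nu> k\<close> are finite, as is
  forced by the integrability condition below (every \<open>bd_tail a b k\<close> is positive).\<close>

definition total_mass :: "(nat \<Rightarrow> real) \<Rightarrow> ennreal" where
  "total_mass \<nu> = (\<Sum>k. ennreal (\<nu> k))"

definition triples :: "(nat \<Rightarrow> real) \<Rightarrow> (nat \<Rightarrow> real) \<Rightarrow> triple set" where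
  "triples a b =
     {(\<gamma>, \<beta>, \<nu>). \<gamma> \<ge> 0 \<and> \<beta> \<ge> 0 \<and> (\<forall>k. \<nu> k \<ge> 0) \<and>
        (\<Sum>k. ennreal (\<nu> k) * bd_tail a b k) < \<infinity> \<and>
        total_mass \<nu> + ennreal \<beta> \<noteq> 0 \<and>
        (infinity_exit a b \<longrightarrow> \<beta> = 0)}"

definition triples_D :: "(nat \<Rightarrow> real) \<Rightarrow> (nat \<Rightarrow> real) \<Rightarrow> triple set" where
  "triples_D a b =
     {(\<gamma>, \<beta>, \<nu>). (\<gamma>, \<beta>, \<nu>) \<in> triples a b \<and> \<beta> = 0 \<and> 0 < total_mass \<nu> \<and> total_mass \<nu> < \<infinity>}"

definition triples_F :: "(nat \<Rightarrow> real) \<Rightarrow> (nat \<Rightarrow> real) \<Rightarrow> triple set" where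
  "triples_F a b = triples a b - triples_D a b"

text \<open>In the following two definitions \<open>pmin\<close> is the minimal transition matrix.

  The real series in \<open>triple_resolvent\<close> converge for triples in \<open>triples a b\<close>, except that
  \<open>\<Sum>k. bd_mu a b k * u_fun pmin \<alpha> k\<close> may diverge when infinity is an exit; then \<open>\<beta> = 0\<close> and
  the term vanishes.\<close>

definition triple_resolvent ::
  "(nat \<Rightarrow> real) \<Rightarrow> (nat \<Rightarrow> real) \<Rightarrow> (nat \<Rightarrow> nat \<Rightarrow> real \<Rightarrow> real) \<Rightarrow> triple \<Rightarrow>
     real \<Rightarrow> nat \<Rightarrow> nat \<Rightarrow> real" where
  "triple_resolvent a b pmin = (\<lambda>(\<gamma>, \<beta>, \<nu>) \<alpha> i j.
     resolvent pmin \<alpha> i j +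
     u_fun pmin \<alpha> i *
       (((\<Sum>k. \<nu> k * resolvent pmin \<alpha> k j) + \<beta> * bd_mu a b j * u_fun pmin \<alpha> j) /
        (\<gamma> + (\<Sum>k. \<nu> k * (1 - u_fun pmin \<alpha> k)) +
         \<beta> * \<alpha> * (\<Sum>k. bd_mu a b k * u_fun pmin \<alpha> k))))"

definition triple_tendsto ::
  "(nat \<Rightarrow> nat \<Rightarrow> real \<Rightarrow> real) \<Rightarrow> (nat \<Rightarrow> triple) \<Rightarrow> triple \<Rightarrow> bool" where
  "triple_tendsto pmin X = (\<lambda>(\<gamma>, \<beta>, \<nu>).
     (\<lambda>n. fst (X n)) \<longlonglongrightarrow> \<gamma> \<and>
     (\<lambda>n. fst (snd (X n))) \<longlonglongrightarrow> \<beta> \<and>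
     (\<forall>k. (\<lambda>n. snd (snd (X n)) k) \<longlonglongrightarrow> \<nu> k) \<and>
     (\<forall>\<alpha>>0. (\<lambda>n. \<Sum>k. snd (snd (X n)) k * (1 - u_fun pmin \<alpha> k))
               \<longlonglongrightarrow> (\<Sum>k. \<nu> k * (1 - u_fun pmin \<alpha> k))))"

definition Q_process_of ::
  "(nat \<Rightarrow> real) \<Rightarrow> (nat \<Rightarrow> real) \<Rightarrow> (nat \<Rightarrow> nat \<Rightarrow> real \<Rightarrow> real) \<Rightarrow> triple \<Rightarrow>
     (nat \<Rightarrow> nat \<Rightarrow> real \<Rightarrow> real) \<Rightarrow> bool" where
  "Q_process_of a b pmin x p \<longleftrightarrow>
     Q_transition a b p \<and>
     (\<forall>\<alpha>>0. \<forall>i j. resolvent p \<alpha> i j = triple_resolvent a b pmin x \<alpha> i j)"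


section \<open>State spaces\<close>

datatype state = Pt nat | Infty | Cemetery

fun state_embed :: "state \<Rightarrow> real" where
  "state_embed (Pt n) = 1 / (real n + 1)"
| "state_embed Infty = 0"
| "state_embed Cemetery = -1"

lemma state_embed_inject: "state_embed x = state_embed y \<longleftrightarrow> x = y"
proof -
  have pos: "1 / (real n + 1) > 0" for n by simp
  have "1 / (real n + 1) \<noteq> -1" "1 / (real n + 1) \<noteq> 0" for n
    using pos[of n] by linarith+
  then show ?thesis
    by (cases x; cases y) (auto simp: eq_commute[of "-1::real"])
qed

instantiation state :: metric_space
begin

definition dist_state :: "state \<Rightarrow> state \<Rightarrow> real" where
  "dist_state x y = \<bar>state_embed x - state_embed y\<bar>"

definition uniformity_state :: "(state \<times> state) filter" where
  "uniformity_state = (INF e\<in>{0<..}. principal {(x, y). dist x y < e})"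

definition open_state :: "state set \<Rightarrow> bool" where
  "open_state U \<longleftrightarrow> (\<forall>x\<in>U. \<forall>\<^sub>F (x', y) in uniformity. x' = x \<longrightarrow> y \<in> U)"

instance
  by standard (auto simp: dist_state_def uniformity_state_def open_state_def state_embed_inject)

end

definition N_cem :: "state set" where
  "N_cem = range Pt \<union> {Cemetery}"

definition prob_measures_N_cem :: "state measure set" where
  "prob_measures_N_cem = {l. prob_space l \<and> sets l = Pow N_cem}"

definition weakly_tendsto_N_cem :: "(nat \<Rightarrow> state measure) \<Rightarrow> state measure \<Rightarrow> bool" where
  "weakly_tendsto_N_cem ls l \<longleftrightarrow>
     (\<forall>f :: state \<Rightarrow> real. bounded (f ` N_cem) \<longrightarrow>
        (\<lambda>n. \<integral>x. f x \<partial>ls n) \<longlonglongrightarrow> (\<integral>x. f x \<partial>l))"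

text \<open>The extension to \<open>N_cem\<close>. The clauses that involve \<open>Infty\<close> are never used.\<close>

fun ext_transition :: "(nat \<Rightarrow> nat \<Rightarrow> real \<Rightarrow> real) \<Rightarrow> state \<Rightarrow> state \<Rightarrow> real \<Rightarrow> real" where
  "ext_transition p (Pt i) (Pt j) t = p i j t"
| "ext_transition p (Pt i) Cemetery t = 1 - (\<Sum>j. p i j t)"
| "ext_transition p Cemetery Cemetery t = 1"
| "ext_transition p _ _ t = 0"


section \<open>Path space\<close>

text \<open>A path is a function on \<open>[0,\<infinity>)\<close>, represented by an extensional function on the reals.\<close>

definition cadlag_paths :: "(real \<Rightarrow> 'a::metric_space) set" where
  "cadlag_paths =
     {w \<in> extensional {0..}.
        (\<forall>t\<ge>0. (w \<longlongrightarrow> w t) (at_right t)) \<and>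
        (\<forall>t>0. \<exists>l. (w \<longlongrightarrow> l) (at_left t))}"

definition time_changes :: "(real \<Rightarrow> real) set" where
  "time_changes =
     {\<tau>. bij_betw \<tau> {0..} {0..} \<and> strict_mono_on {0..} \<tau> \<and> continuous_on {0..} \<tau>}"

definition skorohod_nbhd :: "(real \<Rightarrow> 'a::metric_space) \<Rightarrow> real \<Rightarrow> real \<Rightarrow> (real \<Rightarrow> 'a) set" where
  "skorohod_nbhd w T e =
     {v \<in> cadlag_paths. \<exists>\<tau>\<in>time_changes.
        (\<forall>s\<ge>0. \<bar>\<tau> s - s\<bar> < e) \<and> (\<forall>s\<in>{0..T}. dist (v (\<tau> s)) (w s) < e)}"

text \<open>The \<open>J1\<close> topology on the half line: the sets \<open>skorohod_nbhd w T e\<close> with \<open>T, e > 0\<close> form a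
  neighbourhood base at \<open>w\<close>. Equivalently, \<open>v n\<close> converges to \<open>w\<close> iff there are time changes
  \<open>\<tau> n\<close> such that \<open>\<tau> n s - s\<close> tends to 0 uniformly on \<open>[0,\<infinity>)\<close> and \<open>dist (v n (\<tau> n s)) (w s)\<close>
  tends to 0 uniformly on every \<open>[0,T]\<close> (Jacod and Shiryaev, Limit Theorems for Stochastic
  Processes, Theorem VI.1.14).\<close>

definition skorohod :: "(real \<Rightarrow> 'a::metric_space) topology" where
  "skorohod = topology (\<lambda>U. U \<subseteq> cadlag_paths \<and>
     (\<forall>w\<in>U. \<exists>T>0. \<exists>e>0. skorohod_nbhd w T e \<subseteq> U))"

lemma skorohod_nbhd_mono:
  "T \<le> T' \<Longrightarrow> e' \<le> e \<Longrightarrow> skorohod_nbhd w T' e' \<subseteq> skorohod_nbhd w T e"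
  unfolding skorohod_nbhd_def by (force intro: less_le_trans)

lemma openin_skorohod:
  fixes U :: "(real \<Rightarrow> 'a::metric_space) set"
  shows "openin skorohod U \<longleftrightarrow>
     U \<subseteq> cadlag_paths \<and> (\<forall>w\<in>U. \<exists>T>0. \<exists>e>0. skorohod_nbhd w T e \<subseteq> U)"
proof -
  let ?P = "\<lambda>U :: (real \<Rightarrow> 'a) set. U \<subseteq> cadlag_paths \<and> (\<forall>w\<in>U. \<exists>T>0. \<exists>e>0. skorohod_nbhd w T e \<subseteq> U)"
  have "istopology ?P"
    unfolding istopology_def
  proof (intro conjI allI impI)
    fix U V :: "(real \<Rightarrow> 'a) set"
    assume U: "?P U" and V: "?P V"
    show "U \<inter> V \<subseteq> cadlag_paths" using U by blast
    show "\<forall>w\<in>U \<inter> V. \<exists>T>0. \<exists>e>0. skorohod_nbhd w T e \<subseteq> U \<inter> V"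
    proof
      fix w assume w: "w \<in> U \<inter> V"
      obtain T e where 1: "T > 0" "e > 0" "skorohod_nbhd w T e \<subseteq> U" using U w by blast
      obtain T' e' where 2: "T' > 0" "e' > 0" "skorohod_nbhd w T' e' \<subseteq> V" using V w by blast
      have "skorohod_nbhd w (max T T') (min e e') \<subseteq> U \<inter> V"
        using 1(3) 2(3) skorohod_nbhd_mono[of T "max T T'" "min e e'" e w]
          skorohod_nbhd_mono[of T' "max T T'" "min e e'" e' w] by auto
      then show "\<exists>T>0. \<exists>e>0. skorohod_nbhd w T e \<subseteq> U \<inter> V"
        using 1 2 by (intro exI[of _ "max T T'"] conjI exI[of _ "min e e'"]) auto
    qed
  next
    fix K :: "(real \<Rightarrow> 'a) set set"
    assume K: "\<forall>U\<in>K. ?P U"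
    show "\<Union>K \<subseteq> cadlag_paths" using K by blast
    show "\<forall>w\<in>\<Union>K. \<exists>T>0. \<exists>e>0. skorohod_nbhd w T e \<subseteq> \<Union>K"
      using K by (meson Union_iff Union_upper subset_trans)
  qed
  then show ?thesis by (simp add: skorohod_def topology_inverse')
qed

lemma topspace_skorohod: "topspace skorohod = cadlag_paths"
proof -
  have "openin skorohod (cadlag_paths :: (real \<Rightarrow> 'a::metric_space) set)"
    unfolding openin_skorohod by (auto simp: skorohod_nbhd_def intro: exI[of _ "1::real"])
  then show ?thesis
    by (meson openin_skorohod openin_subset openin_topspace subset_antisym)
qed

text \<open>The \<open>\<sigma>\<close>-algebra on the path space generated by the coordinate maps, which is the Borel
  \<open>\<sigma>\<close>-algebra of the \<open>J1\<close> topology.\<close>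

definition path_space :: "(real \<Rightarrow> state) measure" where
  "path_space = restrict_space (PiM {0..} (\<lambda>_. borel)) cadlag_paths"

lemma space_path_space: "space path_space = cadlag_paths"
  by (auto simp: path_space_def space_restrict_space space_PiM PiE_def cadlag_paths_def)

text \<open>\<open>process_law p l P\<close>: the measure \<open>P\<close> on the path space is the law of the right-continuous
  realization of the chain on \<open>N_cem\<close> with initial distribution \<open>l\<close> and transition probabilities
  \<open>ext_transition p\<close>. Since \<open>l\<close> and the rows of \<open>ext_transition p\<close> have mass 1 on \<open>N_cem\<close>, the
  values below determine all finite-dimensional distributions (with no mass at \<open>Infty\<close>).\<close>

definition process_law ::
  "(nat \<Rightarrow> nat \<Rightarrow> real \<Rightarrow> real) \<Rightarrow> state measure \<Rightarrow> (real \<Rightarrow> state) measure \<Rightarrow> bool" where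
  "process_law p l P \<longleftrightarrow>
     prob_space P \<and> sets P = sets path_space \<and>
     (\<forall>m t x. t 0 = 0 \<and> (\<forall>k<m. t k < t (Suc k)) \<and> (\<forall>k\<le>m. x k \<in> N_cem) \<longrightarrow>
        measure P {w \<in> space P. \<forall>k\<le>m. w (t k) = x k} =
        measure l {x 0} * (\<Prod>k<m. ext_transition p (x k) (x (Suc k)) (t (Suc k) - t k)))"

end

theory Submission
  imports Defs
begin

text \<open>
  Merge all states beyond \<open>K\<close> with \<open>\<infinity>\<close>. Every \<open>Q\<close>-process leaves a state \<open>i \<le> K + 1\<close> at rate
  \<open>a i + b i\<close> and jumps only to its neighbours, and its arrivals in \<open>{0..K}\<close> outnumber the departures
  by at most one. Hence the merged path has two jumps in a common cell of a grid of mesh \<open>h\<close> only with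
  probability \<open>O(h)\<close>, with constants that do not depend on the process. Otherwise a time change
  smaller than \<open>2 * h\<close> matches the path with its samples on the grid up to \<open>1 / (K + 1)\<close>, so that weak
  convergence in the Skorohod space reduces to that of the finite-dimensional distributions.

  The transition functions converge because they are Lipschitz uniformly in \<open>n\<close> and their Laplace
  transforms, the resolvents, converge: \<open>\<alpha> \<Phi>\<^sup>m\<^sup>i\<^sup>n k j \<le> 1 - u k\<close>, so the convergence of
  \<open>\<Sum>k. \<nu> k * (1 - u k)\<close> dominates that of \<open>\<Sum>k. \<nu> k * \<Phi>\<^sup>m\<^sup>i\<^sup>n k j\<close>. These series are finite, because
  Feller's iteration bounds the minimal solution and gives \<open>1 - u k \<le> 2 \<alpha> \<Sum>j\<ge>k. (c (j+1) - c j) * (\<Sum>i\<le>j. \<mu> i)\<close>.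
\<close>

section \<open>Series and Laplace transforms\<close>

text \<open>How a path enters \<open>{0..K}\<close> from beyond depends on the triple, so a single
  entrance is never estimated; only the expected number of entrances is. This is enough because,
  apart from transitions of negligible probability, the later of two merged jumps in one cell can be
  charged to a departure from a state up to \<open>K + 1\<close>, which in one time step has a
  probability of the order of that step, given the whole past. The sum over the cells is then of the
  order of \<open>h\<close> times the expected number of earlier jumps. The cemetery is a state of
  the chain, and entrywise convergence of a transition matrix does not exclude loss of mass.
  Therefore the row sums are treated like the entries, with their own Lipschitz bound and their own
  Laplace transform. No convergent subsequences are extracted. The lower bound for \<open>F\<close>
  by a function of finitely many coordinates has an error that is uniform in \<open>n\<close>, and
  in the limit law it recovers \<open>F\<close> as the mesh shrinks; the same bound for
  \<open>-F\<close> gives the other half.\<close>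

lemma sums_swap_nonneg:
  fixes f :: "nat \<Rightarrow> nat \<Rightarrow> real"
  assumes f0: "\<And>k j. 0 \<le> f k j" and s1: "\<And>k. summable (f k)" and s2: "summable (\<lambda>k. \<Sum>j. f k j)"
  shows "(\<lambda>j. \<Sum>k. f k j) sums (\<Sum>k. \<Sum>j. f k j)"
proof -
  have s3: "summable (\<lambda>k. f k j)" for j
    by (rule summable_comparison_test'[OF s2, of 0])
       (use f0 s1 sum_le_suminf[OF s1, of "{j}"] in auto)
  have "(\<Sum>j. ennreal (\<Sum>k. f k j)) = (\<Sum>j. \<Sum>k. ennreal (f k j))"
    using f0 s3 by (simp add: suminf_ennreal2)
  also have "\<dots> = (\<integral>\<^sup>+j. \<integral>\<^sup>+k. ennreal (f k j) \<partial>count_space UNIV \<partial>count_space UNIV)"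
    by (simp add: nn_integral_count_space_nat)
  also have "\<dots> = (\<integral>\<^sup>+k. \<integral>\<^sup>+j. ennreal (f k j) \<partial>count_space UNIV \<partial>count_space UNIV)"
    by (rule nn_integral_count_space_nn_integral) auto
  also have "\<dots> = (\<Sum>k. \<Sum>j. ennreal (f k j))"
    by (simp add: nn_integral_count_space_nat)
  also have "\<dots> = ennreal (\<Sum>k. \<Sum>j. f k j)"
    using f0 s1 s2 by (simp add: suminf_ennreal2 suminf_nonneg)
  finally have eq: "(\<Sum>j. ennreal (\<Sum>k. f k j)) = ennreal (\<Sum>k. \<Sum>j. f k j)" .
  have nn: "0 \<le> (\<Sum>k. f k j)" for j using f0 s3 by (intro suminf_nonneg)
  have sm: "summable (\<lambda>j. \<Sum>k. f k j)"
    by (rule summable_suminf_not_top) (use nn eq in auto)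
  have "ennreal (\<Sum>j. \<Sum>k. f k j) = ennreal (\<Sum>k. \<Sum>j. f k j)"
    using eq by (simp add: suminf_ennreal2 nn sm)
  then have "(\<Sum>j. \<Sum>k. f k j) = (\<Sum>k. \<Sum>j. f k j)"
    by (subst (asm) ennreal_inj) (auto intro!: suminf_nonneg sm nn s2 s1 f0)
  with sm show ?thesis by (simp add: sums_iff)
qed

text \<open>Fatou's lemma for series: finitely many terms \<open>z k * y k\<close> come within
  \<open>e\<close> of the whole sum, and on these the convergence is termwise. The conditions on
  \<open>x n\<close> are only eventual because the triples are controlled from \<open>n = 1\<close>
  on.\<close>

lemma scheffe_lower:
  fixes x :: "nat \<Rightarrow> nat \<Rightarrow> real"
  assumes x0: "\<forall>\<^sub>F n in sequentially. \<forall>k. 0 \<le> x n k"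
    and xs: "\<forall>\<^sub>F n in sequentially. summable (x n)"
    and z0: "\<And>k. 0 \<le> z k" and zs: "summable z"
    and lim: "\<And>k. (\<lambda>n. x n k) \<longlonglongrightarrow> z k"
    and y: "\<And>k. 0 \<le> y k" "\<And>k. y k \<le> 1" and e: "e > 0"
  shows "\<forall>\<^sub>F n in sequentially. (\<Sum>k. x n k * y k) > (\<Sum>k. z k * y k) - e"
proof -
  have zy: "summable (\<lambda>k. z k * y k)"
    by (rule summable_comparison_test'[OF zs, of 0]) (use z0 y in \<open>auto simp: mult_left_le abs_mult\<close>)
  obtain N where N: "(\<Sum>k<N. z k * y k) > (\<Sum>k. z k * y k) - e"
    using order_tendstoD(1)[OF summable_LIMSEQ[OF zy], of "(\<Sum>k. z k * y k) - e"] e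
    by (auto simp: eventually_sequentially)
  have "(\<lambda>n. \<Sum>k<N. x n k * y k) \<longlonglongrightarrow> (\<Sum>k<N. z k * y k)"
    by (intro tendsto_intros lim)
  from order_tendstoD(1)[OF this N] x0 xs show ?thesis
  proof eventually_elim
    case (elim n)
    have "summable (\<lambda>k. x n k * y k)"
      by (rule summable_comparison_test'[OF elim(3), of 0]) (use elim(2) y in \<open>auto simp: mult_left_le abs_mult\<close>)
    then have "(\<Sum>k<N. x n k * y k) \<le> (\<Sum>k. x n k * y k)"
      by (rule sum_le_suminf) (use elim(2) y in auto)
    with elim(1) show ?case by linarith
  qed
qed

text \<open>Scheffe's lemma for series. The Fatou bound is applied to the weights \<open>y\<close>
  and \<open>1 - y\<close>: once the totals converge, a lower bound for the complementary sum is an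
  upper bound for the sum itself.\<close>

lemma scheffe_series:
  fixes x :: "nat \<Rightarrow> nat \<Rightarrow> real"
  assumes x0: "\<forall>\<^sub>F n in sequentially. \<forall>k. 0 \<le> x n k"
    and xs: "\<forall>\<^sub>F n in sequentially. summable (x n)"
    and z0: "\<And>k. 0 \<le> z k" and zs: "summable z"
    and lim: "\<And>k. (\<lambda>n. x n k) \<longlonglongrightarrow> z k"
    and tot: "(\<lambda>n. \<Sum>k. x n k) \<longlonglongrightarrow> (\<Sum>k. z k)"
    and y: "\<And>k. 0 \<le> y k" "\<And>k. y k \<le> 1"
  shows "(\<lambda>n. \<Sum>k. x n k * y k) \<longlonglongrightarrow> (\<Sum>k. z k * y k)"
proof (rule tendstoI)
  fix e :: real assume e: "e > 0"
  have split: "(\<Sum>k. f k) = (\<Sum>k. f k * y k) + (\<Sum>k. f k * (1 - y k))"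
    if "\<And>k. 0 \<le> f k" "summable f" for f :: "nat \<Rightarrow> real"
  proof -
    have "summable (\<lambda>k. f k * y k)"
      by (rule summable_comparison_test'[OF that(2), of 0]) (use that y in \<open>auto simp: mult_left_le abs_mult\<close>)
    moreover have "summable (\<lambda>k. f k * (1 - y k))"
      by (rule summable_comparison_test'[OF that(2), of 0]) (use that y in \<open>auto simp: mult_left_le abs_mult\<close>)
    ultimately show ?thesis by (subst suminf_add) (auto simp: algebra_simps)
  qed
  have e2: "e / 2 > 0" using e by simp
  have A: "\<forall>\<^sub>F n in sequentially. (\<Sum>k. x n k * y k) > (\<Sum>k. z k * y k) - e/2"
    by (rule scheffe_lower[OF x0 xs z0 zs lim y e2])
  have B: "\<forall>\<^sub>F n in sequentially. (\<Sum>k. x n k * (1 - y k)) > (\<Sum>k. z k * (1 - y k)) - e/2"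
    by (rule scheffe_lower[OF x0 xs z0 zs lim _ _ e2]) (use y in auto)
  from A B x0 xs tendstoD[OF tot e2]
  show "\<forall>\<^sub>F n in sequentially. dist (\<Sum>k. x n k * y k) (\<Sum>k. z k * y k) < e"
  proof eventually_elim
    case (elim n)
    show ?case using elim split[of z, OF z0 zs] split[of "x n"] by (auto simp: dist_real_def abs_if split: if_splits)
  qed
qed

section \<open>Laplace transforms of bounded functions on the half-line\<close>

definition laplace :: "(real \<Rightarrow> real) \<Rightarrow> real \<Rightarrow> real" where
  "laplace f \<alpha> = (LINT t:{0..}|lborel. exp (- \<alpha> * t) * f t)"

lemma exp_integrable:
  assumes "\<alpha> > 0"
  shows "set_integrable lborel {0..} (\<lambda>t::real. exp (- \<alpha> * t))"
    and "(LINT t:{0..}|lborel. exp (- \<alpha> * t)) = 1 / \<alpha>"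
proof -
  have hb: "has_bochner_integral lborel (\<lambda>t. indicator {0..} t *\<^sub>R exp (- \<alpha> * t)) (1/\<alpha>)"
  proof (rule has_bochner_integral_nn_integral)
    have "(\<integral>\<^sup>+ t. ennreal (exp (- \<alpha> * t)) * indicator {0..} t \<partial>lborel) = ennreal (0 - (- exp (- \<alpha> * 0) / \<alpha>))"
    proof (rule nn_integral_FTC_atLeast)
      show "((\<lambda>t. - exp (- \<alpha> * t) / \<alpha>) has_real_derivative exp (- \<alpha> * x)) (at x)" for x
        using assms by (auto intro!: derivative_eq_intros)
      have "((\<lambda>t. exp (- \<alpha> * t)) \<longlongrightarrow> 0) at_top"
        using assms by (intro filterlim_compose[OF exp_at_bot] filterlim_tendsto_neg_mult_at_bot[OF tendsto_const] filterlim_ident) auto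
      from tendsto_divide[OF tendsto_minus[OF this] tendsto_const[of \<alpha>]]
      show "((\<lambda>t. - exp (- \<alpha> * t) / \<alpha>) \<longlongrightarrow> 0) at_top" using assms by simp
    qed auto
    then show "(\<integral>\<^sup>+ t. ennreal (indicator {0..} t *\<^sub>R exp (- \<alpha> * t)) \<partial>lborel) = ennreal (1/\<alpha>)"
      by (simp add: ennreal_mult' mult.commute ennreal_indicator)
  qed (use assms in \<open>auto\<close>)
  show "set_integrable lborel {0..} (\<lambda>t::real. exp (- \<alpha> * t))"
    using hb unfolding set_integrable_def by (rule integrable.intros)
  show "(LINT t:{0..}|lborel. exp (- \<alpha> * t)) = 1 / \<alpha>"
    using hb unfolding set_lebesgue_integral_def by (rule has_bochner_integral_integral_eq)
qed

lemma laplace_integrable: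
  fixes f :: "real \<Rightarrow> real"
  assumes "\<alpha> > 0" and "set_borel_measurable borel {0..} f"
    and "\<And>t. t \<ge> 0 \<Longrightarrow> \<bar>f t\<bar> \<le> C"
  shows "set_integrable lborel {0..} (\<lambda>t. exp (- \<alpha> * t) * f t)"
proof (rule set_integrable_bound)
  show "set_integrable lborel {0..} (\<lambda>t. C * exp (- \<alpha> * t))"
    using exp_integrable(1)[OF assms(1)] by (rule set_integrable_mult_right[rotated]) 
  have "(\<lambda>t. exp (- \<alpha> * t) * (indicator {0..} t *\<^sub>R f t)) \<in> borel_measurable borel"
    using assms(2) unfolding set_borel_measurable_def by measurable
  also have "(\<lambda>t. exp (- \<alpha> * t) * (indicator {0..} t *\<^sub>R f t)) = (\<lambda>t. indicator {0..} t *\<^sub>R (exp (- \<alpha> * t) * f t))"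
    by (auto simp: indicator_def)
  finally show "set_borel_measurable lborel {0..} (\<lambda>t. exp (- \<alpha> * t) * f t)"
    by (simp add: set_borel_measurable_def)
  show "AE t in lborel. t \<in> {0..} \<longrightarrow> norm (exp (- \<alpha> * t) * f t) \<le> norm (C * exp (- \<alpha> * t))"
  proof (intro AE_I2 impI)
    fix t :: real assume "t \<in> {0..}"
    then have "\<bar>f t\<bar> \<le> C" using assms(3) by auto
    then have "exp (- \<alpha> * t) * \<bar>f t\<bar> \<le> exp (- \<alpha> * t) * \<bar>C\<bar>" by (intro mult_left_mono) auto
    then show "norm (exp (- \<alpha> * t) * f t) \<le> norm (C * exp (- \<alpha> * t))"
      by (simp add: abs_mult mult.commute)
  qed
qed

lemma continuous_set_borel:
  fixes f :: "real \<Rightarrow> real"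
  shows "continuous_on {0..} f \<Longrightarrow> set_borel_measurable borel {0..} f"
  by (rule set_measurable_continuous_on) auto

lemma laplace_tendsto:
  fixes f :: "nat \<Rightarrow> real \<Rightarrow> real"
  assumes \<alpha>: "\<alpha> > 0" and f: "\<And>n. continuous_on {0..} (f n)" "\<And>n t. t \<ge> 0 \<Longrightarrow> \<bar>f n t\<bar> \<le> 1"
    and g: "continuous_on {0..} g" "\<And>t. t \<ge> 0 \<Longrightarrow> (\<lambda>n. f n t) \<longlonglongrightarrow> g t"
  shows "(\<lambda>n. laplace (f n) \<alpha>) \<longlonglongrightarrow> laplace g \<alpha>"
  unfolding laplace_def set_lebesgue_integral_def
proof (rule integral_dominated_convergence[where w = "\<lambda>t. indicator {0..} t *\<^sub>R exp (- \<alpha> * t)"])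
  have m: "(\<lambda>t. indicator {0..} t *\<^sub>R (exp (- \<alpha> * t) * h t)) \<in> borel_measurable lborel" if "continuous_on {0..} h" for h :: "real \<Rightarrow> real"
  proof -
    have "continuous_on {0..} (\<lambda>t. exp (- \<alpha> * t) * h t)" by (intro continuous_intros that)
    from continuous_set_borel[OF this] show ?thesis by (simp add: set_borel_measurable_def)
  qed
  show "(\<lambda>t. indicator {0..} t *\<^sub>R (exp (- \<alpha> * t) * g t)) \<in> borel_measurable lborel"
    and "(\<lambda>t. indicator {0..} t *\<^sub>R (exp (- \<alpha> * t) * f n t)) \<in> borel_measurable lborel" for n
    by (rule m[OF g(1)], rule m[OF f(1)])
  show "integrable lborel (\<lambda>t. indicator {0..} t *\<^sub>R exp (- \<alpha> * t))"
    using exp_integrable(1)[OF \<alpha>] by (simp add: set_integrable_def)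
  show "AE t in lborel. (\<lambda>n. indicator {0..} t *\<^sub>R (exp (- \<alpha> * t) * f n t)) \<longlonglongrightarrow> indicator {0..} t *\<^sub>R (exp (- \<alpha> * t) * g t)"
    by (auto simp: indicator_def intro!: tendsto_intros g)
  show "AE t in lborel. norm (indicator {0..} t *\<^sub>R (exp (- \<alpha> * t) * f n t)) \<le> indicator {0..} t *\<^sub>R exp (- \<alpha> * t)" for n
    using f(2) by (auto simp: indicator_def abs_mult)
qed

lemma lipschitz_imp_continuous:
  fixes f :: "real \<Rightarrow> real"
  assumes "\<And>s t. s \<in> A \<Longrightarrow> t \<in> A \<Longrightarrow> \<bar>f s - f t\<bar> \<le> q * \<bar>s - t\<bar>"
  shows "continuous_on A f"
proof (rule lipschitz_on_continuous_on)
  have "\<bar>f s - f t\<bar> \<le> \<bar>q\<bar> * \<bar>s - t\<bar>" if "s \<in> A" "t \<in> A" for s t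
    by (rule order_trans[OF assms[OF that]]) (intro mult_right_mono, auto)
  then show "\<bar>q\<bar>-lipschitz_on A f" by (intro lipschitz_onI) (auto simp: dist_real_def)
qed

text \<open>By Weierstrass, the exponentials with integer rates test \<open>f n - g\<close> against every continuous function
  of \<open>exp (- t)\<close>, in particular against a bump at a given time.\<close>

lemma laplace_continuity:
  fixes f :: "nat \<Rightarrow> real \<Rightarrow> real"
  assumes f: "\<And>n t. n \<ge> m \<Longrightarrow> t \<ge> 0 \<Longrightarrow> 0 \<le> f n t \<and> f n t \<le> 1"
      "\<And>n s t. n \<ge> m \<Longrightarrow> s \<ge> 0 \<Longrightarrow> t \<ge> 0 \<Longrightarrow> \<bar>f n s - f n t\<bar> \<le> q * \<bar>s - t\<bar>"
    and g: "\<And>t. t \<ge> 0 \<Longrightarrow> 0 \<le> g t \<and> g t \<le> 1"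
      "\<And>s t. s \<ge> 0 \<Longrightarrow> t \<ge> 0 \<Longrightarrow> \<bar>g s - g t\<bar> \<le> q * \<bar>s - t\<bar>"
    and lap: "\<And>\<alpha>. \<alpha> > 0 \<Longrightarrow> (\<lambda>n. laplace (f n) \<alpha>) \<longlonglongrightarrow> laplace g \<alpha>"
    and t0: "t0 \<ge> 0"
  shows "(\<lambda>n. f n t0) \<longlonglongrightarrow> g t0"
proof -
  \<comment> \<open>Clamping time at 0 makes \<open>x\<close> and \<open>d n\<close> functions on
    the whole line, so that continuity and measurability can be stated without restriction.\<close>
  define x where "x t = exp (- max 0 t)" for t :: real
  define d where "d n t = f n (max 0 t) - g (max 0 t)" for n t
  \<comment> \<open>\<open>W\<close> is the standard exponential distribution. Together with its
    density, \<open>x t ^ i\<close> becomes \<open>exp (- (i + 1) * t)\<close>, so that the integral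
    of \<open>x t ^ i * d n t\<close> is a difference of Laplace transforms at the rate
    \<open>i + 1\<close>.\<close>
  define W where "W = density lborel (\<lambda>t. ennreal (indicator {0..} t * exp (- t)))"
  have q0: "q \<ge> 0" using g(2)[of 0 1] by auto
  have bnd: "\<bar>d n t\<bar> \<le> 1" if "n \<ge> m" for n t
    using f(1)[OF that, of "max 0 t"] g(1)[of "max 0 t"] by (simp add: d_def abs_le_iff)
  have lip: "\<bar>d n s - d n t\<bar> \<le> 2 * q * \<bar>s - t\<bar>" if "n \<ge> m" for n s t
  proof -
    have "\<bar>d n s - d n t\<bar> \<le> q * \<bar>max 0 s - max 0 t\<bar> + q * \<bar>max 0 s - max 0 t\<bar>"
    proof -
      have "\<bar>A - B\<bar> \<le> r \<Longrightarrow> \<bar>C - D\<bar> \<le> r \<Longrightarrow> \<bar>(A - C) - (B - D)\<bar> \<le> r + r" for A B C D r :: real by linarith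
      then show ?thesis unfolding d_def using f(2)[OF that] g(2) by simp
    qed
    also have "\<dots> \<le> q * \<bar>s - t\<bar> + q * \<bar>s - t\<bar>" using q0 by (intro add_mono mult_left_mono) auto
    finally show ?thesis by simp
  qed
  have dm: "d n \<in> borel_measurable borel" if "n \<ge> m" for n
    by (rule borel_measurable_continuous_onI[OF lipschitz_imp_continuous]) (rule lip[OF that])
  have x: "x t \<in> {0..1}" for t by (simp add: x_def)
  have xc: "continuous_on UNIV x" unfolding x_def by (intro continuous_intros)
  have W_int: "(\<integral>t. h t \<partial>W) = (LINT t:{0..}|lborel. exp (- t) * h t)" if "h \<in> borel_measurable borel" for h :: "real \<Rightarrow> real"
    unfolding W_def using that by (subst integral_density) (auto simp: set_lebesgue_integral_def mult.assoc)
  interpret W: prob_space W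
  proof
    have "emeasure W (space W) = (\<integral>\<^sup>+t. ennreal (indicator {0..} t * exp (- t)) \<partial>lborel)"
      by (simp add: W_def emeasure_density)
    also have "\<dots> = ennreal (LINT t:{0..}|lborel. exp (- 1 * t))"
      using exp_integrable(1)[of 1] by (subst nn_integral_eq_integral) (auto simp: set_integrable_def set_lebesgue_integral_def)
    finally show "emeasure W (space W) = 1" using exp_integrable(2)[of 1] by simp
  qed
  have W_sets: "sets W = sets borel" by (simp add: W_def)
  have int: "integrable W (\<lambda>t. \<phi> (x t) * h t)"
    if \<phi>: "continuous_on {0..1} \<phi>" and h: "h \<in> borel_measurable borel" "\<And>t. \<bar>h t\<bar> \<le> 1" for \<phi> h :: "real \<Rightarrow> real"
  proof -
    obtain M where M: "\<And>y. y \<in> {0..1} \<Longrightarrow> \<bar>\<phi> y\<bar> \<le> M"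
      using compact_imp_bounded[OF compact_continuous_image[OF \<phi> compact_Icc]]
      unfolding bounded_iff by (metis image_eqI real_norm_def)
    have "(\<lambda>t. \<phi> (x t)) \<in> borel_measurable borel"
      by (rule borel_measurable_continuous_onI[OF continuous_on_compose2[OF \<phi> xc]]) (use x in auto)
    then have "(\<lambda>t. \<phi> (x t) * h t) \<in> borel_measurable W" 
      unfolding measurable_cong_sets[OF W_sets refl] using h(1) by (rule borel_measurable_times)
    moreover have "norm (\<phi> (x t) * h t) \<le> M * 1" for t
      using M[OF x, of t] h(2)[of t] unfolding real_norm_def abs_mult by (intro mult_mono) auto
    ultimately show ?thesis by (intro W.integrable_const_bound[of _ "M * 1"]) auto
  qed
  have le: "\<bar>\<integral>t. \<phi> (x t) * h t \<partial>W\<bar> \<le> C"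
    if "continuous_on {0..1} \<phi>" "\<And>y. y \<in> {0..1} \<Longrightarrow> \<bar>\<phi> y\<bar> \<le> C" "h \<in> borel_measurable borel" "\<And>t. \<bar>h t\<bar> \<le> 1" for \<phi> h :: "real \<Rightarrow> real" and C
  proof -
    have "\<bar>\<integral>t. \<phi> (x t) * h t \<partial>W\<bar> \<le> (\<integral>t. \<bar>\<phi> (x t) * h t\<bar> \<partial>W)" by (rule integral_abs_bound)
    also have "\<dots> \<le> (\<integral>t. C * 1 \<partial>W)"
    proof (rule integral_mono)
      show "\<bar>\<phi> (x t) * h t\<bar> \<le> C * 1" for t
        using that(2)[OF x, of t] that(4)[of t] unfolding abs_mult by (intro mult_mono) auto
    qed (use int[OF that(1,3,4)] in auto)
    finally show ?thesis by (simp add: W.prob_space)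
  qed
  have power: "(\<lambda>n. \<integral>t. x t ^ i * d n t \<partial>W) \<longlonglongrightarrow> 0" for i
  proof -
    let ?\<alpha> = "real i + 1"
    have li: "set_integrable lborel {0..} (\<lambda>t. exp (- ?\<alpha> * t) * h t)"
      if "\<And>t. t \<ge> 0 \<Longrightarrow> 0 \<le> h t \<and> h t \<le> 1" "\<And>s t. s \<ge> 0 \<Longrightarrow> t \<ge> 0 \<Longrightarrow> \<bar>h s - h t\<bar> \<le> q * \<bar>s - t\<bar>" for h :: "real \<Rightarrow> real"
      by (rule laplace_integrable[OF _ continuous_set_borel[OF lipschitz_imp_continuous], of _ _ q 1]) (use that in auto)
    have "laplace (f n) ?\<alpha> - laplace g ?\<alpha> = (\<integral>t. x t ^ i * d n t \<partial>W)" if "n \<ge> m" for n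
    proof -
      have "(\<lambda>t. x t ^ i * d n t) \<in> borel_measurable borel"
        using dm[OF that] borel_measurable_continuous_onI[OF xc] by measurable
      then have "(\<integral>t. x t ^ i * d n t \<partial>W) = (LINT t:{0..}|lborel. exp (- t) * (x t ^ i * d n t))" by (rule W_int)
      also have "\<dots> = (LINT t:{0..}|lborel. exp (- ?\<alpha> * t) * f n t - exp (- ?\<alpha> * t) * g t)"
      proof (rule set_lebesgue_integral_cong)
        have "exp (- t) * x t ^ i = exp (- ?\<alpha> * t)" if "t \<ge> 0" for t
          using that by (simp add: x_def exp_of_nat_mult[symmetric] mult_exp_exp algebra_simps)
        then show "\<forall>t. t \<in> {0..} \<longrightarrow> exp (- t) * (x t ^ i * d n t) = exp (- ?\<alpha> * t) * f n t - exp (- ?\<alpha> * t) * g t"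
          by (auto simp: mult.assoc[symmetric] d_def right_diff_distrib)
      qed simp
      also have "\<dots> = laplace (f n) ?\<alpha> - laplace g ?\<alpha>"
        unfolding laplace_def by (rule set_integral_diff(2)[OF li[OF f[OF that]] li[OF g]])
      finally show ?thesis by simp
    qed
    then show ?thesis
      using Lim_transform_eventually[OF LIM_zero[OF lap[of ?\<alpha>]], of "\<lambda>n. \<integral>t. x t ^ i * d n t \<partial>W"]
      by (auto intro!: eventually_sequentiallyI[of m])
  qed
  have poly: "(\<lambda>n. \<integral>t. \<phi> (x t) * d n t \<partial>W) \<longlonglongrightarrow> 0" if pf: "real_polynomial_function \<phi>" for \<phi>
  proof -
    obtain c N where \<phi>: "\<phi> = (\<lambda>y. \<Sum>i\<le>N. c i * y^i)"
      using pf unfolding real_polynomial_function_iff_sum by auto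
    have eq: "(\<Sum>i\<le>N. c i * (\<integral>t. x t ^ i * d n t \<partial>W)) = (\<integral>t. \<phi> (x t) * d n t \<partial>W)" if "n \<ge> m" for n
    proof -
      have "integrable W (\<lambda>t. x t ^ i * d n t)" for i
        by (rule int[OF _ dm[OF that] bnd[OF that]]) (intro continuous_intros)
      then have "(\<Sum>i\<le>N. c i * (\<integral>t. x t ^ i * d n t \<partial>W)) = (\<integral>t. (\<Sum>i\<le>N. c i * (x t ^ i * d n t)) \<partial>W)"
        by (subst Bochner_Integration.integral_sum) auto
      then show ?thesis unfolding \<phi> by (simp add: sum_distrib_right mult.assoc)
    qed
    have "(\<lambda>n. \<Sum>i\<le>N. c i * (\<integral>t. x t ^ i * d n t \<partial>W)) \<longlonglongrightarrow> (\<Sum>i\<le>N. c i * 0)"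
      by (intro tendsto_sum tendsto_mult tendsto_const power)
    then have "(\<lambda>n. \<Sum>i\<le>N. c i * (\<integral>t. x t ^ i * d n t \<partial>W)) \<longlonglongrightarrow> 0" by simp
    then show ?thesis
      by (rule Lim_transform_eventually) (rule eventually_sequentiallyI[of m], rule eq)
  qed
  have cts: "(\<lambda>n. \<integral>t. \<phi> (x t) * d n t \<partial>W) \<longlonglongrightarrow> 0" if \<phi>: "continuous_on {0..1} \<phi>" for \<phi>
  proof (rule tendstoI)
    fix e :: real assume e: "e > 0"
    \<comment> \<open>The approximation costs at most \<open>e/2\<close> uniformly in
      \<open>n\<close>, since \<open>d n\<close> is bounded by 1 and \<open>W\<close> has mass
      1.\<close>
    obtain h where h: "real_polynomial_function h" "\<And>y. y \<in> {0..1} \<Longrightarrow> \<bar>\<phi> y - h y\<bar> < e/2"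
      using Stone_Weierstrass_real_polynomial_function[OF compact_Icc \<phi>, of "e/2"] e by auto
    have hc: "continuous_on {0..1} h"
      by (intro continuous_at_imp_continuous_on ballI continuous_real_polymonial_function h)
    have "\<forall>\<^sub>F n in sequentially. dist (\<integral>t. h (x t) * d n t \<partial>W) 0 < e/2"
      using tendstoD[OF poly[OF h(1)], of "e/2"] e by simp
    then show "\<forall>\<^sub>F n in sequentially. dist (\<integral>t. \<phi> (x t) * d n t \<partial>W) 0 < e"
      using eventually_ge_at_top[of m] unfolding dist_real_def diff_0_right
    proof eventually_elim
      case (elim n)
      note id = dm[OF elim(2)] bnd[OF elim(2)]
      have "(\<integral>t. (\<phi> (x t) - h (x t)) * d n t \<partial>W) = (\<integral>t. \<phi> (x t) * d n t \<partial>W) - (\<integral>t. h (x t) * d n t \<partial>W)"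
        unfolding left_diff_distrib by (rule Bochner_Integration.integral_diff[OF int[OF \<phi> id] int[OF hc id]])
      moreover have "\<bar>\<integral>t. (\<phi> (x t) - h (x t)) * d n t \<partial>W\<bar> \<le> e/2"
        by (rule le[OF continuous_on_diff[OF \<phi> hc] _ id]) (use h(2) in \<open>auto intro: less_imp_le\<close>)
      ultimately show ?case using elim(1) by linarith
    qed
  qed
  have "(\<lambda>n. d n t0) \<longlonglongrightarrow> 0"
  proof (rule tendstoI)
    fix e :: real assume e: "e > 0"
    \<comment> \<open>Over a time \<open>\<kappa>\<close> the Lipschitz constant
      \<open>2 * q\<close> lets \<open>d n\<close> move by at most \<open>e/2\<close>;
      \<open>q + 1\<close> keeps the quotient meaningful for \<open>q = 0\<close>.\<close>
    define \<kappa> where "\<kappa> = e / (4 * (q + 1))"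
    have \<kappa>: "\<kappa> > 0" "2 * q * \<kappa> \<le> e/2" using e q0 by (simp_all add: \<kappa>_def field_simps)
    define x0 where "x0 = exp (- t0)"
    have "isCont ln x0" unfolding x0_def by (rule isCont_ln) simp
    then obtain \<eta> where \<eta>: "\<eta> > 0" "\<And>y. \<bar>y - x0\<bar> < \<eta> \<Longrightarrow> \<bar>ln y - ln x0\<bar> < \<kappa>"
      using \<kappa>(1) unfolding continuous_at_eps_delta by (auto simp: dist_real_def)
    \<comment> \<open>A tent around \<open>exp (- t0)\<close>. By the choice of
      \<open>\<eta>\<close> through the continuity of \<open>ln\<close>, it only sees times within
      \<open>\<kappa>\<close> of \<open>t0\<close>.\<close>
    define \<phi> where "\<phi> y = max 0 (\<eta> - \<bar>y - x0\<bar>)" for y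
    have \<phi>c: "continuous_on A \<phi>" for A unfolding \<phi>_def by (intro continuous_intros)
    have \<phi>0: "\<phi> y \<ge> 0" for y by (simp add: \<phi>_def)
    have supp: "\<bar>max 0 t - t0\<bar> < \<kappa>" if "\<phi> (x t) \<noteq> 0" for t
    proof -
      have "\<bar>x t - x0\<bar> < \<eta>" using that unfolding \<phi>_def by linarith
      then have "\<bar>ln (x t) - ln x0\<bar> < \<kappa>" by (rule \<eta>(2))
      then show ?thesis by (simp add: x_def x0_def abs_minus_commute)
    qed
    define c where "c = (\<integral>t. \<phi> (x t) * 1 \<partial>W)"
    have ic: "integrable W (\<lambda>t. \<phi> (x t) * 1)" by (rule int[OF \<phi>c]) auto
    have "c \<noteq> 0"
    proof
      assume "c = 0"
      then have "AE t in W. \<phi> (x t) * 1 = 0"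
        unfolding c_def using \<phi>0 by (subst (asm) integral_nonneg_eq_0_iff_AE[OF ic]) auto
      then have ae: "AE t in lborel. 0 \<le> t \<longrightarrow> \<phi> (x t) = 0"
        unfolding W_def by (subst (asm) AE_density) (auto simp: indicator_def)
      have "isCont (\<lambda>t. exp (- t)) t0" by (intro continuous_intros)
      then obtain r where r: "r > 0" "\<And>t. \<bar>t - t0\<bar> < r \<Longrightarrow> \<bar>exp (- t) - x0\<bar> < \<eta>"
        using \<eta>(1) unfolding continuous_at_eps_delta x0_def dist_real_def by metis
      \<comment> \<open>An interval to the right of \<open>t0\<close> lies in the half-line even for
        \<open>t0 = 0\<close>, and it has positive measure.\<close>
      have pos: "\<phi> (x t) > 0" if "t \<in> {t0<..<t0 + r}" for t
        using r(2)[of t] that t0 by (auto simp: \<phi>_def x_def)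
      from ae have "AE t in lborel. t \<notin> {t0<..<t0 + r}"
      proof eventually_elim
        case (elim t)
        then show ?case using pos[of t] t0 by force
      qed
      then have "emeasure lborel {t0<..<t0 + r} = 0"
        by (subst (asm) AE_iff_measurable[of "{t0<..<t0 + r}"]) auto
      then show False using r(1) by simp
    qed
    moreover have "c \<ge> 0" unfolding c_def using \<phi>0 by simp
    ultimately have c: "c > 0" by simp
    have "\<forall>\<^sub>F n in sequentially. dist (\<integral>t. \<phi> (x t) * d n t \<partial>W) 0 < c * (e/2)"
      using tendstoD[OF cts[OF \<phi>c], of "c * (e/2)"] e c by simp
    then show "\<forall>\<^sub>F n in sequentially. dist (d n t0) 0 < e"
      using eventually_ge_at_top[of m] unfolding dist_real_def diff_0_right
    proof eventually_elim
      case (elim n)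
      let ?I = "\<integral>t. \<phi> (x t) * d n t \<partial>W"
      have i: "integrable W (\<lambda>t. \<phi> (x t) * d n t)" by (rule int[OF \<phi>c dm[OF elim(2)] bnd[OF elim(2)]])
      have i0: "integrable W (\<lambda>t. (\<phi> (x t) * 1) * d n t0)" using ic by simp
      \<comment> \<open>Freezing \<open>d n\<close> at \<open>t0\<close> under the integral changes
        it by at most \<open>c * (e/2)\<close>.\<close>
      have "?I - c * d n t0 = (\<integral>t. \<phi> (x t) * d n t - (\<phi> (x t) * 1) * d n t0 \<partial>W)"
        unfolding c_def by (subst Bochner_Integration.integral_diff[OF i i0]) simp
      also have "\<bar>\<dots>\<bar> \<le> (\<integral>t. \<bar>\<phi> (x t) * d n t - (\<phi> (x t) * 1) * d n t0\<bar> \<partial>W)" by (rule integral_abs_bound)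
      also have "\<dots> \<le> (\<integral>t. (\<phi> (x t) * 1) * (e/2) \<partial>W)"
      proof (rule integral_mono)
        fix t
        have "\<phi> (x t) * \<bar>d n t - d n t0\<bar> \<le> \<phi> (x t) * (e/2)"
        proof (cases "\<phi> (x t) = 0")
          case False
          have "d n t = d n (max 0 t)" by (simp add: d_def)
          then have "\<bar>d n t - d n t0\<bar> \<le> 2 * q * \<bar>max 0 t - t0\<bar>" using lip[OF elim(2), of "max 0 t" t0] by simp
          also have "\<dots> \<le> 2 * q * \<kappa>" using supp[OF False] q0 by (intro mult_left_mono) auto
          finally show ?thesis using \<kappa>(2) \<phi>0 by (intro mult_left_mono) auto
        qed simp
        then show "\<bar>\<phi> (x t) * d n t - (\<phi> (x t) * 1) * d n t0\<bar> \<le> (\<phi> (x t) * 1) * (e/2)"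
          using \<phi>0[of "x t"] by (simp add: abs_mult right_diff_distrib[symmetric])
      qed (use i i0 ic in auto)
      also have "\<dots> = c * (e/2)" unfolding c_def by simp
      finally have "\<bar>c * d n t0\<bar> < c * (e/2) + c * (e/2)" using elim(1) by linarith
      then show ?case using c by (simp add: abs_mult)
    qed
  qed
  then show ?thesis using t0 by (intro LIM_zero_cancel[of _ "g t0"]) (simp add: d_def)
qed

section \<open>Transition functions\<close>

locale bd_matrix =
  fixes a b :: "nat \<Rightarrow> real"
  assumes bd: "birth_death a b"
begin

lemma a0: "a 0 = 0" and a_pos: "k \<ge> 1 \<Longrightarrow> a k > 0" and a_nonneg: "a k \<ge> 0" and b_pos: "b k > 0"
  using bd unfolding birth_death_def by (auto, cases "k = 0") (auto intro: less_imp_le)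

end

locale Q_trans = bd_matrix +
  fixes p :: "nat \<Rightarrow> nat \<Rightarrow> real \<Rightarrow> real"
  assumes Qt: "Q_transition a b p"
begin

lemma nonneg: "t \<ge> 0 \<Longrightarrow> p i j t \<ge> 0"
  and row_summable: "t \<ge> 0 \<Longrightarrow> summable (\<lambda>j. p i j t)"
  and row_le_1: "t \<ge> 0 \<Longrightarrow> (\<Sum>j. p i j t) \<le> 1"
  and at_0: "p i j 0 = of_bool (i = j)"
  and chapman: "s \<ge> 0 \<Longrightarrow> t \<ge> 0 \<Longrightarrow> p i j (s + t) = (\<Sum>k. p i k s * p k j t)"
  and deriv: "(p i j has_real_derivative bd_Q a b i j) (at 0 within {0..})"
  using Qt unfolding Q_transition_def standard_transition_def by auto

lemma finite_row_le_1:
  assumes "t \<ge> 0" "finite J"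
  shows "(\<Sum>j\<in>J. p i j t) \<le> 1"
  using sum_le_suminf[OF row_summable[OF assms(1)] assms(2), of i] nonneg[OF assms(1)] row_le_1[OF assms(1), of i]
  by force

lemma le_1: "t \<ge> 0 \<Longrightarrow> p i j t \<le> 1"
  using finite_row_le_1[of t "{j}" i] by simp

lemma chapman_summable: 
  assumes "s \<ge> 0" "t \<ge> 0" shows "summable (\<lambda>k. p i k s * p k j t)"
  by (rule summable_comparison_test'[OF row_summable[OF assms(1), of i], of 0])
     (use assms nonneg le_1 in \<open>auto simp: abs_mult mult_left_le\<close>)

lemma diag_supermult:
  assumes "s \<ge> 0" "t \<ge> 0"
  shows "p i i s * p i i t \<le> p i i (s + t)"
  using sum_le_suminf[OF chapman_summable[OF assms, of i i], of "{i}"] nonneg assms chapman[OF assms, of i i]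
  by simp

text \<open>\<open>1 - p i i\<close> is subadditive in time, so \<open>1 - p i i t\<close> is at
  most \<open>n\<close> times its value at \<open>t / n\<close>, and this tends to \<open>t\<close>
  times minus the derivative of \<open>p i i\<close> at 0.\<close>

lemma leave_bound:
  assumes "t \<ge> 0"
  shows "1 - p i i t \<le> (a i + b i) * t"
proof (cases "t = 0")
  case True then show ?thesis by (simp add: at_0)
next
  case False
  with assms have t: "t > 0" by simp
  have step: "1 - p i i (s + t) \<le> (1 - p i i s) + (1 - p i i t)" if "s \<ge> 0" "t \<ge> 0" for s t
  proof -
    have "(1 - p i i s) * (1 - p i i t) \<ge> 0" using le_1 that by simp
    then show ?thesis using diag_supermult[OF that, of i] by (simp add: algebra_simps)
  qed
  have multi: "1 - p i i (real n * s) \<le> real n * (1 - p i i s)" if "s \<ge> 0" for n s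
  proof (induction n)
    case 0 show ?case by (simp add: at_0)
  next
    case (Suc n)
    have "1 - p i i (real n * s + s) \<le> (1 - p i i (real n * s)) + (1 - p i i s)"
      by (rule step) (use that in auto)
    with Suc show ?case by (simp add: algebra_simps)
  qed
  have "(p i i has_real_derivative - (a i + b i)) (at_right 0)"
    using deriv[of i i] by (auto simp: bd_Q_def intro: DERIV_subset)
  then have l: "((\<lambda>h. (p i i h - 1) / h) \<longlongrightarrow> - (a i + b i)) (at_right 0)"
    by (simp add: has_field_derivative_iff at_0)
  have f: "filterlim (\<lambda>n. t / real n) (at_right 0) sequentially"
    unfolding filterlim_at
    using t by (auto intro!: tendsto_divide_0[OF tendsto_const] filterlim_real_sequentially filterlim_at_top_imp_at_infinity
        eventually_sequentiallyI[of 1])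
  have "(\<lambda>n. (p i i (t / real n) - 1) / (t / real n)) \<longlonglongrightarrow> - (a i + b i)"
    by (rule filterlim_compose[OF l f])
  from tendsto_mult[OF tendsto_const[of "- t"] this]
  have "(\<lambda>n. - t * ((p i i (t / real n) - 1) / (t / real n))) \<longlonglongrightarrow> - t * (- (a i + b i))" .
  moreover have "\<forall>\<^sub>F n in sequentially. 1 - p i i t \<le> - t * ((p i i (t / real n) - 1) / (t / real n))"
  proof (rule eventually_sequentiallyI[of 1])
    fix n :: nat assume "1 \<le> n"
    then show "1 - p i i t \<le> - t * ((p i i (t / real n) - 1) / (t / real n))"
      using multi[of "t / real n" n] t by (simp add: diff_divide_distrib algebra_simps)
  qed
  ultimately have "1 - p i i t \<le> - t * (- (a i + b i))"
    by (rule tendsto_lowerbound) simp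
  then show ?thesis by (simp add: algebra_simps)
qed

text \<open>By the semigroup property, this applies to \<open>g k = p k j t\<close> and to \<open>g k = (\<Sum>j. p k j t)\<close>.\<close>

lemma mix_lipschitz:
  assumes "s \<ge> 0" and g: "\<And>k. 0 \<le> g k" "\<And>k. g k \<le> 1"
  shows "\<bar>(\<Sum>k. p i k s * g k) - g i\<bar> \<le> (a i + b i) * s"
proof -
  have sm: "summable (\<lambda>k. p i k s * g k)"
    by (rule summable_comparison_test'[OF row_summable[OF assms(1), of i], of 0])
       (use assms nonneg in \<open>auto simp: abs_mult mult_left_le\<close>)
  \<comment> \<open>The lower estimate keeps only the term \<open>k = i\<close>. The upper one is
    the lower estimate for \<open>1 - g\<close>, combined with row sums of at most 1.\<close>
  have "p i i s * g i \<le> (\<Sum>k. p i k s * g k)"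
    using sum_le_suminf[OF sm, of "{i}"] nonneg assms by simp
  moreover have "(1 - p i i s) * g i \<le> 1 - p i i s" using le_1[OF assms(1), of i i] g[of i] by (simp add: mult_left_le)
  ultimately have low: "g i - (1 - p i i s) \<le> (\<Sum>k. p i k s * g k)" by (simp add: algebra_simps)
  have sm1: "summable (\<lambda>k. p i k s * (1 - g k))"
    by (rule summable_comparison_test'[OF row_summable[OF assms(1), of i], of 0])
       (use assms nonneg in \<open>auto simp: abs_mult mult_left_le\<close>)
  have "p i i s * (1 - g i) \<le> (\<Sum>k. p i k s * (1 - g k))"
    using sum_le_suminf[OF sm1, of "{i}"] nonneg assms by simp
  moreover have "(\<Sum>k. p i k s * g k) + (\<Sum>k. p i k s * (1 - g k)) \<le> 1"
    unfolding suminf_add[OF sm sm1] using row_le_1[OF assms(1), of i] by (simp add: algebra_simps)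
  moreover have "(1 - p i i s) * (1 - g i) \<le> 1 - p i i s" using le_1[OF assms(1), of i i] g[of i] by (simp add: mult_left_le)
  ultimately have "(\<Sum>k. p i k s * g k) \<le> g i + (1 - p i i s)" by (simp add: algebra_simps)
  with low leave_bound[OF assms(1), of i] show ?thesis by (auto simp: abs_le_iff)
qed

lemma lipschitz:
  assumes "s \<ge> 0" "t \<ge> 0"
  shows "\<bar>p i j s - p i j t\<bar> \<le> (a i + b i) * \<bar>s - t\<bar>"
proof -
  have *: "\<bar>p i j s - p i j t\<bar> \<le> (a i + b i) * (s - t)" if "s \<ge> t" "t \<ge> 0" for s t
    using mix_lipschitz[of "s - t" "\<lambda>k. p k j t" i] chapman[of "s - t" t i j] nonneg le_1 that by simp
  show ?thesis using *[of s t] *[of t s] assms by (cases "s \<ge> t") (auto simp: abs_minus_commute)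
qed

text \<open>Tonelli, applied to the semigroup equation. The row sum is 1 minus the probability of
  the cemetery, so this is what carries regularity in time over to that entry.\<close>

lemma row_sum_chapman:
  assumes "s \<ge> 0" "t \<ge> 0"
  shows "(\<Sum>j. p i j (s + t)) = (\<Sum>k. p i k s * (\<Sum>j. p k j t))"
proof -
  have row: "(\<Sum>j. p i k s * p k j t) = p i k s * (\<Sum>j. p k j t)" for k
    by (rule suminf_mult[OF row_summable[OF assms(2)]])
  have "summable (\<lambda>k. p i k s * (\<Sum>j. p k j t))"
    by (rule summable_comparison_test'[OF row_summable[OF assms(1), of i], of 0])
       (use assms nonneg row_le_1 row_summable in \<open>auto simp: abs_mult mult_left_le suminf_nonneg\<close>)
  then have "(\<lambda>j. \<Sum>k. p i k s * p k j t) sums (\<Sum>k. \<Sum>j. p i k s * p k j t)"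
    using assms nonneg row_summable unfolding row[symmetric]
    by (intro sums_swap_nonneg summable_mult mult_nonneg_nonneg) auto
  then show ?thesis unfolding chapman[OF assms, symmetric] row by (rule sums_unique[symmetric])
qed

lemma row_sum_lipschitz:
  assumes "s \<ge> 0" "t \<ge> 0"
  shows "\<bar>(\<Sum>j. p i j s) - (\<Sum>j. p i j t)\<bar> \<le> (a i + b i) * \<bar>s - t\<bar>"
proof -
  have *: "\<bar>(\<Sum>j. p i j s) - (\<Sum>j. p i j t)\<bar> \<le> (a i + b i) * (s - t)" if "s \<ge> t" "t \<ge> 0" for s t
    using mix_lipschitz[of "s - t" "\<lambda>k. \<Sum>j. p k j t" i] row_sum_chapman[of "s - t" t i] suminf_nonneg[OF row_summable] nonneg row_le_1 that by simp
  show ?thesis using *[of s t] *[of t s] assms by (cases "s \<ge> t") (auto simp: abs_minus_commute)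
qed

text \<open>The probability of being at time \<open>t\<close> neither at \<open>i\<close> nor at a
  neighbour, lost mass included. At \<open>i = 0\<close> the truncated \<open>i - 1\<close> would
  subtract state 0 twice, hence the case distinction.\<close>

definition skip_prob :: "nat \<Rightarrow> real \<Rightarrow> real" where
  "skip_prob i t = 1 - p i i t - p i (Suc i) t - (if i = 0 then 0 else p i (i - 1) t)"

lemma skip_prob_nonneg: 
  assumes "t \<ge> 0" shows "skip_prob i t \<ge> 0"
proof (cases "i = 0")
  case True
  then show ?thesis using finite_row_le_1[OF assms, of "{0, 1}" 0] by (simp add: skip_prob_def)
next
  case False
  then show ?thesis using finite_row_le_1[OF assms, of "{i, i+1, i - 1}" i] by (simp add: skip_prob_def)
qed

text \<open>The rates from \<open>i\<close> to its neighbours add up to \<open>a i + b i\<close>, so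
  the derivative at 0 cancels: killing and jumps elsewhere have probability
  \<open>o(t)\<close>.\<close>

lemma skip_prob_small: "((\<lambda>t. skip_prob i t / t) \<longlongrightarrow> 0) (at_right 0)"
proof -
  have d: "(p i j has_real_derivative bd_Q a b i j) (at_right 0)" for j
    using deriv[of i j] by (rule DERIV_subset) auto
  have D: "(skip_prob i has_real_derivative 0 - bd_Q a b i i - bd_Q a b i (Suc i) - (if i = 0 then 0 else bd_Q a b i (i - 1))) (at_right 0)"
    unfolding skip_prob_def[abs_def]
    by (intro DERIV_diff DERIV_const d) (auto intro!: d derivative_eq_intros)
  have "0 - bd_Q a b i i - bd_Q a b i (Suc i) - (if i = 0 then 0 else bd_Q a b i (i - 1)) = 0"
    using a0 by (auto simp: bd_Q_def)
  moreover have "i \<noteq> i - Suc 0" if "0 < i" using that by simp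
  ultimately show ?thesis using D by (auto simp: has_field_derivative_iff skip_prob_def at_0 cong: if_cong split: if_splits)
qed

end

section \<open>The minimal solution\<close>

lemma derivative_within_atLeast:
  fixes F :: "real \<Rightarrow> real"
  assumes "(F has_real_derivative D) (at t within {0..t + 1})" 
  shows "(F has_real_derivative D) (at t within {0..})"
proof -
  have "at t within {0..} = at t within {0..t + 1}"
    by (rule at_within_nhd[of t "{..<t+1}"]) auto
  with assms show ?thesis by simp
qed

text \<open>Variation of constants for \<open>g' = - q * g + h\<close> with
  \<open>g 0 = c\<close>.\<close>

lemma duhamel_derivative:
  fixes h :: "real \<Rightarrow> real"
  assumes h: "continuous_on {0..} h" and t: "t \<ge> 0"
  shows "((\<lambda>t. exp (- q * t) * (c + integral {0..t} (\<lambda>s. exp (q * s) * h s))) has_real_derivative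
     - q * (exp (- q * t) * (c + integral {0..t} (\<lambda>s. exp (q * s) * h s))) + h t) (at t within {0..})"
proof -
  have "continuous_on {0..t + 1} (\<lambda>s. exp (q * s) * h s)"
    by (intro continuous_intros continuous_on_subset[OF h]) auto
  then have "((\<lambda>x. integral {0..x} (\<lambda>s. exp (q * s) * h s)) has_real_derivative exp (q * t) * h t) (at t within {0..t + 1})"
    by (rule integral_has_real_derivative) (use t in auto)
  note D = derivative_within_atLeast[OF this]
  have "exp (- q * t) * exp (q * t) = 1" by (simp add: exp_add[symmetric])
  then have e: "h t * (exp (q * t) * exp (- (q * t))) = h t" by (simp add: mult.commute)
  have E: "((\<lambda>t. exp (- q * t)) has_real_derivative - q * exp (- q * t)) (at t within {0..})"
    by (auto intro!: derivative_eq_intros)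
  show ?thesis
    using DERIV_mult[OF E DERIV_add[OF DERIV_const D], of c] by (simp add: algebra_simps e)
qed

lemma duhamel_continuous:
  fixes h :: "real \<Rightarrow> real"
  assumes h: "continuous_on {0..} h"
  shows "continuous_on {0..} (\<lambda>t. exp (- q * t) * (c + integral {0..t} (\<lambda>s. exp (q * s) * h s)))"
  by (rule DERIV_continuous_on) (rule duhamel_derivative[OF h], simp)

text \<open>Integration by parts against \<open>exp (- \<alpha> * t)\<close>; the boundary term at
  infinity vanishes since \<open>g\<close> is bounded.\<close>

lemma laplace_duhamel:
  fixes g h :: "real \<Rightarrow> real"
  assumes \<alpha>: "\<alpha> > 0"
    and d: "\<And>t. t \<ge> 0 \<Longrightarrow> (g has_real_derivative - q * g t + h t) (at t within {0..})"
    and h: "continuous_on {0..} h" "\<And>t. t \<ge> 0 \<Longrightarrow> \<bar>h t\<bar> \<le> C" 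
    and g: "\<And>t. t \<ge> 0 \<Longrightarrow> \<bar>g t\<bar> \<le> C'"
  shows "(\<alpha> + q) * laplace g \<alpha> = g 0 + laplace h \<alpha>"
proof -
  have gc: "continuous_on {0..} g" by (rule DERIV_continuous_on) (rule d, simp)
  have ig: "set_integrable lborel {0..} (\<lambda>t. exp (- \<alpha> * t) * g t)"
    by (rule laplace_integrable[OF \<alpha> continuous_set_borel[OF gc] g])
  have ih: "set_integrable lborel {0..} (\<lambda>t. exp (- \<alpha> * t) * h t)"
    by (rule laplace_integrable[OF \<alpha> continuous_set_borel[OF h(1)] h(2)])
  \<comment> \<open>\<open>k\<close> is the derivative of
    \<open>- exp (- \<alpha> * t) * g t\<close>.\<close>
  define k where "k t = (\<alpha> + q) * (exp (- \<alpha> * t) * g t) - exp (- \<alpha> * t) * h t" for t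
  have ik: "set_integrable lborel {0..} k"
    unfolding k_def by (intro set_integral_diff(1) set_integrable_mult_right ig ih)
  have val: "(LINT t:{0..}|lborel. k t) = (\<alpha> + q) * laplace g \<alpha> - laplace h \<alpha>"
    using set_integral_diff(2)[OF set_integrable_mult_right[OF ig] ih, of "\<alpha> + q"]
    unfolding k_def laplace_def by simp
  have fin: "(LINT t:{0..T}|lborel. k t) = g 0 - exp (- \<alpha> * T) * g T" if "T \<ge> 0" for T
  proof -
    have "(\<integral>t. indicator {0..T} t *\<^sub>R k t \<partial>lborel) = (- exp (- \<alpha> * T) * g T) - (- exp (- \<alpha> * 0) * g 0)"
    proof (rule integral_FTC_Icc[OF that])
      fix t assume t: "0 \<le> t" "t \<le> T"
      have "(g has_real_derivative - q * g t + h t) (at t within {0..T})"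
        using d[OF t(1)] by (rule DERIV_subset) auto
      then have "((\<lambda>t. - exp (- \<alpha> * t) * g t) has_real_derivative k t) (at t within {0..T})"
        unfolding k_def by (auto intro!: derivative_eq_intros simp: algebra_simps)
      then show "((\<lambda>t. - exp (- \<alpha> * t) * g t) has_vector_derivative k t) (at t within {0..T})"
        by (simp add: has_real_derivative_iff_has_vector_derivative)
    next
      show "continuous_on {0..T} k" unfolding k_def
        by (intro continuous_intros continuous_on_subset[OF gc] continuous_on_subset[OF h(1)]) auto
    qed
    then show ?thesis by (simp add: set_lebesgue_integral_def)
  qed
  have l1: "((\<lambda>T. LINT t:{0..T}|lborel. k t) \<longlongrightarrow> (LINT t:{0..}|lborel. k t)) at_top"
    by (rule tendsto_set_lebesgue_integral_at_top[OF _ ik]) simp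
  have "((\<lambda>T. exp (- \<alpha> * T) * g T) \<longlongrightarrow> 0) at_top"
  proof (rule Lim_null_comparison[where g = "\<lambda>T. exp (- \<alpha> * T) * C'"])
    show "\<forall>\<^sub>F T in at_top. norm (exp (- \<alpha> * T) * g T) \<le> exp (- \<alpha> * T) * C'"
      using eventually_ge_at_top[of 0] by eventually_elim (auto simp: abs_mult g)
    have "((\<lambda>T. exp (- \<alpha> * T)) \<longlongrightarrow> 0) at_top"
      using \<alpha> by (intro filterlim_compose[OF exp_at_bot] filterlim_tendsto_neg_mult_at_bot[OF tendsto_const] filterlim_ident) auto
    then show "((\<lambda>T. exp (- \<alpha> * T) * C') \<longlongrightarrow> 0) at_top" by (rule tendsto_mult_left_zero)
  qed
  then have "((\<lambda>T. g 0 - exp (- \<alpha> * T) * g T) \<longlongrightarrow> g 0 - 0) at_top"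
    by (intro tendsto_diff tendsto_const)
  then have l2: "((\<lambda>T. LINT t:{0..T}|lborel. k t) \<longlongrightarrow> g 0) at_top"
    unfolding diff_zero by (rule Lim_transform_eventually) (use fin in \<open>auto intro: eventually_mono[OF eventually_ge_at_top[of 0]]\<close>)
  have "(LINT t:{0..}|lborel. k t) = g 0"
    using tendsto_unique[OF _ l1 l2] by simp
  with val show ?thesis by simp
qed

section \<open>Feller's iteration for the backward equation\<close>

context bd_matrix
begin

text \<open>At \<open>i = 0\<close> the truncated \<open>i - 1\<close> is again 0, but then the term
  carries the factor \<open>a 0 = 0\<close>.\<close>

lemma bd_Q_sum: "(\<Sum>k. bd_Q a b i k * x k) = - (a i + b i) * x i + (a i * x (i - 1) + b i * x (i + 1))"
proof -
  have "(\<Sum>k. bd_Q a b i k * x k) = (\<Sum>k\<in>{i - 1, i, i + 1}. bd_Q a b i k * x k)"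
    by (rule suminf_finite) (auto simp: bd_Q_def)
  also have "\<dots> = - (a i + b i) * x i + (a i * x (i - 1) + b i * x (i + 1))"
    using a0 by (cases i) (auto simp: bd_Q_def)
  finally show ?thesis .
qed

text \<open>\<open>iterate n i j t\<close> is the probability of being in \<open>j\<close> at time \<open>t\<close> after fewer than \<open>n\<close> jumps.\<close>

primrec iterate :: "nat \<Rightarrow> nat \<Rightarrow> nat \<Rightarrow> real \<Rightarrow> real" where
  "iterate 0 i j t = 0"
| "iterate (Suc n) i j t = exp (- (a i + b i) * t) * (of_bool (i = j) +
     integral {0..t} (\<lambda>s. exp ((a i + b i) * s) * (a i * iterate n (i - 1) j s + b i * iterate n (i + 1) j s)))"

lemma iterate_continuous: "continuous_on {0..} (iterate n i j)"
proof (induction n arbitrary: i)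
  case (Suc n)
  show ?case unfolding iterate.simps
    by (intro duhamel_continuous continuous_intros Suc)
qed simp

lemma inflow_continuous: "continuous_on A (\<lambda>s. a i * iterate n (i - 1) j s + b i * iterate n (i + 1) j s)" if "A \<subseteq> {0..}"
  by (intro continuous_intros continuous_on_subset[OF iterate_continuous] that)

lemma inflow_integrable: "(\<lambda>s. exp ((a i + b i) * s) * (a i * iterate n (i - 1) j s + b i * iterate n (i + 1) j s)) integrable_on {0..t}"
  by (intro integrable_continuous_real continuous_on_mult inflow_continuous continuous_intros) auto

lemma iterate_nonneg: "t \<ge> 0 \<Longrightarrow> iterate n i j t \<ge> 0"
proof (induction n arbitrary: i t)
  case (Suc n)
  have "0 \<le> integral {0..t} (\<lambda>s. exp ((a i + b i) * s) * (a i * iterate n (i - 1) j s + b i * iterate n (i + 1) j s))"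
    by (intro integral_nonneg inflow_integrable)
       (auto intro!: mult_nonneg_nonneg add_nonneg_nonneg a_nonneg less_imp_le[OF b_pos] Suc.IH)
  then show ?case by simp
qed simp

lemma iterate_mono: "t \<ge> 0 \<Longrightarrow> iterate n i j t \<le> iterate (Suc n) i j t"
proof (induction n arbitrary: i t)
  case 0 then show ?case by (simp only: iterate_nonneg iterate.simps(1))
next
  case (Suc n)
  have "integral {0..t} (\<lambda>s. exp ((a i + b i) * s) * (a i * iterate n (i - 1) j s + b i * iterate n (i + 1) j s))
     \<le> integral {0..t} (\<lambda>s. exp ((a i + b i) * s) * (a i * iterate (Suc n) (i - 1) j s + b i * iterate (Suc n) (i + 1) j s))"
    by (intro integral_le inflow_integrable)
       (auto intro!: mult_left_mono add_mono a_nonneg less_imp_le[OF b_pos] Suc.IH simp del: iterate.simps)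
  then show ?case unfolding iterate.simps(2)[of n] iterate.simps(2)[of "Suc n"] by simp
qed

text \<open>By induction the inflow at \<open>i\<close>, summed over \<open>J\<close>, is at most
  \<open>a i + b i\<close>; with this inflow and initial mass 1 the variation of constants formula
  returns the constant 1.\<close>

lemma iterate_row_le_1: "t \<ge> 0 \<Longrightarrow> finite J \<Longrightarrow> (\<Sum>j\<in>J. iterate n i j t) \<le> 1"
proof (induction n arbitrary: i t)
  case (Suc n)
  define q where "q = a i + b i"
  have q: "q > 0" using a_nonneg[of i] b_pos[of i] by (simp add: q_def)
  let ?h = "\<lambda>j s. exp (q * s) * (a i * iterate n (i - 1) j s + b i * iterate n (i + 1) j s)"
  have int: "?h j integrable_on {0..t}" for j using inflow_integrable by (simp add: q_def)
  have "(\<Sum>j\<in>J. integral {0..t} (?h j)) = integral {0..t} (\<lambda>s. \<Sum>j\<in>J. ?h j s)"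
    using Suc.prems int by (simp add: integral_sum)
  also have "\<dots> \<le> integral {0..t} (\<lambda>s. exp (q * s) * q)"
  proof (rule integral_le)
    show "(\<lambda>s. \<Sum>j\<in>J. ?h j s) integrable_on {0..t}" by (intro integrable_sum int Suc)
    show "(\<lambda>s. exp (q * s) * q) integrable_on {0..t}" by (intro integrable_continuous_real continuous_intros)
    fix s assume "s \<in> {0..t}"
    then have "(\<Sum>j\<in>J. iterate n k j s) \<le> 1" for k using Suc by simp
    then have "a i * (\<Sum>j\<in>J. iterate n (i - 1) j s) + b i * (\<Sum>j\<in>J. iterate n (i + 1) j s) \<le> a i * 1 + b i * 1"
      by (intro add_mono mult_left_mono a_nonneg less_imp_le[OF b_pos])
    then have "exp (q * s) * (a i * (\<Sum>j\<in>J. iterate n (i - 1) j s) + b i * (\<Sum>j\<in>J. iterate n (i + 1) j s)) \<le> exp (q * s) * q"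
      by (simp add: q_def)
    then show "(\<Sum>j\<in>J. ?h j s) \<le> exp (q * s) * q"
      by (simp add: sum_distrib_left sum.distrib[symmetric] distrib_left mult.assoc)
  qed
  also have "\<dots> = exp (q * t) - 1"
  proof -
    have "((\<lambda>s. exp (q * s) * q) has_integral (exp (q * t) - exp (q * 0))) {0..t}"
      by (rule fundamental_theorem_of_calculus[OF Suc.prems(1)])
         (auto intro!: derivative_eq_intros simp: has_real_derivative_iff_has_vector_derivative[symmetric])
    then show ?thesis by (simp only: integral_unique) simp
  qed
  finally have I: "(\<Sum>j\<in>J. integral {0..t} (?h j)) \<le> exp (q * t) - 1" .
  have D: "(\<Sum>j\<in>J. of_bool (i = j)) \<le> (1::real)"
    using Suc.prems by (simp add: of_bool_def sum.delta')
  have "(\<Sum>j\<in>J. iterate (Suc n) i j t) = exp (- q * t) * ((\<Sum>j\<in>J. of_bool (i = j)) + (\<Sum>j\<in>J. integral {0..t} (?h j)))"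
    by (simp add: q_def sum_distrib_left[symmetric] sum.distrib[symmetric] del: sum_of_bool_eq)
  also have "\<dots> \<le> exp (- q * t) * (1 + (exp (q * t) - 1))"
    by (intro mult_left_mono add_mono I D) auto
  also have "\<dots> = 1" by (simp add: exp_minus field_simps)
  finally show ?case .
qed simp

lemma iterate_le_1: "t \<ge> 0 \<Longrightarrow> iterate n i j t \<le> 1"
  using iterate_row_le_1[of t "{j}"] by simp

text \<open>The limit of the increasing iterates. It serves as a solution of the backward equation
  with explicit bounds: by minimality \<open>pmin\<close> lies below it and inherits them.\<close>

definition feller :: "nat \<Rightarrow> nat \<Rightarrow> real \<Rightarrow> real" where
  "feller i j t = (SUP n. iterate n i j t)"

lemma feller_tendsto: "t \<ge> 0 \<Longrightarrow> (\<lambda>n. iterate n i j t) \<longlonglongrightarrow> feller i j t"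
  unfolding feller_def
  by (rule LIMSEQ_incseq_SUP) (auto intro!: bdd_aboveI[of _ 1] iterate_le_1 incseq_SucI iterate_mono simp del: iterate.simps)

lemma feller_nonneg: "t \<ge> 0 \<Longrightarrow> feller i j t \<ge> 0"
  by (rule LIMSEQ_le_const[OF feller_tendsto]) (auto intro: iterate_nonneg)

lemma feller_row_le_1: "t \<ge> 0 \<Longrightarrow> finite J \<Longrightarrow> (\<Sum>j\<in>J. feller i j t) \<le> 1"
  by (rule LIMSEQ_le_const2[OF tendsto_sum[OF feller_tendsto]]) (auto intro: iterate_row_le_1)

lemma feller_le_1: "t \<ge> 0 \<Longrightarrow> feller i j t \<le> 1"
  using feller_row_le_1[of t "{j}"] by simp

text \<open>The integral recursion passes to the limit by dominated convergence, the inflow being at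
  most \<open>a i + b i\<close>.\<close>

lemma feller_equation:
  assumes t: "t \<ge> 0"
  shows "(\<lambda>s. exp ((a i + b i) * s) * (a i * feller (i - 1) j s + b i * feller (i + 1) j s)) integrable_on {0..t}" (is "?g integrable_on _")
    and "feller i j t = exp (- (a i + b i) * t) * (of_bool (i = j) +
      integral {0..t} (\<lambda>s. exp ((a i + b i) * s) * (a i * feller (i - 1) j s + b i * feller (i + 1) j s)))"
proof -
  let ?f = "\<lambda>n s. exp ((a i + b i) * s) * (a i * iterate n (i - 1) j s + b i * iterate n (i + 1) j s)"
  let ?B = "\<lambda>s. exp ((a i + b i) * s) * (a i * 1 + b i * 1)"
  have B: "?B integrable_on {0..t}" by (intro integrable_continuous_real continuous_intros)
  have le: "norm (?f n s) \<le> ?B s" if "s \<in> {0..t}" for n s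
  proof -
    have "0 \<le> a i * iterate n (i - 1) j s + b i * iterate n (i + 1) j s"
      using that by (intro add_nonneg_nonneg mult_nonneg_nonneg a_nonneg less_imp_le[OF b_pos] iterate_nonneg) auto
    moreover have "a i * iterate n (i - 1) j s + b i * iterate n (i + 1) j s \<le> a i * 1 + b i * 1"
      using that by (intro add_mono mult_left_mono a_nonneg less_imp_le[OF b_pos] iterate_le_1) auto
    ultimately show ?thesis by (simp add: abs_mult)
  qed
  have lim: "(\<lambda>n. ?f n s) \<longlonglongrightarrow> ?g s" if "s \<in> {0..t}" for s
    using that by (intro tendsto_intros feller_tendsto) auto
  note dc = dominated_convergence[OF inflow_integrable B le lim]
  show "?g integrable_on {0..t}" by (rule dc(1))
  have "(\<lambda>n. iterate (Suc n) i j t) \<longlonglongrightarrow> exp (- (a i + b i) * t) * (of_bool (i = j) + integral {0..t} ?g)"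
    unfolding iterate.simps by (intro tendsto_intros dc(2))
  moreover have "(\<lambda>n. iterate (Suc n) i j t) \<longlonglongrightarrow> feller i j t"
    by (rule LIMSEQ_Suc[OF feller_tendsto[OF t]])
  ultimately show "feller i j t = exp (- (a i + b i) * t) * (of_bool (i = j) + integral {0..t} ?g)"
    using LIMSEQ_unique by blast
qed

text \<open>Continuity comes from the integral equation, as indefinite integrals are continuous. It
  makes the integrand continuous, so that the equation can then be differentiated.\<close>

lemma feller_continuous: "continuous_on {0..} (feller i j)"
proof -
  have T: "continuous_on {0..T} (feller i j)" if "T \<ge> 0" for T
  proof -
    have "continuous_on {0..T} (\<lambda>t. exp (- (a i + b i) * t) * (of_bool (i = j) +
      integral {0..t} (\<lambda>s. exp ((a i + b i) * s) * (a i * feller (i - 1) j s + b i * feller (i + 1) j s))))"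
      by (intro continuous_intros indefinite_integral_continuous_1 feller_equation(1) that)
    then show ?thesis
      by (subst continuous_on_cong[OF refl, where g = "\<lambda>t. exp (- (a i + b i) * t) * (of_bool (i = j) + integral {0..t} (\<lambda>s. exp ((a i + b i) * s) * (a i * feller (i - 1) j s + b i * feller (i + 1) j s)))"])
       (rule feller_equation(2), simp)
  qed
  show ?thesis unfolding continuous_on_eq_continuous_within
  proof
    fix x :: real assume x: "x \<in> {0..}"
    have "continuous (at x within {0..x+1}) (feller i j)"
      using T[of "x+1"] x by (auto simp: continuous_on_eq_continuous_within)
    moreover have "at x within {0..} = at x within {0..x + 1}"
      by (rule at_within_nhd[of x "{..<x+1}"]) auto
    ultimately show "continuous (at x within {0..}) (feller i j)" by simp
  qed
qed

lemma feller_derivative: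
  assumes t: "t \<ge> 0"
  shows "(feller i j has_real_derivative - (a i + b i) * feller i j t + (a i * feller (i - 1) j t + b i * feller (i + 1) j t)) (at t within {0..})"
proof -
  let ?G = "\<lambda>t. exp (- (a i + b i) * t) * (of_bool (i = j) +
      integral {0..t} (\<lambda>s. exp ((a i + b i) * s) * (a i * feller (i - 1) j s + b i * feller (i + 1) j s)))"
  have "(?G has_real_derivative - (a i + b i) * ?G t + (a i * feller (i - 1) j t + b i * feller (i + 1) j t)) (at t within {0..})"
    by (rule duhamel_derivative[OF _ t]) (intro continuous_intros feller_continuous)
  then show ?thesis
    unfolding feller_equation(2)[OF t, of i j, symmetric]
    by (rule has_field_derivative_transform_within[OF _ zero_less_one]) (use t feller_equation(2) in auto)
qed

lemma feller_backward: "backward_solution a b feller"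
  unfolding backward_solution_def bd_Q_sum
proof (intro conjI allI impI)
  fix i j show "feller i j 0 = of_bool (i = j)"
    using feller_equation(2)[of 0 i j] by simp
qed (use feller_nonneg feller_derivative in auto)

text \<open>The Laplace transform turns the integral recursion into an algebraic one, to which
  comparison arguments apply.\<close>

lemma iterate_laplace:
  assumes "\<alpha> > 0"
  shows "(\<alpha> + (a i + b i)) * laplace (iterate (Suc n) i j) \<alpha> =
     of_bool (i = j) + (a i * laplace (iterate n (i - 1) j) \<alpha> + b i * laplace (iterate n (i + 1) j) \<alpha>)"
proof -
  let ?h = "\<lambda>s. a i * iterate n (i - 1) j s + b i * iterate n (i + 1) j s"
  have ii: "set_integrable lborel {0..} (\<lambda>t. exp (- \<alpha> * t) * iterate n k j t)" for k
    by (rule laplace_integrable[OF assms continuous_set_borel[OF iterate_continuous], of _ _ _ 1])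
       (auto simp: iterate_nonneg iterate_le_1)
  have "(\<alpha> + (a i + b i)) * laplace (iterate (Suc n) i j) \<alpha> = iterate (Suc n) i j 0 + laplace ?h \<alpha>"
  proof (rule laplace_duhamel[OF assms])
    fix t :: real assume t: "t \<ge> 0"
    show "(iterate (Suc n) i j has_real_derivative - (a i + b i) * iterate (Suc n) i j t + ?h t) (at t within {0..})"
      unfolding iterate.simps by (rule duhamel_derivative[OF inflow_continuous t]) auto
    have "0 \<le> ?h t" using t
      by (intro add_nonneg_nonneg mult_nonneg_nonneg a_nonneg less_imp_le[OF b_pos] iterate_nonneg) auto
    moreover have "?h t \<le> a i * 1 + b i * 1"
      using t by (intro add_mono mult_left_mono a_nonneg less_imp_le[OF b_pos] iterate_le_1) auto
    ultimately show "\<bar>?h t\<bar> \<le> a i * 1 + b i * 1" by simp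
    show "\<bar>iterate (Suc n) i j t\<bar> \<le> 1" using iterate_nonneg[OF t, of "Suc n"] iterate_le_1[OF t, of "Suc n"] by (simp del: iterate.simps)
  qed (rule inflow_continuous, simp)
  also have "laplace ?h \<alpha> = a i * laplace (iterate n (i - 1) j) \<alpha> + b i * laplace (iterate n (i + 1) j) \<alpha>"
    using set_integral_add(2)[OF set_integrable_mult_right[OF ii] set_integrable_mult_right[OF ii], of "a i" "i - 1" "b i" "i + 1"]
    unfolding laplace_def by (simp add: algebra_simps)
  also have "iterate (Suc n) i j 0 = of_bool (i = j)" by simp
  finally show ?thesis .
qed

text \<open>A maximum principle by induction on the number of jumps: the transforms start at 0 and
  satisfy with equality the recursion that \<open>\<phi>\<close> satisfies as an inequality, so they
  stay below \<open>\<phi>\<close>.\<close>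

lemma iterate_laplace_le:
  assumes "\<alpha> > 0" "finite J" and \<phi>: "\<And>i. \<phi> i \<ge> 0"
    and super: "\<And>i. (\<alpha> + (a i + b i)) * \<phi> i \<ge> 1 + (a i * \<phi> (i - 1) + b i * \<phi> (i + 1))"
  shows "(\<Sum>j\<in>J. laplace (iterate n i j) \<alpha>) \<le> \<phi> i"
proof (induction n arbitrary: i)
  case 0 then show ?case using \<phi> by (simp add: laplace_def)
next
  case (Suc n)
  have pos: "\<alpha> + (a i + b i) > 0" using assms(1) a_nonneg[of i] b_pos[of i] by linarith
  have "(\<alpha> + (a i + b i)) * (\<Sum>j\<in>J. laplace (iterate (Suc n) i j) \<alpha>) =
      (\<Sum>j\<in>J. of_bool (i = j)) + (a i * (\<Sum>j\<in>J. laplace (iterate n (i - 1) j) \<alpha>) + b i * (\<Sum>j\<in>J. laplace (iterate n (i + 1) j) \<alpha>))"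
    unfolding sum_distrib_left iterate_laplace[OF assms(1)] sum.distrib ..
  also have "\<dots> \<le> 1 + (a i * \<phi> (i - 1) + b i * \<phi> (i + 1))"
    using assms(2) by (intro add_mono mult_left_mono Suc a_nonneg less_imp_le[OF b_pos]) (simp add: of_bool_def sum.delta')
  also have "\<dots> \<le> (\<alpha> + (a i + b i)) * \<phi> i" by (rule super)
  finally show ?case using pos by (simp del: iterate.simps)
qed

lemma feller_laplace_le:
  assumes "\<alpha> > 0" "finite J" and \<phi>: "\<And>i. \<phi> i \<ge> 0"
    and super: "\<And>i. (\<alpha> + (a i + b i)) * \<phi> i \<ge> 1 + (a i * \<phi> (i - 1) + b i * \<phi> (i + 1))"
  shows "(\<Sum>j\<in>J. laplace (feller i j) \<alpha>) \<le> \<phi> i"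
proof (rule LIMSEQ_le_const2[OF tendsto_sum])
  fix j
  show "(\<lambda>n. laplace (iterate n i j) \<alpha>) \<longlonglongrightarrow> laplace (feller i j) \<alpha>"
    by (rule laplace_tendsto[OF assms(1) iterate_continuous _ feller_continuous feller_tendsto])
      (simp_all add: iterate_nonneg iterate_le_1 abs_of_nonneg)
qed (use iterate_laplace_le[OF assms] in auto)

section \<open>Scale increments, speed measure and the increasing harmonic function\<close>

definition dc :: "nat \<Rightarrow> real" where "dc k = bd_c a b (k + 1) - bd_c a b k"

abbreviation mu :: "nat \<Rightarrow> real" where "mu \<equiv> bd_mu a b"

lemma mu_pos: "mu k > 0"
  unfolding bd_mu_def by (intro divide_pos_pos prod_pos) (auto intro: a_pos b_pos)

lemma dc_eq: "dc k = (\<Prod>m=1..k. a m) / (2 * (\<Prod>m<Suc k. b m))"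
  by (cases k) (auto simp: dc_def bd_c_def atLeastLessThanSuc_atLeastAtMost)

lemma dc_pos: "dc k > 0"
  unfolding dc_eq by (intro divide_pos_pos mult_pos_pos prod_pos) (auto intro: a_pos b_pos)

text \<open>\<open>bd_c\<close> is half of the natural scale. This is the origin of the factor 2
  here and in the recursion for \<open>harm\<close>.\<close>

lemma dc_mu: "2 * dc k * b k = 1 / mu k"
proof -
  have "(\<Prod>m=1..k. a m) > 0" "(\<Prod>m<k. b m) > 0" by (intro prod_pos; auto intro: a_pos b_pos)+
  then show ?thesis using b_pos[of k] by (simp add: dc_eq bd_mu_def field_simps)
qed

text \<open>Detailed balance: \<open>mu\<close> is the reversing measure.\<close>

lemma mu_Suc: "mu (Suc k) * a (Suc k) = mu k * b k"
proof -
  have "(\<Prod>m=1..k. a m) > 0" by (intro prod_pos) (auto intro: a_pos)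
  then show ?thesis using a_pos[of "Suc k"] by (simp add: bd_mu_def field_simps)
qed

text \<open>\<open>harm \<alpha>\<close> consists of the increasing \<open>\<alpha>\<close>-harmonic function with value 1 at 0
  and of its \<open>\<mu>\<close>-weighted partial sums.\<close>

primrec harm :: "real \<Rightarrow> nat \<Rightarrow> real \<times> real" where
  "harm \<alpha> 0 = (1, mu 0)"
| "harm \<alpha> (Suc k) = (let u = fst (harm \<alpha> k) + 2 * \<alpha> * dc k * snd (harm \<alpha> k) in (u, snd (harm \<alpha> k) + mu (Suc k) * u))"

abbreviation U :: "real \<Rightarrow> nat \<Rightarrow> real" where "U \<alpha> k \<equiv> fst (harm \<alpha> k)"

lemma U_Suc: "U \<alpha> (Suc k) = U \<alpha> k + 2 * \<alpha> * dc k * (\<Sum>j\<le>k. mu j * U \<alpha> j)"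
proof -
  have "snd (harm \<alpha> k) = (\<Sum>j\<le>k. mu j * U \<alpha> j)"
    by (induction k) (auto simp: Let_def)
  then show ?thesis by (simp add: Let_def)
qed

lemma U_ge_1: "\<alpha> > 0 \<Longrightarrow> U \<alpha> k \<ge> 1"
proof (induction k rule: less_induct)
  case (less k)
  show ?case
  proof (cases k)
    case (Suc m)
    have "0 \<le> 2 * \<alpha> * dc m * (\<Sum>j\<le>m. mu j * U \<alpha> j)"
    proof (intro mult_nonneg_nonneg sum_nonneg)
      fix j assume "j \<in> {..m}"
      then show "0 \<le> U \<alpha> j" using less.IH[of j] Suc less.prems by fastforce
    qed (use less.prems dc_pos mu_pos in \<open>auto intro: less_imp_le\<close>)
    moreover have "U \<alpha> m \<ge> 1" using less Suc by simp
    ultimately show ?thesis unfolding Suc U_Suc by linarith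
  qed simp
qed

lemma U_nonneg: "\<alpha> > 0 \<Longrightarrow> U \<alpha> k \<ge> 0"
  using U_ge_1[of \<alpha> k] by linarith

lemma U_mono: assumes "\<alpha> > 0" shows "incseq (U \<alpha>)"
proof (rule incseq_SucI)
  fix k
  have "0 \<le> 2 * \<alpha> * dc k * (\<Sum>j\<le>k. mu j * U \<alpha> j)"
    using assms by (intro mult_nonneg_nonneg sum_nonneg) (auto intro: less_imp_le mu_pos dc_pos U_nonneg)
  then show "U \<alpha> k \<le> U \<alpha> (Suc k)" unfolding U_Suc by linarith
qed

text \<open>The flow \<open>mu k * b k * (U \<alpha> (Suc k) - U \<alpha> k)\<close> equals
  \<open>\<alpha>\<close> times the weighted partial sum up to \<open>k\<close>. The flows on the
  two sides of \<open>k\<close> therefore differ by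
  \<open>\<alpha> * mu k * U \<alpha> k\<close>.\<close>

lemma U_harmonic: "\<alpha> * U \<alpha> k = a k * (U \<alpha> (k - 1) - U \<alpha> k) + b k * (U \<alpha> (Suc k) - U \<alpha> k)"
proof -
  have up: "b k * (U \<alpha> (Suc k) - U \<alpha> k) = \<alpha> * (\<Sum>j\<le>k. mu j * U \<alpha> j) / mu k"
  proof -
    have "b k * (U \<alpha> (Suc k) - U \<alpha> k) = \<alpha> * (\<Sum>j\<le>k. mu j * U \<alpha> j) * (2 * dc k * b k)"
      unfolding U_Suc by (simp add: mult_ac)
    then show ?thesis unfolding dc_mu by simp
  qed
  show ?thesis
  proof (cases k)
    case 0
    have "mu 0 \<noteq> 0" using mu_pos[of 0] by simp
    then show ?thesis using up 0 a0 by simp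
  next
    case (Suc m)
    have mk: "mu k > 0" "mu m > 0" by (rule mu_pos)+
    \<comment> \<open>By detailed balance \<open>mu k * a k = mu m * b m\<close>, so the downward
      step is the flow across the edge from \<open>m\<close>.\<close>
    have "a k * (U \<alpha> k - U \<alpha> m) = (mu k * a k) * (2 * \<alpha> * dc m * (\<Sum>j\<le>m. mu j * U \<alpha> j)) / mu k"
      using mk unfolding Suc U_Suc by simp
    also have "\<dots> = \<alpha> * (\<Sum>j\<le>m. mu j * U \<alpha> j) * (2 * dc m * b m) * mu m / mu k"
      unfolding Suc mu_Suc by (simp add: mult_ac)
    also have "\<dots> = \<alpha> * (\<Sum>j\<le>m. mu j * U \<alpha> j) / mu k" unfolding dc_mu using mk by simp
    finally have down: "a k * (U \<alpha> k - U \<alpha> m) = \<alpha> * (\<Sum>j\<le>m. mu j * U \<alpha> j) / mu k" .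
    have "b k * (U \<alpha> (Suc k) - U \<alpha> k) - a k * (U \<alpha> k - U \<alpha> m) = \<alpha> * (mu k * U \<alpha> k) / mu k"
      unfolding up down using Suc by (simp add: diff_divide_distrib[symmetric] right_diff_distrib[symmetric] del: harm.simps)
    then show ?thesis using Suc mk by (simp add: algebra_simps del: harm.simps)
  qed
qed

definition tail_term :: "nat \<Rightarrow> real" where "tail_term k = dc k * (\<Sum>i\<le>k. mu i)"

lemma tail_term_nonneg: "tail_term k \<ge> 0"
  unfolding tail_term_def by (intro mult_nonneg_nonneg sum_nonneg) (auto intro: less_imp_le dc_pos mu_pos)

text \<open>As \<open>U\<close> increases, each \<open>U \<alpha> j\<close> in the partial sum may
  be replaced by \<open>U \<alpha> k\<close>; what remains is a term of the series for
  \<open>R\<close>.\<close>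

lemma U_step: assumes "\<alpha> > 0" shows "U \<alpha> (Suc k) - U \<alpha> k \<le> 2 * \<alpha> * U \<alpha> k * tail_term k"
proof -
  have "(\<Sum>j\<le>k. mu j * U \<alpha> j) \<le> (\<Sum>j\<le>k. mu j * U \<alpha> k)"
    by (intro sum_mono mult_left_mono incseqD[OF U_mono[OF assms]]) (auto intro: less_imp_le mu_pos)
  also have "\<dots> = U \<alpha> k * (\<Sum>j\<le>k. mu j)" by (simp only: mult.commute[of "U \<alpha> k"] sum_distrib_right)
  finally have "2 * \<alpha> * dc k * (\<Sum>j\<le>k. mu j * U \<alpha> j) \<le> 2 * \<alpha> * dc k * (U \<alpha> k * (\<Sum>j\<le>k. mu j))"
    using assms less_imp_le[OF dc_pos[of k]] by (intro mult_left_mono) auto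
  then show ?thesis unfolding U_Suc tail_term_def by (simp add: mult_ac)
qed

end

section \<open>Bounded harmonic functions when \<open>R\<close> is finite\<close>

locale bd_accessible = bd_matrix +
  assumes R: "bd_R a b < \<infinity>"
begin

lemma tail_term_summable: "summable tail_term"
proof -
  have "(\<Sum>k. ennreal (tail_term k)) \<noteq> \<infinity>"
    using R unfolding bd_R_def tail_term_def dc_def by simp
  then show ?thesis by (intro summable_suminf_not_top) (auto simp: tail_term_nonneg)
qed

text \<open>A discrete Gronwall bound: every step multiplies \<open>U\<close> by at most
  \<open>1 + 2 * \<alpha> * tail_term k\<close>, and finiteness of \<open>R\<close> keeps the
  product bounded.\<close>

lemma U_bounded: assumes "\<alpha> > 0" shows "U \<alpha> k \<le> exp (2 * \<alpha> * suminf tail_term)"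
proof -
  have "U \<alpha> k \<le> exp (2 * \<alpha> * (\<Sum>j<k. tail_term j))"
  proof (induction k)
    case (Suc k)
    have "U \<alpha> (Suc k) \<le> U \<alpha> k * (1 + 2 * \<alpha> * tail_term k)" using U_step[OF assms, of k] by (simp add: algebra_simps del: harm.simps)
    also have "\<dots> \<le> exp (2 * \<alpha> * (\<Sum>j<k. tail_term j)) * exp (2 * \<alpha> * tail_term k)"
      using assms tail_term_nonneg[of k] exp_ge_add_one_self[of "2 * \<alpha> * tail_term k"]
      by (intro mult_mono Suc) auto
    finally show ?case by (simp add: exp_add[symmetric] algebra_simps del: harm.simps)
  qed simp
  also have "\<dots> \<le> exp (2 * \<alpha> * suminf tail_term)"
    using assms by (simp add: sum_le_suminf[OF tail_term_summable] tail_term_nonneg)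
  finally show ?thesis .
qed

definition U_inf :: "real \<Rightarrow> real" where "U_inf \<alpha> = lim (U \<alpha>)"

lemma U_tendsto: assumes "\<alpha> > 0" shows "U \<alpha> \<longlonglongrightarrow> U_inf \<alpha>"
proof -
  have "convergent (U \<alpha>)"
    by (rule Bseq_mono_convergent[OF BseqI']) (use U_bounded[OF assms] U_nonneg[OF assms] incseqD[OF U_mono[OF assms]] in auto)
  then show ?thesis unfolding U_inf_def by (simp add: convergent_LIMSEQ_iff)
qed

lemma U_le_inf: "\<alpha> > 0 \<Longrightarrow> U \<alpha> k \<le> U_inf \<alpha>"
  by (rule incseq_le[OF U_mono U_tendsto])

lemma U_inf_pos: "\<alpha> > 0 \<Longrightarrow> U_inf \<alpha> > 0"
  using U_le_inf[of \<alpha> 0] U_ge_1[of \<alpha> 0] by linarith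

text \<open>The harmonic function normalised to the limit 1 at infinity. It enters as an explicit
  lower bound for \<open>u\<close>.\<close>

definition v :: "real \<Rightarrow> nat \<Rightarrow> real" where "v \<alpha> k = U \<alpha> k / U_inf \<alpha>"

lemma v_bounds: assumes "\<alpha> > 0" shows "0 < v \<alpha> k" "v \<alpha> k \<le> 1"
  using U_inf_pos[OF assms] U_le_inf[OF assms, of k] U_ge_1[OF assms, of k] by (auto simp: v_def)

text \<open>\<open>1 - v \<alpha> k\<close> is the telescoping sum of the increments from
  \<open>k\<close> on, each at most \<open>2 * \<alpha>\<close> times a term of the tail. The bound
  is stated in \<open>ennreal\<close> because \<open>bd_tail\<close> takes its values there.\<close>

lemma v_tail: assumes "\<alpha> > 0" shows "ennreal (1 - v \<alpha> k) \<le> ennreal (2 * \<alpha>) * bd_tail a b k"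
proof -
  have tl: "(\<lambda>j. v \<alpha> (k + j)) \<longlonglongrightarrow> 1"
  proof -
    have "(\<lambda>j. U \<alpha> (j + k) / U_inf \<alpha>) \<longlonglongrightarrow> U_inf \<alpha> / U_inf \<alpha>"
      by (rule tendsto_divide[OF LIMSEQ_ignore_initial_segment[OF U_tendsto[OF assms]] tendsto_const])
         (use U_inf_pos[OF assms] in simp)
    then show ?thesis using U_inf_pos[OF assms] by (simp add: v_def add.commute)
  qed
  have sums: "(\<lambda>j. v \<alpha> (k + Suc j) - v \<alpha> (k + j)) sums (1 - v \<alpha> k)"
    using telescope_sums[OF tl] by simp
  have st: "v \<alpha> (k + Suc j) - v \<alpha> (k + j) \<le> 2 * \<alpha> * tail_term (k + j)" for j
  proof -
    have "v \<alpha> (k + Suc j) - v \<alpha> (k + j) \<le> 2 * \<alpha> * v \<alpha> (k + j) * tail_term (k + j)"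
      using divide_right_mono[OF U_step[OF assms, of "k + j"] less_imp_le[OF U_inf_pos[OF assms]]]
      by (simp add: v_def diff_divide_distrib del: harm.simps)
    also have "\<dots> \<le> 2 * \<alpha> * 1 * tail_term (k + j)"
      using v_bounds[OF assms] assms by (intro mult_right_mono mult_left_mono tail_term_nonneg) auto
    finally show ?thesis by simp
  qed
  have inc: "0 \<le> v \<alpha> (k + Suc j) - v \<alpha> (k + j)" for j
    using incseqD[OF U_mono[OF assms], of "k + j" "k + Suc j"] U_inf_pos[OF assms]
    unfolding v_def by (simp add: divide_right_mono del: harm.simps)
  have "ennreal (1 - v \<alpha> k) = (\<Sum>j. ennreal (v \<alpha> (k + Suc j) - v \<alpha> (k + j)))"
    using sums inc by (subst suminf_ennreal2) (auto simp: sums_iff)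
  also have "\<dots> \<le> (\<Sum>j. ennreal (2 * \<alpha>) * ennreal (tail_term (k + j)))"
    using st assms tail_term_nonneg by (intro suminf_le) (auto simp: ennreal_mult[symmetric] intro!: ennreal_leI)
  also have "\<dots> = ennreal (2 * \<alpha>) * bd_tail a b k"
    by (simp add: bd_tail_def tail_term_def dc_def)
  finally show ?thesis .
qed

text \<open>Makes \<open>(1 - v) / \<alpha>\<close> an admissible \<open>\<phi>\<close> for
  \<open>feller_laplace_le\<close>, with equality.\<close>

lemma v_super:
  assumes "\<alpha> > 0"
  shows "(\<alpha> + (a i + b i)) * ((1 - v \<alpha> i) / \<alpha>) = 1 + (a i * ((1 - v \<alpha> (i - 1)) / \<alpha>) + b i * ((1 - v \<alpha> (i + 1)) / \<alpha>))"
proof -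
  have "\<alpha> * v \<alpha> i = a i * (v \<alpha> (i - 1) - v \<alpha> i) + b i * (v \<alpha> (i + 1) - v \<alpha> i)"
    using arg_cong[OF U_harmonic[of \<alpha> i], of "\<lambda>x. x / U_inf \<alpha>"] unfolding v_def
    by (simp add: right_diff_distrib add_divide_distrib diff_divide_distrib del: harm.simps)
  then show ?thesis using assms by (simp add: field_simps)
qed

end

section \<open>Resolvent of the minimal process\<close>

locale bd_minimal = bd_accessible +
  fixes pmin
  assumes pmin: "minimal_transition a b pmin"
begin

lemma pmin_nonneg: "t \<ge> 0 \<Longrightarrow> pmin i j t \<ge> 0"
  using pmin unfolding minimal_transition_def backward_solution_def by blast

lemma pmin_0: "pmin i j 0 = of_bool (i = j)"
  using pmin unfolding minimal_transition_def backward_solution_def by blast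

lemma pmin_le_feller: "t \<ge> 0 \<Longrightarrow> pmin i j t \<le> feller i j t"
  using pmin feller_backward unfolding minimal_transition_def by blast

lemma pmin_continuous: "continuous_on {0..} (pmin i j)"
proof (rule DERIV_continuous_on)
  fix t :: real assume "t \<in> {0..}"
  then show "(pmin i j has_real_derivative (\<Sum>k. bd_Q a b i k * pmin k j t)) (at t within {0..})"
    using pmin unfolding minimal_transition_def backward_solution_def by auto
qed

lemma pmin_row: "t \<ge> 0 \<Longrightarrow> finite J \<Longrightarrow> (\<Sum>j\<in>J. pmin i j t) \<le> 1"
  using order_trans[OF sum_mono[OF pmin_le_feller] feller_row_le_1] by blast

lemma pmin_le_1: "t \<ge> 0 \<Longrightarrow> pmin i j t \<le> 1"
  using pmin_row[of t "{j}"] by simp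

lemma pmin_integrable: "\<alpha> > 0 \<Longrightarrow> set_integrable lborel {0..} (\<lambda>t. exp (- \<alpha> * t) * pmin i j t)"
  by (rule laplace_integrable[OF _ continuous_set_borel[OF pmin_continuous], of _ _ _ 1]) (auto simp: pmin_nonneg pmin_le_1)

lemma resolvent_laplace: "resolvent p \<alpha> i j = laplace (p i j) \<alpha>"
  by (simp add: resolvent_def laplace_def)

abbreviation G :: "real \<Rightarrow> nat \<Rightarrow> nat \<Rightarrow> real" where "G \<alpha> \<equiv> resolvent pmin \<alpha>"

abbreviation u :: "real \<Rightarrow> nat \<Rightarrow> real" where "u \<alpha> \<equiv> u_fun pmin \<alpha>"

lemma G_nonneg: "\<alpha> > 0 \<Longrightarrow> G \<alpha> i j \<ge> 0"
  unfolding resolvent_def set_lebesgue_integral_def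
  by (rule Bochner_Integration.integral_nonneg) (auto simp: indicator_def pmin_nonneg)

text \<open>Stated for finite \<open>J\<close> because summability of the row of the resolvent is
  itself deduced from this bound.\<close>

lemma G_le: assumes "\<alpha> > 0" "finite J" shows "(\<Sum>j\<in>J. G \<alpha> i j) \<le> (1 - v \<alpha> i) / \<alpha>"
proof -
  have "(\<Sum>j\<in>J. G \<alpha> i j) \<le> (\<Sum>j\<in>J. laplace (feller i j) \<alpha>)"
    unfolding resolvent_laplace laplace_def
    using pmin_le_feller
    by (intro sum_mono set_integral_mono pmin_integrable laplace_integrable[OF _ continuous_set_borel[OF feller_continuous], of _ _ _ 1])
       (auto simp: assms feller_nonneg feller_le_1)
  also have "\<dots> \<le> (1 - v \<alpha> i) / \<alpha>"
    using v_bounds[OF assms(1)] v_super[OF assms(1)] assms by (intro feller_laplace_le) auto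
  finally show ?thesis .
qed

lemma G_summable: "\<alpha> > 0 \<Longrightarrow> summable (G \<alpha> i)"
  by (rule summableI_nonneg_bounded[OF G_nonneg G_le]) auto

lemma G_sum: assumes "\<alpha> > 0" shows "(\<Sum>j. G \<alpha> i j) = (1 - u \<alpha> i) / \<alpha>"
  using assms by (simp add: u_fun_def)

lemma u_ge_v: assumes "\<alpha> > 0" shows "v \<alpha> i \<le> u \<alpha> i"
proof -
  have "(\<Sum>j. G \<alpha> i j) \<le> (1 - v \<alpha> i) / \<alpha>"
    by (intro suminf_le_const G_summable assms) (use G_le[OF assms] in auto)
  then show ?thesis using assms by (simp add: u_fun_def field_simps)
qed

text \<open>\<open>pmin i i\<close> starts at 1 and is continuous, so it contributes near time 0.
  This gives \<open>u < 1\<close>, which allows divisions by \<open>1 - u\<close> and makes the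
  denominator of the resolvent formula positive.\<close>

lemma G_diag_pos: assumes "\<alpha> > 0" shows "G \<alpha> i i > 0"
proof -
  have c: "continuous_on {0..} (\<lambda>t. exp (- \<alpha> * t) * pmin i i t)" by (intro continuous_intros pmin_continuous)
  have "continuous (at 0 within {0..}) (\<lambda>t. exp (- \<alpha> * t) * pmin i i t)"
    using c by (auto simp: continuous_on_eq_continuous_within)
  then obtain d where d: "d > 0" "\<And>t. t \<in> {0..} \<Longrightarrow> dist t 0 < d \<Longrightarrow> dist (exp (- \<alpha> * t) * pmin i i t) (exp (- \<alpha> * 0) * pmin i i 0) < 1/2"
    unfolding continuous_within_eps_delta by (auto dest!: spec[of _ "1/2"])
  have "(d/2) * (1/2) = (LINT t:{0..d/2}|lborel. 1/2)"
    using d by (simp add: set_lebesgue_integral_def)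
  also have "\<dots> \<le> (LINT t:{0..d/2}|lborel. exp (- \<alpha> * t) * pmin i i t)"
  proof (rule set_integral_mono)
    show "set_integrable lborel {0..d/2} (\<lambda>t. 1/2::real)"
      by (rule borel_integrable_atLeastAtMost') (rule continuous_on_const)
    show "set_integrable lborel {0..d/2} (\<lambda>t. exp (- \<alpha> * t) * pmin i i t)"
      by (rule set_integrable_subset[OF pmin_integrable[OF assms]]) auto
    fix t assume "t \<in> {0..d/2}"
    then show "1/2 \<le> exp (- \<alpha> * t) * pmin i i t"
    proof -
      assume t: "t \<in> {0..d/2}"
      then have "\<bar>exp (- \<alpha> * t) * pmin i i t - 1\<bar> < 1/2" using d(2)[of t] d(1) by (auto simp: pmin_0 dist_real_def)
      then show ?thesis by linarith
    qed
  qed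
  also have "\<dots> \<le> G \<alpha> i i"
    unfolding resolvent_def set_lebesgue_integral_def
    using set_integrable_subset[OF pmin_integrable[OF assms], of "{0..d/2}" i i] pmin_integrable[OF assms, of i i]
    by (intro integral_mono) (auto simp: set_integrable_def indicator_def pmin_nonneg)
  finally show ?thesis using d by simp
qed

lemma u_bounds: assumes "\<alpha> > 0" shows "0 < u \<alpha> i" "u \<alpha> i < 1"
proof -
  show "0 < u \<alpha> i" using u_ge_v[OF assms, of i] v_bounds[OF assms, of i] by linarith
  have "G \<alpha> i i \<le> (\<Sum>j. G \<alpha> i j)"
    using sum_le_suminf[OF G_summable[OF assms], of "{i}"] G_nonneg[OF assms] by simp
  with G_diag_pos[OF assms, of i] have "0 < (1 - u \<alpha> i) / \<alpha>" unfolding G_sum[OF assms] by linarith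
  then show "u \<alpha> i < 1" using assms by (simp add: zero_less_divide_iff)
qed

lemma G_le_u: assumes "\<alpha> > 0" shows "\<alpha> * G \<alpha> i j \<le> 1 - u \<alpha> i"
proof -
  have "G \<alpha> i j \<le> (\<Sum>j. G \<alpha> i j)"
    using sum_le_suminf[OF G_summable[OF assms], of "{j}"] G_nonneg[OF assms] by simp
  then show ?thesis unfolding G_sum[OF assms] using assms by (simp add: field_simps)
qed

text \<open>\<open>1 - u \<le> 1 - v \<le> 2 * \<alpha> * bd_tail\<close>, and the tail is
  integrable against \<open>\<nu>\<close> by the definition of \<open>triples\<close>.\<close>

lemma nu_summable:
  assumes "\<alpha> > 0" "(\<gamma>, \<beta>, \<nu>) \<in> triples a b"
  shows "summable (\<lambda>k. \<nu> k * (1 - u \<alpha> k))"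
proof -
  have nu: "\<nu> k \<ge> 0" for k using assms by (auto simp: triples_def)
  have nn: "0 \<le> \<nu> k * (1 - u \<alpha> k)" for k using nu u_bounds[OF assms(1), of k] by (simp add: mult_nonneg_nonneg)
  have "(\<Sum>k. ennreal (\<nu> k * (1 - u \<alpha> k))) \<le> (\<Sum>k. ennreal (2 * \<alpha>) * (ennreal (\<nu> k) * bd_tail a b k))"
  proof (intro suminf_le allI)
    fix k
    have "ennreal (\<nu> k * (1 - u \<alpha> k)) \<le> ennreal (\<nu> k) * ennreal (1 - v \<alpha> k)"
      using nu u_ge_v[OF assms(1), of k] v_bounds[OF assms(1), of k]
      by (simp add: ennreal_mult[symmetric] ennreal_leI mult_left_mono)
    also have "\<dots> \<le> ennreal (\<nu> k) * (ennreal (2 * \<alpha>) * bd_tail a b k)"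
      by (intro mult_left_mono v_tail assms) auto
    finally show "ennreal (\<nu> k * (1 - u \<alpha> k)) \<le> ennreal (2 * \<alpha>) * (ennreal (\<nu> k) * bd_tail a b k)" by (simp add: mult_ac)
  qed auto
  also have "\<dots> = ennreal (2 * \<alpha>) * (\<Sum>k. ennreal (\<nu> k) * bd_tail a b k)" by simp
  also have "\<dots> < \<infinity>" using assms by (auto simp: triples_def ennreal_mult_less_top)
  finally show ?thesis by (intro summable_suminf_not_top nn) simp
qed

end

section \<open>Convergence of the transition functions\<close>

context Q_trans
begin

lemma continuous_p: "continuous_on {0..} (p i j)"
  by (rule lipschitz_imp_continuous) (use lipschitz in auto)

definition row :: "nat \<Rightarrow> real \<Rightarrow> real" where "row i t = (\<Sum>j. p i j t)"

lemma row_bounds: "t \<ge> 0 \<Longrightarrow> 0 \<le> row i t" "t \<ge> 0 \<Longrightarrow> row i t \<le> 1"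
  unfolding row_def using suminf_nonneg[OF row_summable] nonneg row_le_1 by auto

lemma continuous_row: "continuous_on {0..} (row i)"
  unfolding row_def by (rule lipschitz_imp_continuous) (use row_sum_lipschitz in auto)

lemma laplace_p_integrable: "\<alpha> > 0 \<Longrightarrow> set_integrable lborel {0..} (\<lambda>t. exp (- \<alpha> * t) * p i j t)"
  by (rule laplace_integrable[OF _ continuous_set_borel[OF continuous_p], of _ _ _ 1]) (auto simp: nonneg le_1)

text \<open>The partial row sums are bounded by 1 and converge pointwise, so dominated convergence
  interchanges the sum over \<open>j\<close> with the transform.\<close>

lemma laplace_row_sums:
  assumes \<alpha>: "\<alpha> > 0"
  shows "(\<lambda>j. laplace (p i j) \<alpha>) sums laplace (row i) \<alpha>"
proof -
  have "(\<lambda>n. laplace (\<lambda>t. \<Sum>j<n. p i j t) \<alpha>) \<longlonglongrightarrow> laplace (row i) \<alpha>"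
  proof (rule laplace_tendsto[OF \<alpha> _ _ continuous_row])
    show "\<bar>\<Sum>j<n. p i j t\<bar> \<le> 1" if "t \<ge> 0" for n t
      using finite_row_le_1[OF that, of "{..<n}" i] sum_nonneg[of "{..<n}" "\<lambda>j. p i j t"] nonneg[OF that] by simp
  qed (auto simp: row_def intro!: continuous_intros continuous_p summable_LIMSEQ row_summable)
  moreover have "laplace (\<lambda>t. \<Sum>j<n. p i j t) \<alpha> = (\<Sum>j<n. laplace (p i j) \<alpha>)" for n
    unfolding laplace_def set_lebesgue_integral_def sum_distrib_left scaleR_sum_right
    using laplace_p_integrable[OF \<alpha>] by (intro Bochner_Integration.integral_sum) (simp add: set_integrable_def)
  ultimately show ?thesis by (simp add: sums_def)
qed

end

context bd_minimal
begin

text \<open>From index 1 on \<open>bd_c\<close> is at least \<open>bd_c a b 1 > 0\<close>, so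
  finiteness of \<open>S\<close> makes \<open>mu\<close> summable. The index is shifted because
  \<open>bd_c\<close> vanishes at 0.\<close>

lemma mu_u_summable:
  assumes "infinity_regular a b" "\<alpha> > 0"
  shows "summable (\<lambda>k. mu k * u \<alpha> k)"
proof -
  have inc: "bd_c a b 1 \<le> bd_c a b (Suc k)" for k
  proof (induction k)
    case (Suc k)
    then show ?case using dc_pos[of "Suc k"] by (simp add: dc_def)
  qed simp
  have c1: "bd_c a b 1 > 0" using dc_pos[of 0] by (simp add: dc_def bd_c_def[of a b 0])
  have c0: "bd_c a b k \<ge> 0" for k
    using inc[of "k - 1"] c1 by (cases k) (auto simp: bd_c_def[of a b 0])
  have "summable (\<lambda>k. bd_c a b k * mu k)"
    by (rule summable_suminf_not_top)
       (use assms c0 mu_pos in \<open>auto simp: infinity_regular_def bd_S_def less_imp_le\<close>)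
  then have "summable (\<lambda>k. bd_c a b (Suc k) * mu (Suc k))" by (subst summable_Suc_iff)
  from summable_mult[OF this, of "1 / bd_c a b 1"]
  have "summable (\<lambda>k. (bd_c a b (Suc k) / bd_c a b 1) * mu (Suc k))" by simp
  then have "summable (\<lambda>k. mu (Suc k) * u \<alpha> (Suc k))"
  proof (rule summable_comparison_test')
    fix k
    have "mu (Suc k) * u \<alpha> (Suc k) \<le> 1 * mu (Suc k)"
      using u_bounds[OF assms(2), of "Suc k"] mu_pos[of "Suc k"] by simp
    also have "\<dots> \<le> (bd_c a b (Suc k) / bd_c a b 1) * mu (Suc k)"
      using inc[of k] c1 mu_pos[of "Suc k"] by (intro mult_right_mono) auto
    finally show "norm (mu (Suc k) * u \<alpha> (Suc k)) \<le> (bd_c a b (Suc k) / bd_c a b 1) * mu (Suc k)"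
      using u_bounds[OF assms(2), of "Suc k"] mu_pos[of "Suc k"] by (simp add: abs_mult)
  qed
  then show ?thesis by (subst (asm) summable_Suc_iff)
qed

section \<open>Numerator and denominator of the resolvent formula\<close>

definition den :: "triple \<Rightarrow> real \<Rightarrow> real" where
  "den = (\<lambda>(\<gamma>, \<beta>, \<nu>) \<alpha>. \<gamma> + (\<Sum>k. \<nu> k * (1 - u \<alpha> k)) + \<beta> * \<alpha> * (\<Sum>k. mu k * u \<alpha> k))"

definition num :: "triple \<Rightarrow> real \<Rightarrow> nat \<Rightarrow> real" where
  "num = (\<lambda>(\<gamma>, \<beta>, \<nu>) \<alpha> j. (\<Sum>k. \<nu> k * G \<alpha> k j) + \<beta> * mu j * u \<alpha> j)"

text \<open>The sum of \<open>num\<close> over \<open>j\<close>, by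
  \<open>\<alpha> * (\<Sum>j. G \<alpha> k j) = 1 - u \<alpha> k\<close>; it governs the row
  sums.\<close>

definition num_total :: "triple \<Rightarrow> real \<Rightarrow> real" where
  "num_total = (\<lambda>(\<gamma>, \<beta>, \<nu>) \<alpha>. (\<Sum>k. \<nu> k * (1 - u \<alpha> k)) / \<alpha> + \<beta> * (\<Sum>k. mu k * u \<alpha> k))"

lemma triple_resolvent_eq: "triple_resolvent a b pmin X \<alpha> i j = G \<alpha> i j + u \<alpha> i * (num X \<alpha> j / den X \<alpha>)"
  by (cases X) (simp add: triple_resolvent_def num_def den_def)

lemma num_sums:
  assumes X: "X \<in> triples a b" and reg: "infinity_regular a b \<or> infinity_exit a b" and \<alpha>: "\<alpha> > 0"
  shows "num X \<alpha> sums num_total X \<alpha>"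
proof -
  obtain \<gamma> \<beta> \<nu> where X': "X = (\<gamma>, \<beta>, \<nu>)" by (cases X)
  have nu: "\<nu> k \<ge> 0" for k using X by (auto simp: X' triples_def)
  have row: "(\<Sum>j. \<nu> k * G \<alpha> k j) = \<nu> k * (1 - u \<alpha> k) / \<alpha>" for k
    using suminf_mult[OF G_summable[OF \<alpha>, of k], of "\<nu> k"] G_sum[OF \<alpha>, of k] by simp
  have sm: "summable (\<lambda>k. \<Sum>j. \<nu> k * G \<alpha> k j)"
    unfolding row by (intro summable_divide nu_summable[OF \<alpha> X[unfolded X']])
  have 1: "(\<lambda>j. \<Sum>k. \<nu> k * G \<alpha> k j) sums ((\<Sum>k. \<nu> k * (1 - u \<alpha> k)) / \<alpha>)"
    using sums_swap_nonneg[OF _ _ sm] nu G_nonneg[OF \<alpha>] G_summable[OF \<alpha>]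
      suminf_divide[OF nu_summable[OF \<alpha> X[unfolded X']], of \<alpha>]
    unfolding row by (simp add: summable_mult)
  \<comment> \<open>For \<open>\<beta> = 0\<close> both sides vanish, whatever value the possibly
    divergent series has; otherwise infinity is regular and the series converges.\<close>
  have 2: "(\<lambda>j. \<beta> * (mu j * u \<alpha> j)) sums (\<beta> * (\<Sum>k. mu k * u \<alpha> k))"
  proof (cases "\<beta> = 0")
    case False
    then have "infinity_regular a b" using X reg by (auto simp: X' triples_def)
    then show ?thesis by (intro sums_mult summable_sums mu_u_summable \<alpha>)
  qed simp
  show ?thesis using sums_add[OF 1 2] unfolding X' num_def num_total_def by (simp add: mult.assoc)
qed

text \<open>A triple has \<open>\<beta> > 0\<close> or some \<open>\<nu> k > 0\<close>, and either
  contributes a positive term because \<open>0 < u < 1\<close>.\<close>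

lemma den_pos:
  assumes X: "X \<in> triples a b" and reg: "infinity_regular a b \<or> infinity_exit a b" and \<alpha>: "\<alpha> > 0"
  shows "den X \<alpha> > 0"
proof -
  obtain \<gamma> \<beta> \<nu> where X': "X = (\<gamma>, \<beta>, \<nu>)" by (cases X)
  have nu: "\<nu> k \<ge> 0" "\<gamma> \<ge> 0" "\<beta> \<ge> 0" for k using X by (auto simp: X' triples_def)
  note sm = nu_summable[OF \<alpha> X[unfolded X']]
  have t0: "0 \<le> \<nu> k * (1 - u \<alpha> k)" for k using nu u_bounds[OF \<alpha>, of k] by simp
  have A: "0 \<le> (\<Sum>k. \<nu> k * (1 - u \<alpha> k))" by (intro suminf_nonneg sm t0)
  have B: "0 \<le> \<beta> * \<alpha> * (\<Sum>k. mu k * u \<alpha> k)" and B': "\<beta> \<noteq> 0 \<Longrightarrow> 0 < \<beta> * \<alpha> * (\<Sum>k. mu k * u \<alpha> k)"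
  proof -
    have *: "0 < \<beta> * \<alpha> * (\<Sum>k. mu k * u \<alpha> k)" if "\<beta> \<noteq> 0"
    proof -
      have "infinity_regular a b" using X reg that by (auto simp: X' triples_def)
      then have "summable (\<lambda>k. mu k * u \<alpha> k)" by (intro mu_u_summable \<alpha>)
      then have "0 < (\<Sum>k. mu k * u \<alpha> k)"
        by (rule suminf_pos) (use mu_pos u_bounds[OF \<alpha>] in auto)
      then show ?thesis using that nu \<alpha> by simp
    qed
    then show "\<beta> \<noteq> 0 \<Longrightarrow> 0 < \<beta> * \<alpha> * (\<Sum>k. mu k * u \<alpha> k)" .
    show "0 \<le> \<beta> * \<alpha> * (\<Sum>k. mu k * u \<alpha> k)" using * by (cases "\<beta> = 0") auto
  qed
  show ?thesis
  proof (cases "\<beta> = 0")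
    case True
    then have "total_mass \<nu> \<noteq> 0" using X by (auto simp: X' triples_def)
    then obtain k where "\<nu> k \<noteq> 0" unfolding total_mass_def by (cases "\<forall>k. \<nu> k = 0") auto
    then have "0 < \<nu> k * (1 - u \<alpha> k)" using nu(1)[of k] u_bounds[OF \<alpha>, of k] by simp
    also have "\<dots> \<le> (\<Sum>k. \<nu> k * (1 - u \<alpha> k))" using sum_le_suminf[OF sm, of "{k}"] t0 by simp
    finally show ?thesis using B nu unfolding X' den_def by simp
  next
    case False
    then show ?thesis using A B' nu unfolding X' den_def by simp
  qed
qed

lemma Q_process_laplace:
  assumes "Q_process_of a b pmin X p" and \<alpha>: "\<alpha> > 0"
  shows "laplace (p i j) \<alpha> = G \<alpha> i j + u \<alpha> i * (num X \<alpha> j / den X \<alpha>)"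
  using assms unfolding Q_process_of_def triple_resolvent_eq resolvent_laplace[of p] by blast

lemma Q_process_laplace_row:
  assumes Q: "Q_process_of a b pmin X p" and \<alpha>: "\<alpha> > 0"
    and X: "X \<in> triples a b" and reg: "infinity_regular a b \<or> infinity_exit a b"
  shows "laplace (\<lambda>t. \<Sum>j. p i j t) \<alpha> = (1 - u \<alpha> i) / \<alpha> + u \<alpha> i * (num_total X \<alpha> / den X \<alpha>)"
proof -
  interpret Q: Q_trans a b p using Q bd by unfold_locales (auto simp: Q_process_of_def)
  have "(\<lambda>j. laplace (p i j) \<alpha>) sums laplace (Q.row i) \<alpha>" by (rule Q.laplace_row_sums[OF \<alpha>])
  moreover have "(\<lambda>j. laplace (p i j) \<alpha>) sums ((1 - u \<alpha> i) / \<alpha> + u \<alpha> i * (num_total X \<alpha> / den X \<alpha>))"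
    unfolding Q_process_laplace[OF Q \<alpha>]
    using summable_sums[OF G_summable[OF \<alpha>, of i]] unfolding G_sum[OF \<alpha>]
    by (intro sums_add sums_mult sums_divide num_sums X reg \<alpha>) auto
  ultimately show ?thesis using sums_unique2 unfolding Q.row_def[abs_def] by blast
qed

section \<open>Limits along a convergent sequence of triples\<close>

context
  fixes X :: triple and Xs :: "nat \<Rightarrow> triple"
  assumes X: "X \<in> triples a b" and Xs: "\<And>n. n \<ge> 1 \<Longrightarrow> Xs n \<in> triples a b"
    and reg: "infinity_regular a b \<or> infinity_exit a b"
    and conv: "triple_tendsto pmin Xs X"
begin

lemma gamma_tendsto: "(\<lambda>n. fst (Xs n)) \<longlonglongrightarrow> fst X"
  and beta_tendsto: "(\<lambda>n. fst (snd (Xs n))) \<longlonglongrightarrow> fst (snd X)"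
  and nu_tendsto: "(\<lambda>n. snd (snd (Xs n)) k) \<longlonglongrightarrow> snd (snd X) k"
  and nu_u_tendsto: "\<alpha> > 0 \<Longrightarrow> (\<lambda>n. \<Sum>k. snd (snd (Xs n)) k * (1 - u \<alpha> k)) \<longlonglongrightarrow> (\<Sum>k. snd (snd X) k * (1 - u \<alpha> k))"
  using conv unfolding triple_tendsto_def case_prod_beta by blast+

text \<open>The series over \<open>mu\<close> does not involve \<open>n\<close>; only its factor
  \<open>\<beta>\<close> varies.\<close>

lemma den_tendsto: "\<alpha> > 0 \<Longrightarrow> (\<lambda>n. den (Xs n) \<alpha>) \<longlonglongrightarrow> den X \<alpha>"
  unfolding den_def case_prod_beta
  by (intro tendsto_add tendsto_mult tendsto_const gamma_tendsto beta_tendsto nu_u_tendsto)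

lemma num_total_tendsto: "\<alpha> > 0 \<Longrightarrow> (\<lambda>n. num_total (Xs n) \<alpha>) \<longlonglongrightarrow> num_total X \<alpha>"
  unfolding num_total_def case_prod_beta
  by (intro tendsto_add tendsto_mult tendsto_divide tendsto_const beta_tendsto nu_u_tendsto) auto

text \<open>Termwise convergence of \<open>\<nu>\<close> could lose mass at infinity. Relative to
  the masses \<open>\<nu> k * (1 - u \<alpha> k)\<close>, whose totals converge by assumption, the
  remaining factor \<open>\<alpha> * G \<alpha> k j / (1 - u \<alpha> k)\<close> lies in
  \<open>[0, 1]\<close>, and \<open>scheffe_series\<close> applies.\<close>

lemma num_tendsto:
  assumes \<alpha>: "\<alpha> > 0" shows "(\<lambda>n. num (Xs n) \<alpha> j) \<longlonglongrightarrow> num X \<alpha> j"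
proof -
  let ?y = "\<lambda>k. \<alpha> * G \<alpha> k j / (1 - u \<alpha> k)"
  let ?x = "\<lambda>n k. snd (snd (Xs n)) k * (1 - u \<alpha> k)" and ?z = "\<lambda>k. snd (snd X) k * (1 - u \<alpha> k)"
  have nu: "n \<ge> 1 \<Longrightarrow> snd (snd (Xs n)) k \<ge> 0" "snd (snd X) k \<ge> 0" for n k
    using X Xs[of n] by (auto simp: triples_def)
  have w: "1 - u \<alpha> k > 0" for k using u_bounds[OF \<alpha>, of k] by simp
  have sm: "summable (\<lambda>k. snd (snd Y) k * (1 - u \<alpha> k))" if "Y \<in> triples a b" for Y
    using nu_summable[OF \<alpha>, of "fst Y" "fst (snd Y)" "snd (snd Y)"] that by simp
  have nn: "0 \<le> c * (1 - u \<alpha> k)" if "c \<ge> 0" for c k using that w[of k] by (intro mult_nonneg_nonneg) auto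
  have "(\<lambda>n. \<Sum>k. ?x n k * ?y k) \<longlonglongrightarrow> (\<Sum>k. ?z k * ?y k)"
  proof (rule scheffe_series)
    show "\<forall>\<^sub>F n in sequentially. \<forall>k. 0 \<le> ?x n k"
      by (rule eventually_sequentiallyI[of 1]) (use nu in \<open>auto intro!: nn\<close>)
    show "\<forall>\<^sub>F n in sequentially. summable (?x n)"
      by (rule eventually_sequentiallyI[of 1]) (use sm Xs in auto)
    show "0 \<le> ?z k" for k using nu by (intro nn)
    show "summable ?z" by (rule sm[OF X])
    show "(\<lambda>n. ?x n k) \<longlonglongrightarrow> ?z k" for k
      by (intro tendsto_mult tendsto_const nu_tendsto)
    show "(\<lambda>n. \<Sum>k. ?x n k) \<longlonglongrightarrow> (\<Sum>k. ?z k)"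
      by (rule nu_u_tendsto[OF \<alpha>])
    show "0 \<le> ?y k" "?y k \<le> 1" for k
      using w[of k] G_nonneg[OF \<alpha>, of k j] G_le_u[OF \<alpha>, of k j] \<alpha> by auto
  qed
  from tendsto_mult[OF this tendsto_const[of "1 / \<alpha>"]]
  have lim: "(\<lambda>n. (\<Sum>k. ?x n k * ?y k) * (1 / \<alpha>)) \<longlonglongrightarrow> (\<Sum>k. ?z k * ?y k) * (1 / \<alpha>)" .
  have eq: "(\<Sum>k. (\<nu> k * (1 - u \<alpha> k)) * ?y k) * (1 / \<alpha>) = (\<Sum>k. \<nu> k * G \<alpha> k j)"
    if "Y \<in> triples a b" "\<nu> = snd (snd Y)" for Y and \<nu> :: "nat \<Rightarrow> real"
  proof -
    have e: "(\<nu> k * (1 - u \<alpha> k)) * ?y k = \<alpha> * (\<nu> k * G \<alpha> k j)" for k using w[of k] by simp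
    have "summable (\<lambda>k. \<nu> k * G \<alpha> k j)"
    proof (rule summable_comparison_test'[OF summable_mult[OF sm[OF that(1)], of "1 / \<alpha>"], of 0])
      fix k
      have "\<nu> k \<ge> 0" using that by (auto simp: triples_def)
      have "G \<alpha> k j \<le> (1 - u \<alpha> k) / \<alpha>" using G_le_u[OF \<alpha>, of k j] \<alpha> by (simp add: field_simps)
      then have "\<nu> k * G \<alpha> k j \<le> \<nu> k * ((1 - u \<alpha> k) / \<alpha>)" using \<open>\<nu> k \<ge> 0\<close> by (rule mult_left_mono)
      then show "norm (\<nu> k * G \<alpha> k j) \<le> 1 / \<alpha> * (snd (snd Y) k * (1 - u \<alpha> k))"
        using \<open>\<nu> k \<ge> 0\<close> G_nonneg[OF \<alpha>, of k j] that by simp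
    qed
    then show ?thesis unfolding e using \<alpha> by (simp add: suminf_mult)
  qed
  have "(\<lambda>n. \<Sum>k. snd (snd (Xs n)) k * G \<alpha> k j) \<longlonglongrightarrow> (\<Sum>k. snd (snd X) k * G \<alpha> k j)"
    by (rule Lim_transform_eventually[OF lim[unfolded eq[OF X refl]]]) (rule eventually_sequentiallyI[of 1], rule eq[OF Xs refl])
  then show ?thesis
    unfolding num_def case_prod_beta by (intro tendsto_add tendsto_mult tendsto_const beta_tendsto)
qed

context
  fixes p :: "nat \<Rightarrow> nat \<Rightarrow> real \<Rightarrow> real" and ps :: "nat \<Rightarrow> nat \<Rightarrow> nat \<Rightarrow> real \<Rightarrow> real"
  assumes p: "Q_process_of a b pmin X p" and ps: "\<And>n. n \<ge> 1 \<Longrightarrow> Q_process_of a b pmin (Xs n) (ps n)"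
begin

lemma p_Q: "Q_trans a b p" and ps_Q: "n \<ge> 1 \<Longrightarrow> Q_trans a b (ps n)"
  using p ps bd by (auto simp: Q_process_of_def Q_trans_def Q_trans_axioms_def bd_matrix_def)

text \<open>The Lipschitz constant \<open>a i + b i\<close> is the same for all \<open>n\<close>, so
  convergence of the Laplace transforms is enough.\<close>

lemma transition_tendsto:
  assumes t: "t \<ge> 0" shows "(\<lambda>n. ps n i j t) \<longlonglongrightarrow> p i j t"
proof (rule laplace_continuity[where m = 1 and q = "a i + b i" and f = "\<lambda>n. ps n i j" and g = "p i j"])
  fix \<alpha> :: real assume \<alpha>: "\<alpha> > 0"
  have "(\<lambda>n. G \<alpha> i j + u \<alpha> i * (num (Xs n) \<alpha> j / den (Xs n) \<alpha>)) \<longlonglongrightarrow> G \<alpha> i j + u \<alpha> i * (num X \<alpha> j / den X \<alpha>)"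
    using den_pos[OF X reg \<alpha>] by (intro tendsto_intros num_tendsto den_tendsto \<alpha>) auto
  then show "(\<lambda>n. laplace (ps n i j) \<alpha>) \<longlonglongrightarrow> laplace (p i j) \<alpha>"
    unfolding Q_process_laplace[OF p \<alpha>]
    by (rule Lim_transform_eventually) (rule eventually_sequentiallyI[of 1], rule Q_process_laplace[OF ps \<alpha>, symmetric])
next
  show "0 \<le> ps n i j t \<and> ps n i j t \<le> 1" if n: "1 \<le> n" and t: "0 \<le> t" for n t
    using Q_trans.nonneg[OF ps_Q[OF n] t] Q_trans.le_1[OF ps_Q[OF n] t] by blast
  show "\<bar>ps n i j s - ps n i j t\<bar> \<le> (a i + b i) * \<bar>s - t\<bar>" if n: "1 \<le> n" and st: "0 \<le> s" "0 \<le> t" for n s t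
    by (rule Q_trans.lipschitz[OF ps_Q[OF n] st])
  show "0 \<le> p i j t \<and> p i j t \<le> 1" if t: "0 \<le> t" for t
    using Q_trans.nonneg[OF p_Q t] Q_trans.le_1[OF p_Q t] by blast
  show "\<bar>p i j s - p i j t\<bar> \<le> (a i + b i) * \<bar>s - t\<bar>" if st: "0 \<le> s" "0 \<le> t" for s t
    by (rule Q_trans.lipschitz[OF p_Q st])
qed (rule t)

text \<open>Not a consequence of the convergence of the entries, since mass of a row might disappear
  in the limit. The row sums determine the probability of the cemetery.\<close>

lemma row_tendsto:
  assumes t: "t \<ge> 0" shows "(\<lambda>n. \<Sum>j. ps n i j t) \<longlonglongrightarrow> (\<Sum>j. p i j t)"
proof (rule laplace_continuity[where m = 1 and q = "a i + b i" and f = "\<lambda>n t. \<Sum>j. ps n i j t" and g = "\<lambda>t. \<Sum>j. p i j t"])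
  fix \<alpha> :: real assume \<alpha>: "\<alpha> > 0"
  let ?L = "\<lambda>Y. (1 - u \<alpha> i) / \<alpha> + u \<alpha> i * (num_total Y \<alpha> / den Y \<alpha>)"
  have "(\<lambda>n. ?L (Xs n)) \<longlonglongrightarrow> ?L X"
    using den_pos[OF X reg \<alpha>] \<alpha> by (intro tendsto_intros num_total_tendsto den_tendsto \<alpha>) auto
  then show "(\<lambda>n. laplace (\<lambda>t. \<Sum>j. ps n i j t) \<alpha>) \<longlonglongrightarrow> laplace (\<lambda>t. \<Sum>j. p i j t) \<alpha>"
    unfolding Q_process_laplace_row[OF p \<alpha> X reg]
    by (rule Lim_transform_eventually)
       (rule eventually_sequentiallyI[of 1], rule Q_process_laplace_row[OF ps \<alpha> Xs reg, symmetric])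
next
  show "0 \<le> (\<Sum>j. ps n i j t) \<and> (\<Sum>j. ps n i j t) \<le> 1" if n: "1 \<le> n" and t: "0 \<le> t" for n t
    using Q_trans.row_bounds[OF ps_Q[OF n] t, of i] by (simp add: Q_trans.row_def[OF ps_Q[OF n]])
  show "\<bar>(\<Sum>j. ps n i j s) - (\<Sum>j. ps n i j t)\<bar> \<le> (a i + b i) * \<bar>s - t\<bar>" if n: "1 \<le> n" and st: "0 \<le> s" "0 \<le> t" for n s t
    by (rule Q_trans.row_sum_lipschitz[OF ps_Q[OF n] st])
  show "0 \<le> (\<Sum>j. p i j t) \<and> (\<Sum>j. p i j t) \<le> 1" if t: "0 \<le> t" for t
    using Q_trans.row_bounds[OF p_Q t, of i] by (simp add: Q_trans.row_def[OF p_Q])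
  show "\<bar>(\<Sum>j. p i j s) - (\<Sum>j. p i j t)\<bar> \<le> (a i + b i) * \<bar>s - t\<bar>" if st: "0 \<le> s" "0 \<le> t" for s t
    by (rule Q_trans.row_sum_lipschitz[OF p_Q st])
qed (rule t)

lemma ext_transition_tendsto:
  assumes "t \<ge> 0" shows "(\<lambda>n. ext_transition (ps n) x y t) \<longlonglongrightarrow> ext_transition p x y t"
  by (cases x; cases y) (auto intro!: tendsto_intros transition_tendsto row_tendsto assms)

end

end

end

section \<open>Sampled paths in the Skorohod space\<close>

text \<open>Lists of states become countable, which makes samples discrete random variables and
  allows them to be encoded by natural numbers.\<close>

instance state :: countable
  by countable_datatype

section \<open>Merging the states beyond \<open>K\<close> with infinity\<close>

fun coarse :: "nat \<Rightarrow> state \<Rightarrow> state" where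
  "coarse K (Pt i) = (if i \<le> K then Pt i else Infty)"
| "coarse K x = x"

text \<open>The states merged with infinity are embedded in \<open>[0, 1 / (K + 2)]\<close>; all
  other classes are single states.\<close>

lemma coarse_eq_dist:
  assumes "coarse K x = coarse K y"
  shows "dist x y < 1 / (real K + 1)"
proof -
  have small: "0 < 1 / (real i + 1)" "1 / (real i + 1) < 1 / (real K + 1)" if "i > K" for i
    using that by (simp_all add: frac_less2)
  consider "x = y" | i j where "x = Pt i" "y = Pt j" "i > K" "j > K" | i where "x = Pt i" "y = Infty" "i > K"
    | j where "x = Infty" "y = Pt j" "j > K"
    using assms by (cases x; cases y) (auto split: if_splits)
  then show ?thesis
  proof cases
    case 2
    show ?thesis using small[OF 2(3)] small[OF 2(4)] unfolding 2(1,2) dist_state_def state_embed.simps by linarith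
  qed (use small in \<open>auto simp: dist_state_def\<close>)
qed

text \<open>The bound is the distance between \<open>Pt K\<close> and \<open>Pt (Suc K)\<close>, the
  smallest one between different classes. Through it a cadlag path becomes coarsely constant on
  one-sided neighbourhoods of every time.\<close>

lemma coarse_locally_constant:
  assumes "dist x y < 1 / ((real K + 1) * (real K + 2))"
  shows "coarse K x = coarse K y"
proof -
  define \<epsilon> where "\<epsilon> = 1 / ((real K + 1) * (real K + 2))"
  have gap: "\<epsilon> \<le> 1 / (real i + 1) - 1 / (real j + 1)" if "i \<le> K" "i < j" for i j
  proof -
    have "1 / (real j + 1) \<le> 1 / (real i + 2)" using that by (intro divide_left_mono) auto
    then have "1 / (real i + 1) - 1 / (real i + 2) \<le> 1 / (real i + 1) - 1 / (real j + 1)" by simp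
    moreover have "1 / (real i + 1) - 1 / (real i + 2) = 1 / ((real i + 1) * (real i + 2))" by (simp add: field_simps)
    moreover have "\<epsilon> \<le> 1 / ((real i + 1) * (real i + 2))"
      unfolding \<epsilon>_def using that by (intro divide_left_mono mult_mono) auto
    ultimately show ?thesis by linarith
  qed
  have gap0: "\<epsilon> \<le> 1 / (real i + 1)" if "i \<le> K" for i
    using gap[OF that, of "Suc i"] by (smt (verit) divide_nonneg_nonneg lessI of_nat_0_le_iff)
  have e1: "\<epsilon> \<le> 1" using gap0[of 0] by simp
  have pos: "0 < 1 / (real i + 1)" for i by simp
  have d: "\<bar>state_embed x - state_embed y\<bar> < \<epsilon>" using assms by (simp add: dist_state_def \<epsilon>_def)
  have no1: False if "i \<le> K" "i < j" "\<bar>1 / (real i + 1) - 1 / (real j + 1)\<bar> < \<epsilon>" for i j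
    using gap[OF that(1,2)] that(3) by linarith
  have no2: "i > K" if "\<bar>1 / (real i + 1)\<bar> < \<epsilon>" for i
    using gap0[of i] that by (cases "i \<le> K") auto
  have no3: False if "\<bar>- 1 - 1 / (real i + 1)\<bar> < \<epsilon>" for i
    using that e1 pos[of i] by linarith
  show ?thesis
  proof (cases x)
    case x: (Pt i)
    show ?thesis
    proof (cases y)
      case y: (Pt j)
      show ?thesis
      proof (cases i j rule: linorder_cases)
        case less
        then have "i > K" using no1[of i j] d x y by force
        then show ?thesis using less by (simp add: x y)
      next
        case greater
        then have "j > K" using no1[of j i] d x y by (force simp: abs_minus_commute)
        then show ?thesis using greater by (simp add: x y)
      qed (simp add: x y)
    next
      case Infty
      then show ?thesis using no2[of i] d x by simp
    next
      case c: Cemetery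
      have "\<bar>state_embed y - state_embed x\<bar> < \<epsilon>" using d by linarith
      then show ?thesis using no3[of i] x c by simp
    qed
  next
    case x: Infty
    show ?thesis
    proof (cases y)
      case (Pt j)
      then show ?thesis using no2[of j] d x by simp
    next
      case Cemetery
      then show ?thesis using e1 d x by simp
    qed (simp add: x)
  next
    case x: Cemetery
    show ?thesis
    proof (cases y)
      case (Pt j)
      then show ?thesis using no3[of j] d x by simp
    next
      case Infty
      then show ?thesis using e1 d x by simp
    qed (simp add: x)
  qed
qed

section \<open>Grid samples and step paths\<close>

definition samples :: "real \<Rightarrow> nat \<Rightarrow> (real \<Rightarrow> 'a) \<Rightarrow> 'a list" where
  "samples h N w = map (\<lambda>k. w (real k * h)) [0..<Suc N]"

text \<open>Beyond time \<open>N * h\<close> the last sample is kept; \<open>undefined\<close> at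
  negative times makes the path extensional.\<close>

definition step :: "real \<Rightarrow> nat \<Rightarrow> 'a list \<Rightarrow> real \<Rightarrow> 'a" where
  "step h N xs s = (if s \<ge> 0 then xs ! min N (nat \<lfloor>s / h\<rfloor>) else undefined)"

lemma length_samples: "length (samples h N w) = Suc N"
  by (simp add: samples_def)

lemma nth_samples: "k \<le> N \<Longrightarrow> samples h N w ! k = w (real k * h)"
  by (simp add: samples_def less_Suc_eq_le nth_append)

lemma step_samples:
  assumes "h > 0" "l \<le> N" "real l * h \<le> s" "s < real (Suc l) * h"
  shows "step h N (samples h N w) s = w (real l * h)"
proof -
  have "s \<ge> 0" using assms by (smt (verit) mult_nonneg_nonneg of_nat_0_le_iff)
  moreover have "\<lfloor>s / h\<rfloor> = int l"
    using assms by (intro floor_unique) (auto simp: field_simps)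
  ultimately show ?thesis using assms unfolding step_def samples_def
    by (simp add: min_absorb2 del: upt_Suc)
qed

lemma step_cadlag:
  fixes xs :: "'a::metric_space list"
  assumes h: "h > 0"
  shows "step h N xs \<in> cadlag_paths"
  unfolding cadlag_paths_def
proof (intro CollectI conjI allI impI)
  show "step h N xs \<in> extensional {0..}" by (auto simp: extensional_def step_def)
  fix t :: real assume t: "t \<ge> 0"
  have "t / h < real_of_int \<lfloor>t / h\<rfloor> + 1" by linarith
  then have "t < (real_of_int \<lfloor>t / h\<rfloor> + 1) * h" using h by (simp only: pos_divide_less_eq)
  then have "\<forall>\<^sub>F s in at_right t. s < (real_of_int \<lfloor>t / h\<rfloor> + 1) * h \<and> t < s"
    by (intro eventually_conj eventually_at_right_less eventually_at_rightI[of t "(real_of_int \<lfloor>t / h\<rfloor> + 1) * h"]) auto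
  then have "\<forall>\<^sub>F s in at_right t. step h N xs s = step h N xs t"
  proof eventually_elim
    case (elim s)
    have "real_of_int \<lfloor>t / h\<rfloor> \<le> t / h" by simp
    also have "\<dots> \<le> s / h" using elim h by (simp add: divide_right_mono)
    finally have "\<lfloor>s / h\<rfloor> = \<lfloor>t / h\<rfloor>"
      using elim h by (intro floor_unique) (auto simp: field_simps)
    then show ?case using elim t by (simp add: step_def)
  qed
  then show "(step h N xs \<longlongrightarrow> step h N xs t) (at_right t)" by (rule tendsto_eventually)
next
  fix t :: real assume t: "t > 0"
  \<comment> \<open>\<open>(m * h, (m + 1) * h]\<close> is the cell that contains \<open>t\<close>,
    that is, the one seen from the left of \<open>t\<close>.\<close>
  define m where "m = \<lceil>t / h\<rceil> - 1"
  have m: "real_of_int m * h < t" "t \<le> (real_of_int m + 1) * h" 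
  proof -
    have "real_of_int m < t / h" "t / h \<le> real_of_int m + 1" unfolding m_def by linarith+
    then show "real_of_int m * h < t" "t \<le> (real_of_int m + 1) * h" using h by (simp_all add: field_simps)
  qed
  have "\<forall>\<^sub>F s in at_left t. max 0 (real_of_int m * h) < s \<and> s < t"
    using m t by (intro eventually_at_leftI[of "max 0 (real_of_int m * h)"]) auto
  then have "\<forall>\<^sub>F s in at_left t. step h N xs s = xs ! min N (nat m)"
  proof eventually_elim
    case (elim s)
    then have "\<lfloor>s / h\<rfloor> = m"
      using m h by (intro floor_unique) (auto simp: field_simps)
    then show ?case using elim by (simp add: step_def)
  qed
  then show "\<exists>l. (step h N xs \<longlongrightarrow> l) (at_left t)" by (intro exI tendsto_eventually)
qed

section \<open>Time changes and Skorohod neighbourhoods\<close>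

lemma grid_cell:
  fixes x :: "nat \<Rightarrow> real"
  assumes "x 0 \<le> s" "s < x M"
  shows "\<exists>l<M. x l \<le> s \<and> s < x (Suc l)"
  using assms(2)
proof (induction M)
  case (Suc M)
  then show ?case by (cases "s < x M") (auto simp: not_less less_Suc_eq)
qed (use assms(1) in simp)

text \<open>Piecewise linear interpolation, written as a sum of clamped increments: continuity is
  then immediate and monotonicity can be checked term by term. The common end point allows the
  identity afterwards.\<close>

lemma time_change_interpolation:
  fixes x y :: "nat \<Rightarrow> real"
  assumes x0: "x 0 = 0" and y0: "y 0 = 0"
    and xi: "\<And>l. l < M \<Longrightarrow> x l < x (Suc l)" and yi: "\<And>l. l < M \<Longrightarrow> y l < y (Suc l)"
    and end_eq: "x M = y M"
  shows "\<exists>\<tau>\<in>time_changes. (\<forall>l\<le>M. \<tau> (x l) = y l) \<and> (\<forall>s\<ge>x M. \<tau> s = s)"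
proof -
  \<comment> \<open>\<open>cl l s\<close> is the fraction of the cell from \<open>x l\<close> to
    \<open>x (Suc l)\<close> that lies before \<open>s\<close>.\<close>
  define cl where "cl l s = max 0 (min 1 ((s - x l) / (x (Suc l) - x l)))" for l s
  define \<tau> where "\<tau> s = (\<Sum>l<M. (y (Suc l) - y l) * cl l s) + max 0 (s - x M)" for s
  have xmono: "x k \<le> x l" if "k \<le> l" "l \<le> M" for k l
    using that by (induction l) (auto simp: le_Suc_eq intro: order_trans[OF _ less_imp_le[OF xi]])
  have cl0: "cl l s = 0" if "l < M" "s \<le> x l" for l s
  proof -
    have "(s - x l) / (x (Suc l) - x l) \<le> 0"
      using xi[OF that(1)] that(2) by (intro divide_nonpos_pos) auto
    then show ?thesis unfolding cl_def by linarith
  qed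
  have cl1: "cl l s = 1" if "l < M" "s \<ge> x (Suc l)" for l s
    using xi[OF that(1)] that(2) by (auto simp: cl_def field_simps)
  have grid: "\<tau> (x k) = y k" if "k \<le> M" for k
  proof -
    have "(\<Sum>l<M. (y (Suc l) - y l) * cl l (x k)) = (\<Sum>l<M. if l < k then y (Suc l) - y l else 0)"
    proof (rule sum.cong[OF refl])
      fix l assume "l \<in> {..<M}"
      then show "(y (Suc l) - y l) * cl l (x k) = (if l < k then y (Suc l) - y l else 0)"
        using cl0[of l "x k"] cl1[of l "x k"] xmono[of k l] xmono[of "Suc l" k] that by auto
    qed
    also have "\<dots> = (\<Sum>l<k. y (Suc l) - y l)"
      using that by (intro sum.mono_neutral_cong_right) auto
    also have "\<dots> = y k" using y0 by (simp add: sum_lessThan_telescope)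
    finally show ?thesis using xmono[of k M] that by (simp add: \<tau>_def)
  qed
  have above: "\<tau> s = s" if "s \<ge> x M" for s
  proof -
    have "(\<Sum>l<M. (y (Suc l) - y l) * cl l s) = (\<Sum>l<M. y (Suc l) - y l)"
    proof (rule sum.cong[OF refl])
      fix l assume "l \<in> {..<M}"
      then show "(y (Suc l) - y l) * cl l s = y (Suc l) - y l"
        using cl1[of l s] xmono[of "Suc l" M] that by auto
    qed
    also have "\<dots> = y M" using y0 by (simp add: sum_lessThan_telescope)
    finally show ?thesis using that end_eq by (simp add: \<tau>_def)
  qed
  have clc: "continuous_on UNIV (cl l)" for l
    unfolding cl_def divide_inverse by (intro continuous_intros)
  have cont: "continuous_on A \<tau>" for A
    unfolding \<tau>_def by (intro continuous_intros continuous_on_subset[OF clc]) auto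
  have clm: "cl l s \<le> cl l t" if "l < M" "s \<le> t" for l s t
  proof -
    have "(s - x l) / (x (Suc l) - x l) \<le> (t - x l) / (x (Suc l) - x l)"
      using xi[OF that(1)] that(2) by (intro divide_right_mono) auto
    then show ?thesis unfolding cl_def by linarith
  qed
  have strict: "\<tau> s < \<tau> t" if st: "0 \<le> s" "s < t" for s t
  proof -
    have terms: "(y (Suc l) - y l) * cl l s \<le> (y (Suc l) - y l) * cl l t" if "l \<in> {..<M}" for l
      using clm[of l s t] yi[of l] that st by (intro mult_left_mono) auto
    show ?thesis
    proof (cases "s < x M")
      case True
      then obtain l where l: "l < M" "x l \<le> s" "s < x (Suc l)" using grid_cell[of x s M] x0 st by auto
      have "cl l s < cl l t"
      proof -
        have "(s - x l) / (x (Suc l) - x l) < (t - x l) / (x (Suc l) - x l)"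
          using xi[OF l(1)] st(2) by (intro divide_strict_right_mono) auto
        moreover have "0 \<le> (s - x l) / (x (Suc l) - x l)" "(s - x l) / (x (Suc l) - x l) < 1"
          using xi[OF l(1)] l by auto
        ultimately show ?thesis unfolding cl_def by linarith
      qed
      then have "(y (Suc l) - y l) * cl l s < (y (Suc l) - y l) * cl l t"
        using yi[OF l(1)] by simp
      then have "(\<Sum>l<M. (y (Suc l) - y l) * cl l s) < (\<Sum>l<M. (y (Suc l) - y l) * cl l t)"
        using terms l(1) by (intro sum_strict_mono_ex1) auto
      then show ?thesis using st unfolding \<tau>_def by linarith
    next
      case False
      then show ?thesis using above[of s] above[of t] st by simp
    qed
  qed
  have t0: "\<tau> 0 = 0" using grid[of 0] x0 y0 by simp
  have nonneg: "\<tau> s \<ge> 0" if "s \<ge> 0" for s using strict[of 0 s] t0 that by (cases "s = 0") auto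
  have "\<tau> ` {0..} = {0..}"
  proof (intro equalityI subsetI)
    fix r :: real assume r: "r \<in> {0..}"
    have "\<exists>s\<ge>0. s \<le> max r (x M) \<and> \<tau> s = r"
    proof (rule IVT')
      show "r \<le> \<tau> (max r (x M))" using above[of "max r (x M)"] by simp
      show "0 \<le> max r (x M)" using r by simp
    qed (use t0 r cont in auto)
    then show "r \<in> \<tau> ` {0..}" by auto
  qed (use nonneg in auto)
  moreover have sm: "strict_mono_on {0..} \<tau>" using strict by (auto simp: strict_mono_on_def)
  ultimately have "\<tau> \<in> time_changes"
    using cont by (auto simp: time_changes_def bij_betw_def intro: strict_mono_on_imp_inj_on)
  then show ?thesis using grid above by blast
qed

lemma time_changes_comp:
  assumes "\<tau> \<in> time_changes" "\<sigma> \<in> time_changes"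
  shows "(\<lambda>s. \<tau> (\<sigma> s)) \<in> time_changes"
proof -
  have \<sigma>: "\<sigma> ` {0..} = {0..}" using assms by (auto simp: time_changes_def bij_betw_def)
  have "bij_betw (\<tau> \<circ> \<sigma>) {0..} {0..}" using assms by (auto simp: time_changes_def intro: bij_betw_trans)
  moreover have "continuous_on {0..} (\<lambda>s. \<tau> (\<sigma> s))"
  proof (rule continuous_on_compose2[of "{0..}" \<tau>])
    show "continuous_on {0..} \<tau>" "continuous_on {0..} \<sigma>" using assms unfolding time_changes_def by blast+
  qed (use \<sigma> in simp)
  moreover have "strict_mono_on {0..} (\<lambda>s. \<tau> (\<sigma> s))"
  proof (rule strict_mono_onI)
    fix r s :: real assume rs: "r \<in> {0..}" "s \<in> {0..}" "r < s"
    have "\<sigma> r \<in> {0..}" "\<sigma> s \<in> {0..}" using \<sigma> rs by blast+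
    moreover have "\<sigma> r < \<sigma> s" using assms(2) rs unfolding time_changes_def strict_mono_on_def by blast
    ultimately show "\<tau> (\<sigma> r) < \<tau> (\<sigma> s)" using assms(1) unfolding time_changes_def strict_mono_on_def by blast
  qed
  ultimately show ?thesis by (simp add: time_changes_def comp_def)
qed

lemma time_changes_nonneg: "\<tau> \<in> time_changes \<Longrightarrow> s \<ge> 0 \<Longrightarrow> \<tau> s \<ge> 0"
  by (auto simp: time_changes_def bij_betw_def)

text \<open>Composition of the two time changes. The inner one can move \<open>s\<close> up to
  \<open>T + e2\<close>, hence the longer horizon \<open>T1\<close>.\<close>

lemma skorohod_nbhd_trans:
  assumes v: "v \<in> skorohod_nbhd d T1 e1" and d: "d \<in> skorohod_nbhd w T2 e2" and "T \<le> T2" "T + e2 \<le> T1"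
  shows "v \<in> skorohod_nbhd w T (e1 + e2)"
proof -
  obtain \<tau> where \<tau>: "\<tau> \<in> time_changes" "\<And>s. s \<ge> 0 \<Longrightarrow> \<bar>\<tau> s - s\<bar> < e1" "\<And>s. s \<in> {0..T1} \<Longrightarrow> dist (v (\<tau> s)) (d s) < e1"
    and vc: "v \<in> cadlag_paths"
    using v by (auto simp: skorohod_nbhd_def)
  obtain \<sigma> where \<sigma>: "\<sigma> \<in> time_changes" "\<And>s. s \<ge> 0 \<Longrightarrow> \<bar>\<sigma> s - s\<bar> < e2" "\<And>s. s \<in> {0..T2} \<Longrightarrow> dist (d (\<sigma> s)) (w s) < e2"
    using d by (auto simp: skorohod_nbhd_def)
  note comp = time_changes_comp[OF \<tau>(1) \<sigma>(1)]
  show ?thesis unfolding skorohod_nbhd_def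
  proof (intro CollectI conjI bexI[OF _ comp] allI ballI impI vc)
    fix s :: real assume s: "0 \<le> s"
    show "\<bar>\<tau> (\<sigma> s) - s\<bar> < e1 + e2"
      using \<tau>(2)[OF time_changes_nonneg[OF \<sigma>(1) s]] \<sigma>(2)[OF s] by linarith
  next
    fix s assume s: "s \<in> {0..T}"
    have "\<sigma> s \<in> {0..T1}" using \<sigma>(2)[of s] time_changes_nonneg[OF \<sigma>(1), of s] s assms(4) by auto
    from \<tau>(3)[OF this] \<sigma>(3)[of s] s assms(3)
    show "dist (v (\<tau> (\<sigma> s))) (w s) < e1 + e2"
      by (intro le_less_trans[OF dist_triangle[of _ _ "d (\<sigma> s)"]]) auto
  qed
qed

lemma skorohod_nbhd_refl:
  assumes "w \<in> cadlag_paths" "e > 0" shows "w \<in> skorohod_nbhd w T e"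
proof -
  have "(\<lambda>s. s) \<in> time_changes" by (auto simp: time_changes_def strict_mono_on_def bij_betw_def)
  then show ?thesis using assms by (auto simp: skorohod_nbhd_def intro!: bexI[of _ "\<lambda>s. s"])
qed

text \<open>\<open>one_jump K h N w\<close>: the coarsened path jumps at most once in each cell \<open>(l * h, (l + 1) * h]\<close>, \<open>l < N\<close>.\<close>

definition one_jump :: "nat \<Rightarrow> real \<Rightarrow> nat \<Rightarrow> (real \<Rightarrow> state) \<Rightarrow> bool" where
  "one_jump K h N w \<longleftrightarrow> (\<forall>l<N. \<exists>t. real l * h < t \<and> t \<le> real (Suc l) * h \<and>
     (\<forall>s\<in>{real l * h..<t}. coarse K (w s) = coarse K (w (real l * h))) \<and>
     (\<forall>s\<in>{t..real (Suc l) * h}. coarse K (w s) = coarse K (w (real (Suc l) * h))))"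

text \<open>The time change moves the jump in each cell to the right end point of the cell.\<close>

lemma one_jump_grid:
  assumes h: "h > 0" and oj: "one_jump K h N w"
  obtains g where "g 0 = 0" "\<And>l. l < Suc N \<Longrightarrow> g l < g (Suc l)" "g (Suc N) = real (Suc N) * h"
    "\<And>l. l \<le> N \<Longrightarrow> real l * h - h \<le> g l \<and> g l \<le> real l * h"
    "\<And>l s. l < N \<Longrightarrow> g l \<le> s \<Longrightarrow> s < g (Suc l) \<Longrightarrow> coarse K (w s) = coarse K (w (real l * h))"
proof -
  obtain t where t: "\<And>l. l < N \<Longrightarrow> real l * h < t l \<and> t l \<le> real (Suc l) * h"
     "\<And>l s. l < N \<Longrightarrow> s \<in> {real l * h..<t l} \<Longrightarrow> coarse K (w s) = coarse K (w (real l * h))"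
     "\<And>l s. l < N \<Longrightarrow> s \<in> {t l..real (Suc l) * h} \<Longrightarrow> coarse K (w s) = coarse K (w (real (Suc l) * h))"
    using oj unfolding one_jump_def by metis
  \<comment> \<open>\<open>g (Suc k)\<close> is the jump time of cell \<open>k\<close> for
    \<open>k < N\<close>. The last node is the end point of the grid, from which on the time change
    is the identity.\<close>
  define g where "g l = (case l of 0 \<Rightarrow> 0 | Suc k \<Rightarrow> if k < N then t k else real l * h)" for l
  have gS: "g (Suc k) = (if k < N then t k else real (Suc k) * h)" for k by (simp add: g_def)
  have g0: "g 0 = 0" by (simp add: g_def)
  have b: "real l * h - h \<le> g l \<and> g l \<le> real l * h" if "l \<le> N" for l
    using t(1)[of "l - 1"] that h by (cases l) (auto simp: g0 gS algebra_simps)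
  have b2: "real l * h < g (Suc l)" if "l \<le> N" for l
    using t(1)[of l] that h by (auto simp: gS)
  show ?thesis
  proof (rule that)
    show "g l < g (Suc l)" if "l < Suc N" for l using b[of l] b2[of l] that by auto
    \<comment> \<open>To the right of \<open>l * h\<close> the path has not yet jumped in cell
      \<open>l\<close>; to the left of it the jump of the preceding cell is already over.\<close>
    fix l s assume l: "l < N" and s: "g l \<le> s" "s < g (Suc l)"
    show "coarse K (w s) = coarse K (w (real l * h))"
    proof (cases "s \<ge> real l * h")
      case True
      have "s < t l" using s l by (simp add: gS)
      with True show ?thesis by (intro t(2)[OF l]) auto
    next
      case False
      then obtain k where k: "l = Suc k" using s g0 by (cases l) auto
      have "t k \<le> s" "s \<le> real (Suc k) * h" using s l False by (simp_all add: gS k)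
      then show ?thesis unfolding k using l k by (intro t(3)) auto
    qed
  qed (use g0 b in \<open>auto simp: gS\<close>)
qed

text \<open>If \<open>s\<close> is in a cell of \<open>x\<close>, then \<open>\<tau> s\<close> is in
  the cell of \<open>y\<close> with the same index, so their distance is controlled by the two
  crossed differences of end points.\<close>

lemma grid_time_bound:
  fixes x y :: "nat \<Rightarrow> real"
  assumes \<tau>: "\<tau> \<in> time_changes" "\<forall>l\<le>M. \<tau> (x l) = y l" "\<forall>s\<ge>x M. \<tau> s = s"
    and x0: "x 0 = 0" "\<forall>l. x l \<ge> 0" and s: "s \<ge> 0"
  shows "s < x M \<Longrightarrow> \<exists>l<M. x l \<le> s \<and> s < x (Suc l) \<and> y l \<le> \<tau> s \<and> \<tau> s < y (Suc l)"
    and "(\<And>l. l < M \<Longrightarrow> y (Suc l) - x l < e) \<Longrightarrow> (\<And>l. l < M \<Longrightarrow> x (Suc l) - y l < e) \<Longrightarrow> e > 0 \<Longrightarrow> \<bar>\<tau> s - s\<bar> < e"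
proof -
  have sm: "\<tau> p < \<tau> q" if "0 \<le> p" "p < q" for p q
    using \<tau>(1) that by (auto simp: time_changes_def strict_mono_on_def)
  show find: "\<exists>l<M. x l \<le> s \<and> s < x (Suc l) \<and> y l \<le> \<tau> s \<and> \<tau> s < y (Suc l)" if sM: "s < x M"
  proof -
    obtain l where l: "l < M" "x l \<le> s" "s < x (Suc l)" using grid_cell[of x s M] x0(1) s sM by auto
    have "\<tau> s < y (Suc l)" using sm[OF s l(3)] \<tau>(2)[rule_format, of "Suc l"] l(1) by simp
    moreover have "y l \<le> \<tau> s"
      using sm[OF x0(2)[rule_format], of l s] \<tau>(2)[rule_format, of l] l by (cases "x l = s") auto
    ultimately show ?thesis using l by blast
  qed
  show "\<bar>\<tau> s - s\<bar> < e" if close: "\<And>l. l < M \<Longrightarrow> y (Suc l) - x l < e" "\<And>l. l < M \<Longrightarrow> x (Suc l) - y l < e" and e: "e > 0"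
  proof (cases "s < x M")
    case True
    then obtain l where "l < M" "x l \<le> s" "s < x (Suc l)" "y l \<le> \<tau> s" "\<tau> s < y (Suc l)" using find by blast
    then show ?thesis using close[of l] by linarith
  next
    case False then show ?thesis using \<tau>(3) e by simp
  qed
qed

text \<open>The centre is the step path and not \<open>w\<close>, because the infimum of
  \<open>F\<close> over this neighbourhood has to be a function of the samples. The time change
  sends \<open>l * h\<close> to \<open>g l\<close>; as \<open>g l \<ge> l * h - h\<close>, no time
  moves by more than \<open>2 * h\<close>.\<close>

lemma one_jump_nbhd_step:
  assumes h: "h > 0" "2 * h < e" and K: "1 / (real K + 1) \<le> e" and oj: "one_jump K h N w"
    and w: "w \<in> cadlag_paths" and T: "T < real N * h"
  shows "w \<in> skorohod_nbhd (step h N (samples h N w)) T e"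
proof -
  obtain g where g: "g 0 = 0" "\<And>l. l < Suc N \<Longrightarrow> g l < g (Suc l)" "g (Suc N) = real (Suc N) * h"
    "\<And>l. l \<le> N \<Longrightarrow> real l * h - h \<le> g l \<and> g l \<le> real l * h"
    "\<And>l s. l < N \<Longrightarrow> g l \<le> s \<Longrightarrow> s < g (Suc l) \<Longrightarrow> coarse K (w s) = coarse K (w (real l * h))"
    by (rule one_jump_grid[OF h(1) oj]) blast
  let ?x = "\<lambda>l. real l * h"
  obtain \<tau> where \<tau>: "\<tau> \<in> time_changes" "\<forall>l\<le>Suc N. \<tau> (?x l) = g l" "\<forall>s\<ge>?x (Suc N). \<tau> s = s"
  proof -
    have "\<exists>\<tau>\<in>time_changes. (\<forall>l\<le>Suc N. \<tau> (?x l) = g l) \<and> (\<forall>s\<ge>?x (Suc N). \<tau> s = s)"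
      by (rule time_change_interpolation) (use g(1,2,3) h(1) in auto)
    then show ?thesis using that by blast
  qed
  have x0: "?x 0 = 0" by simp
  have xn: "\<forall>l. ?x l \<ge> 0" using h by simp
  have gle: "g l \<le> real l * h" if "l \<le> Suc N" for l using g(3) g(4)[of l] that by (cases "l = Suc N") auto
  note B = grid_time_bound[of \<tau> "Suc N" ?x g, OF \<tau> x0 xn]
  show ?thesis unfolding skorohod_nbhd_def
  proof (intro CollectI conjI w bexI[OF _ \<tau>(1)] allI impI ballI)
    fix s :: real assume s: "0 \<le> s"
    show "\<bar>\<tau> s - s\<bar> < e"
    proof (rule B(2)[OF s])
      fix l assume l: "l < Suc N"
      show "g (Suc l) - real l * h < e" using gle[of "Suc l"] l h by (simp add: algebra_simps)
      show "real (Suc l) * h - g l < e" using g(4)[of l] l h by (simp add: algebra_simps)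
    qed (use h in auto)
  next
    fix s assume s: "s \<in> {0..T}"
    have sN: "s < real N * h" using s T by auto
    then have "s < ?x (Suc N)" using h by (simp add: algebra_simps)
    then obtain l where l: "l < Suc N" "?x l \<le> s" "s < ?x (Suc l)" "g l \<le> \<tau> s" "\<tau> s < g (Suc l)"
      using B(1)[of s] s by auto
    have lN: "l < N" using l(2) sN h by (metis le_less_trans mult_less_cancel_right_pos of_nat_less_iff)
    have "step h N (samples h N w) s = w (real l * h)"
      using h(1) lN l by (intro step_samples) auto
    moreover have "coarse K (w (\<tau> s)) = coarse K (w (real l * h))" by (rule g(5)[OF lN l(4,5)])
    ultimately show "dist (w (\<tau> s)) (step h N (samples h N w) s) < e"
      using coarse_eq_dist K by (metis less_le_trans)
  qed
qed

text \<open>The inverse time change, from \<open>g l\<close> to \<open>l * h\<close>. The horizon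
  ends one cell earlier because only \<open>g N \<ge> N * h - h\<close> is known. With
  \<open>N'\<close> the step path may have more samples than there are controlled cells.\<close>

lemma step_nbhd_path:
  assumes h: "h > 0" "2 * h < e" and K: "1 / (real K + 1) \<le> e" and oj: "one_jump K h N w"
    and T: "T < real N * h - h" and N': "N \<le> N'"
  shows "step h N' (samples h N' w) \<in> skorohod_nbhd w T e"
proof -
  obtain g where g: "g 0 = 0" "\<And>l. l < Suc N \<Longrightarrow> g l < g (Suc l)" "g (Suc N) = real (Suc N) * h"
    "\<And>l. l \<le> N \<Longrightarrow> real l * h - h \<le> g l \<and> g l \<le> real l * h"
    "\<And>l s. l < N \<Longrightarrow> g l \<le> s \<Longrightarrow> s < g (Suc l) \<Longrightarrow> coarse K (w s) = coarse K (w (real l * h))"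
    by (rule one_jump_grid[OF h(1) oj]) blast
  \<comment> \<open>Extended by 0 past the last node, since \<open>grid_time_bound\<close> asks for
    nonnegative values at every index.\<close>
  define x where "x l = (if l \<le> Suc N then g l else 0)" for l
  let ?y = "\<lambda>l. real l * h"
  obtain \<tau> where \<tau>: "\<tau> \<in> time_changes" "\<forall>l\<le>Suc N. \<tau> (x l) = ?y l" "\<forall>s\<ge>x (Suc N). \<tau> s = s"
  proof -
    have "\<exists>\<tau>\<in>time_changes. (\<forall>l\<le>Suc N. \<tau> (x l) = ?y l) \<and> (\<forall>s\<ge>x (Suc N). \<tau> s = s)"
      by (rule time_change_interpolation) (use g(1,2,3) h(1) in \<open>auto simp: x_def\<close>)
    then show ?thesis using that by blast
  qed
  have "0 \<le> g l" if "l \<le> Suc N" for l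
    using that by (induction l) (auto simp: g(1) intro: order_trans[OF _ less_imp_le[OF g(2)]])
  then have xn: "\<forall>l. x l \<ge> 0" by (simp add: x_def)
  have x0: "x 0 = 0" by (simp add: x_def g)
  have gle: "g l \<le> real l * h" if "l \<le> Suc N" for l using g(3) g(4)[of l] that by (cases "l = Suc N") auto
  note B = grid_time_bound[of \<tau> "Suc N" x ?y, OF \<tau> x0 xn]
  show ?thesis unfolding skorohod_nbhd_def
  proof (intro CollectI conjI step_cadlag h bexI[OF _ \<tau>(1)] allI impI ballI)
    fix s :: real assume s: "0 \<le> s"
    show "\<bar>\<tau> s - s\<bar> < e"
    proof (rule B(2)[OF s])
      fix l assume l: "l < Suc N"
      show "x (Suc l) - real l * h < e" using gle[of "Suc l"] l h by (simp add: algebra_simps x_def)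
      show "real (Suc l) * h - x l < e" using g(4)[of l] l h by (simp add: algebra_simps x_def)
    qed (use h in auto)
  next
    fix s assume s: "s \<in> {0..T}"
    have sN: "s < g N" using s T g(4)[of N] by auto
    also have "\<dots> < x (Suc N)" using g(2)[of N] by (simp add: x_def)
    finally have "s < x (Suc N)" .
    then obtain l where l: "l < Suc N" "x l \<le> s" "s < x (Suc l)" "real l * h \<le> \<tau> s" "\<tau> s < real (Suc l) * h"
      using B(1)[of s] s by auto
    have lN: "l < N" using l(1,2) sN by (cases "l = N") (auto simp: x_def)
    have "step h N' (samples h N' w) (\<tau> s) = w (real l * h)"
      using h(1) lN l N' by (intro step_samples) auto
    moreover have "coarse K (w s) = coarse K (w (real l * h))"
      using g(5)[OF lN, of s] l lN by (auto simp: x_def)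
    ultimately show "dist (step h N' (samples h N' w) (\<tau> s)) (w s) < e"
      using coarse_eq_dist K by (metis less_le_trans)
  qed
qed

section \<open>A fixed cadlag path on a fine grid\<close>

lemma cadlag_coarse_right:
  assumes "w \<in> cadlag_paths" "t \<ge> 0"
  obtains r where "r > 0" "\<And>s. t \<le> s \<Longrightarrow> s < t + r \<Longrightarrow> coarse K (w s) = coarse K (w t)"
proof -
  have "(w \<longlongrightarrow> w t) (at_right t)" using assms by (auto simp: cadlag_paths_def)
  then have "\<forall>\<^sub>F s in at_right t. dist (w s) (w t) < 1 / ((real K + 1) * (real K + 2))"
    by (rule tendstoD) simp
  then obtain u where "u > t" "\<And>s. t < s \<Longrightarrow> s < u \<Longrightarrow> dist (w s) (w t) < 1 / ((real K + 1) * (real K + 2))"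
    unfolding eventually_at_right_field by blast
  then show ?thesis
    by (intro that[of "u - t"]) (auto simp: le_less intro: coarse_locally_constant)
qed

lemma cadlag_coarse_left:
  assumes "w \<in> cadlag_paths" "t > 0"
  obtains r c where "r > 0" "\<And>s. t - r < s \<Longrightarrow> s < t \<Longrightarrow> coarse K (w s) = c"
proof -
  obtain l where "(w \<longlongrightarrow> l) (at_left t)" using assms by (auto simp: cadlag_paths_def)
  then have "\<forall>\<^sub>F s in at_left t. dist (w s) l < 1 / ((real K + 1) * (real K + 2))"
    by (rule tendstoD) simp
  then obtain u where "u < t" "\<And>s. u < s \<Longrightarrow> s < t \<Longrightarrow> dist (w s) l < 1 / ((real K + 1) * (real K + 2))"
    unfolding eventually_at_left_field by blast
  then show ?thesis
    by (intro that[of "t - u" "coarse K l"]) (auto intro: coarse_locally_constant)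
qed

text \<open>Every time is the centre of an interval in which the coarse path can jump only at the
  centre. These intervals cover \<open>[0, T]\<close>, and a cell shorter than a Lebesgue number of
  the cover lies in one of them.\<close>

lemma one_jump_eventually:
  assumes w: "w \<in> cadlag_paths"
  obtains \<delta> where "\<delta> > 0" "\<And>h N. 0 < h \<Longrightarrow> h < \<delta> \<Longrightarrow> real N * h \<le> T \<Longrightarrow> one_jump K h N w"
proof -
  have "\<exists>r c. r > 0 \<and> (\<forall>s. t \<le> s \<longrightarrow> s < t + r \<longrightarrow> coarse K (w s) = coarse K (w t)) \<and>
      (\<forall>s\<ge>0. t - r < s \<longrightarrow> s < t \<longrightarrow> coarse K (w s) = c)" if t: "t \<ge> 0" for t
  proof -
    obtain r1 where r1: "r1 > 0" "\<And>s. t \<le> s \<Longrightarrow> s < t + r1 \<Longrightarrow> coarse K (w s) = coarse K (w t)"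
      by (rule cadlag_coarse_right[OF w t, where K = K]) blast
    show ?thesis
    proof (cases "t = 0")
      \<comment> \<open>Time 0 has no left neighbourhood in the half-line, so the condition on
        \<open>c\<close> is vacuous.\<close>
      case True
      show ?thesis
      proof (intro exI[of _ r1] exI[of _ undefined] conjI allI impI)
        show "coarse K (w s) = coarse K (w t)" if "t \<le> s" "s < t + r1" for s by (rule r1(2)[OF that])
      qed (use r1(1) True in auto)
    next
      case False
      then obtain r2 c where r2: "r2 > 0" "\<And>s. t - r2 < s \<Longrightarrow> s < t \<Longrightarrow> coarse K (w s) = c"
        using cadlag_coarse_left[OF w, of t] t by (metis le_less)
      show ?thesis
      proof (intro exI[of _ "min r1 r2"] exI[of _ c] conjI allI impI)
        show "coarse K (w s) = coarse K (w t)" if "t \<le> s" "s < t + min r1 r2" for s using that by (intro r1(2)) auto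
        show "coarse K (w s) = c" if "t - min r1 r2 < s" "s < t" for s using that by (intro r2(2)) auto
      qed (use r1(1) r2(1) in auto)
    qed
  qed
  then obtain r c where r: "\<And>t. t \<ge> 0 \<Longrightarrow> r t > 0"
      "\<And>t s. t \<ge> 0 \<Longrightarrow> t \<le> s \<Longrightarrow> s < t + r t \<Longrightarrow> coarse K (w s) = coarse K (w t)"
      "\<And>t s. t \<ge> 0 \<Longrightarrow> s \<ge> 0 \<Longrightarrow> t - r t < s \<Longrightarrow> s < t \<Longrightarrow> coarse K (w s) = c t"
    by metis
  have "compact {0..T}" by simp
  moreover have "{0..T} \<subseteq> \<Union> ((\<lambda>t. {t - r t<..<t + r t}) ` {0..})"
    using r(1) by (force intro: bexI)
  ultimately obtain e where e: "e > 0" "\<And>x. x \<in> {0..T} \<Longrightarrow> \<exists>G\<in>(\<lambda>t. {t - r t<..<t + r t}) ` {0..}. ball x e \<subseteq> G"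
    using Heine_Borel_lemma[of "{0..T}" "(\<lambda>t. {t - r t<..<t + r t}) ` {0..}"] by (metis (no_types, lifting) imageE open_greaterThanLessThan)
  show ?thesis
  proof (rule that[OF e(1)])
    fix h N assume h: "0 < h" "h < e" and N: "real N * h \<le> T"
    show "one_jump K h N w" unfolding one_jump_def
    proof (intro allI impI)
      fix l assume l: "l < N"
      have l0: "real l * h \<ge> 0" using h by simp
      have "real l * h \<le> real N * h" using l h by (intro mult_right_mono) auto
      then obtain t where t: "t \<ge> 0" "ball (real l * h) e \<subseteq> {t - r t<..<t + r t}"
        using e(2)[of "real l * h"] l0 N by auto
      have near: "t - r t < s \<and> s < t + r t" if "real l * h \<le> s" "s \<le> real (Suc l) * h" for s
      proof -
        have "s \<in> ball (real l * h) e" using that h by (auto simp: dist_real_def algebra_simps)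
        then show ?thesis using t by auto
      qed
      have Sl: "real (Suc l) * h = real l * h + h" by (simp add: algebra_simps)
      \<comment> \<open>The only possible jump is at \<open>t\<close>. If \<open>t\<close> is
        outside \<open>(l * h, (l + 1) * h]\<close>, the coarse path is constant on the cell and the
        right end point serves as jump time.\<close>
      consider "t \<le> real l * h" | "real l * h < t" "t \<le> real (Suc l) * h" | "real (Suc l) * h < t" by linarith
      then show "\<exists>t. real l * h < t \<and> t \<le> real (Suc l) * h \<and>
         (\<forall>s\<in>{real l * h..<t}. coarse K (w s) = coarse K (w (real l * h))) \<and>
         (\<forall>s\<in>{t..real (Suc l) * h}. coarse K (w s) = coarse K (w (real (Suc l) * h)))"
      proof cases
        case 1
        have "coarse K (w s) = coarse K (w t)" if "real l * h \<le> s" "s \<le> real (Suc l) * h" for s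
          using r(2)[OF t(1), of s] near[OF that] that 1 by auto
        then show ?thesis using h Sl by (intro exI[of _ "real (Suc l) * h"]) auto
      next
        case 2
        have L: "coarse K (w s) = c t" if "real l * h \<le> s" "s < t" for s
          using r(3)[OF t(1), of s] near[of s] that 2 l0 by auto
        have R: "coarse K (w s) = coarse K (w t)" if "t \<le> s" "s \<le> real (Suc l) * h" for s
          using r(2)[OF t(1), of s] near[of s] that 2 by auto
        show ?thesis
        proof (intro exI[of _ t] conjI ballI 2)
          fix s
          show "coarse K (w s) = coarse K (w (real l * h))" if "s \<in> {real l * h..<t}"
            using L[of s] L[of "real l * h"] that 2 by simp
          show "coarse K (w s) = coarse K (w (real (Suc l) * h))" if "s \<in> {t..real (Suc l) * h}"
            using R[of s] R[of "real (Suc l) * h"] that 2 by simp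
        qed
      next
        case 3
        have "coarse K (w s) = c t" if "real l * h \<le> s" "s \<le> real (Suc l) * h" for s
          using r(3)[OF t(1), of s] near[OF that] that 3 l0 by auto
        then show ?thesis using h Sl by (intro exI[of _ "real (Suc l) * h"]) auto
      qed
    qed
  qed
qed

text \<open>For a fixed path \<open>one_jump\<close> holds as soon as the mesh is small, which
  brings its sampled step paths close to it.\<close>

lemma step_samples_converge:
  fixes w :: "real \<Rightarrow> state"
  assumes w: "w \<in> cadlag_paths" and e: "e > 0" and T: "T \<ge> 0"
  obtains \<delta> where "\<delta> > 0" "\<And>h N. 0 < h \<Longrightarrow> h < \<delta> \<Longrightarrow> T + 2 \<le> real N * h \<Longrightarrow> step h N (samples h N w) \<in> skorohod_nbhd w T e"
proof -
  obtain K :: nat where K: "1 / (real K + 1) \<le> e"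
    using reals_Archimedean[OF e] by (auto simp: divide_inverse add.commute intro: less_imp_le)
  obtain \<delta> where \<delta>: "\<delta> > 0" "\<And>h N. 0 < h \<Longrightarrow> h < \<delta> \<Longrightarrow> real N * h \<le> T + 2 \<Longrightarrow> one_jump K h N w"
    by (rule one_jump_eventually[OF w]) blast
  show ?thesis
  proof (rule that[of "min \<delta> (min (e/2) (1/2))"])
    fix h N assume h: "0 < h" "h < min \<delta> (min (e/2) (1/2))" and N: "T + 2 \<le> real N * h"
    \<comment> \<open>\<open>one_jump\<close> is available only up to time \<open>T + 2\<close>,
      while \<open>N * h\<close> may be larger. \<open>M\<close> cells end between
      \<open>T + 2 * h\<close> and \<open>T + 3 * h\<close>, before \<open>T + 2\<close> as
      \<open>h < 1/2\<close>.\<close>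
    define M where "M = nat \<lceil>T / h\<rceil> + 2"
    have c: "T / h \<le> real_of_int \<lceil>T / h\<rceil>" "real_of_int \<lceil>T / h\<rceil> < T / h + 1" "\<lceil>T / h\<rceil> \<ge> 0"
    proof -
      have "0 \<le> T / h" using T h by simp
      then show "T / h \<le> real_of_int \<lceil>T / h\<rceil>" "real_of_int \<lceil>T / h\<rceil> < T / h + 1" "\<lceil>T / h\<rceil> \<ge> 0" by linarith+
    qed
    then have M: "T / h + 2 \<le> real M" "real M < T / h + 3" by (auto simp: M_def)
    then have M': "T + 2 * h \<le> real M * h" "real M * h < T + 3 * h" using h by (auto simp: field_simps)
    have "real M * h \<le> real N * h" using M' N h(2) unfolding min_less_iff_conj by linarith
    then have "real M \<le> real N" by (rule mult_right_le_imp_le) (rule h(1))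
    then have "M \<le> N" by simp
    show "step h N (samples h N w) \<in> skorohod_nbhd w T e"
      by (rule step_nbhd_path[OF _ _ K \<delta>(2) _ \<open>M \<le> N\<close>]) (use h M' in auto)
  qed (use \<delta> e in auto)
qed

section \<open>Measurability of Skorohod-continuous functions\<close>

lemma skorohod_continuousD:
  assumes F: "continuous_map skorohod euclideanreal F" and w: "w \<in> cadlag_paths" and e: "e > 0"
  obtains T d where "T > 0" "d > 0" "\<And>v. v \<in> skorohod_nbhd w T d \<Longrightarrow> \<bar>F v - F w\<bar> < e"
proof -
  have "openin skorohod {v \<in> topspace skorohod. F v \<in> ball (F w) e}"
    using F by (intro openin_continuous_map_preimage[OF F]) auto
  then have "openin skorohod {v \<in> cadlag_paths. \<bar>F v - F w\<bar> < e}"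
    by (simp add: topspace_skorohod dist_real_def abs_minus_commute)
  then obtain T d where "T > 0" "d > 0" "skorohod_nbhd w T d \<subseteq> {v \<in> cadlag_paths. \<bar>F v - F w\<bar> < e}"
    unfolding openin_skorohod using w e by auto
  then show ?thesis by (intro that[of T d]) auto
qed

lemma sets_coordinate: 
  assumes "t \<ge> 0" shows "{w \<in> space path_space. w t = x} \<in> sets path_space"
proof -
  have "(\<lambda>w. w t) \<in> measurable (PiM {0..} (\<lambda>_. borel)) borel"
    using assms by (intro measurable_component_singleton) auto
  then have "(\<lambda>w. w t) \<in> measurable path_space borel"
    unfolding path_space_def by (rule measurable_restrict_space1)
  then have "(\<lambda>w. w t) -` {x} \<inter> space path_space \<in> sets path_space"
    by (rule measurable_sets) (auto intro!: borel_closed)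
  also have "(\<lambda>w. w t) -` {x} \<inter> space path_space = {w \<in> space path_space. w t = x}" by auto
  finally show ?thesis .
qed

lemma samples_measurable:
  assumes "h \<ge> 0" shows "samples h N \<in> measurable path_space (count_space (UNIV :: state list set))"
proof (subst measurable_count_space_eq2_countable, safe)
  fix xs :: "state list"
  have "{w \<in> space path_space. \<forall>k\<in>{..N}. w (real k * h) = xs ! k} \<in> sets path_space"
    using assms by (intro sets.sets_Collect_finite_All' sets_coordinate) auto
  moreover have "samples h N -` {xs} \<inter> space path_space =
     (if length xs = Suc N then {w \<in> space path_space. \<forall>k\<in>{..N}. w (real k * h) = xs ! k} else {})"
    by (auto simp: list_eq_iff_nth_eq less_Suc_eq_le nth_samples length_samples)
  ultimately show "samples h N -` {xs} \<inter> space path_space \<in> sets path_space" by simp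
qed auto

text \<open>\<open>F\<close> is the pointwise limit of its values at sampled step paths, and each of
  these is a function of a list from a countable set.\<close>

lemma continuous_imp_measurable:
  assumes F: "continuous_map skorohod euclideanreal F"
  shows "F \<in> borel_measurable path_space"
proof (rule borel_measurable_LIMSEQ_real)
  \<comment> \<open>The mesh tends to 0 while the covered time \<open>m + 1\<close> tends to
    infinity.\<close>
  let ?h = "\<lambda>m. 1 / (real m + 1)" and ?N = "\<lambda>m. (m + 1) * (m + 1)"
  show "(\<lambda>w. F (step (?h m) (?N m) (samples (?h m) (?N m) w))) \<in> borel_measurable path_space" for m
    by (rule measurable_compose[OF samples_measurable]) auto
  fix w assume "w \<in> space path_space"
  then have w: "w \<in> cadlag_paths" by (simp add: space_path_space)
  show "(\<lambda>m. F (step (?h m) (?N m) (samples (?h m) (?N m) w))) \<longlonglongrightarrow> F w"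
  proof (rule tendstoI)
    fix e :: real assume "e > 0"
    then obtain T d where T: "T > 0" "d > 0" "\<And>v. v \<in> skorohod_nbhd w T d \<Longrightarrow> \<bar>F v - F w\<bar> < e"
      using skorohod_continuousD[OF F w] by metis
    obtain \<delta> where \<delta>: "\<delta> > 0" "\<And>h N. 0 < h \<Longrightarrow> h < \<delta> \<Longrightarrow> T + 2 \<le> real N * h \<Longrightarrow> step h N (samples h N w) \<in> skorohod_nbhd w T d"
      using step_samples_converge[OF w T(2), of T] T(1) by (metis less_imp_le)
    have "\<forall>\<^sub>F m in sequentially. ?h m < \<delta>"
      using order_tendstoD(2)[OF LIMSEQ_inverse_real_of_nat \<delta>(1)]
      by eventually_elim (simp add: inverse_eq_divide add.commute)
    moreover have "\<forall>\<^sub>F m in sequentially. T + 2 \<le> real m"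
      by (rule eventually_ge_at_top[THEN eventually_compose_filterlim, OF filterlim_real_sequentially])
    ultimately show "\<forall>\<^sub>F m in sequentially. dist (F (step (?h m) (?N m) (samples (?h m) (?N m) w))) (F w) < e"
    proof eventually_elim
      case (elim m)
      have "real (?N m) * ?h m = real m + 1" by (simp add: field_simps)
      then show ?case using elim by (auto simp: dist_real_def intro!: T(3) \<delta>(2))
    qed
  qed
qed

section \<open>Two coarse jumps detected on dyadic grids\<close>

definition two_jumps_grid :: "nat \<Rightarrow> real \<Rightarrow> nat \<Rightarrow> nat \<Rightarrow> (real \<Rightarrow> state) \<Rightarrow> bool" where
  "two_jumps_grid K h N L w \<longleftrightarrow> (\<exists>l<N. \<exists>i j k. l * L \<le> i \<and> i < j \<and> j < k \<and> k \<le> Suc l * L \<and>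
     coarse K (w (real i * (h / real L))) \<noteq> coarse K (w (real j * (h / real L))) \<and>
     coarse K (w (real j * (h / real L))) \<noteq> coarse K (w (real k * (h / real L))))"

lemma two_jumps_grid_mono:
  assumes "two_jumps_grid K h N L w" "m > 0"
  shows "two_jumps_grid K h N (m * L) w"
proof -
  obtain l i j k where *: "l < N" "l * L \<le> i" "i < j" "j < k" "k \<le> Suc l * L"
     "coarse K (w (real i * (h / real L))) \<noteq> coarse K (w (real j * (h / real L)))"
     "coarse K (w (real j * (h / real L))) \<noteq> coarse K (w (real k * (h / real L)))"
    using assms unfolding two_jumps_grid_def by blast
  have e: "real (m * i) * (h / real (m * L)) = real i * (h / real L)" for i using assms(2) by simp
  show ?thesis unfolding two_jumps_grid_def
    by (intro exI[of _ l] conjI exI[of _ "m * i"] exI[of _ "m * j"] exI[of _ "m * k"])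
       (use * assms(2) mult_le_mono2[OF *(2), of m] mult_le_mono2[OF *(5), of m] in \<open>auto simp only: e mult_less_cancel1 mult.left_commute mult.assoc\<close>)
qed

text \<open>Without \<open>one_jump\<close> some cell contains three times with successive different
  coarse values, and by right continuity these values are still seen at nearby points of a fine
  dyadic grid. This covers the failure of \<open>one_jump\<close> by countably many events of
  finitely many coordinates.\<close>

lemma not_one_jump_imp_grid:
  assumes w: "w \<in> cadlag_paths" and h: "h > 0" and bad: "\<not> one_jump K h N w"
  shows "\<exists>r. two_jumps_grid K h N (2 ^ r) w"
proof -
  obtain l where l: "l < N" and nt: "\<And>t. real l * h < t \<Longrightarrow> t \<le> real (Suc l) * h \<Longrightarrow>
     \<not> ((\<forall>s\<in>{real l * h..<t}. coarse K (w s) = coarse K (w (real l * h))) \<and>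
     (\<forall>s\<in>{t..real (Suc l) * h}. coarse K (w s) = coarse K (w (real (Suc l) * h))))"
    using bad unfolding one_jump_def by blast
  define A B where "A = real l * h" and "B = real (Suc l) * h"
  have AB: "A < B" "A \<ge> 0" using h by (auto simp: A_def B_def algebra_simps)
  let ?c = "\<lambda>s. coarse K (w s)"
  have "\<exists>s t u. A \<le> s \<and> s < t \<and> t < u \<and> u \<le> B \<and> ?c s \<noteq> ?c t \<and> ?c t \<noteq> ?c u"
  proof -
    \<comment> \<open>The first coarse change is at the infimum of \<open>S\<close>, which is
      attained by right continuity. It cannot serve as the only jump time, so another change
      follows.\<close>
    define S where "S = {x \<in> {A..B}. ?c x \<noteq> ?c A}"
    have "S \<noteq> {}"
    proof
      assume "S = {}"
      have "\<forall>s\<in>{A..<B}. ?c s = ?c A"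
      proof
        fix s assume "s \<in> {A..<B}"
        moreover have "s \<notin> S" using \<open>S = {}\<close> by simp
        ultimately show "?c s = ?c A" unfolding S_def by simp
      qed
      moreover have "\<forall>s\<in>{B..B}. ?c s = ?c B" by simp
      ultimately show False using nt[of B, folded A_def B_def] AB by blast
    qed
    define t where "t = Inf S"
    have bS: "bdd_below S" by (auto simp: S_def intro: bdd_belowI[of _ A])
    have tA: "A \<le> t" unfolding t_def using \<open>S \<noteq> {}\<close> by (intro cInf_greatest) (auto simp: S_def)
    have tB: "t \<le> B" using \<open>S \<noteq> {}\<close> cInf_lower[OF _ bS] unfolding t_def by (force simp: S_def)
    have before: "?c s = ?c A" if "A \<le> s" "s < t" for s
      using cInf_lower[OF _ bS, of s] that tB unfolding t_def S_def by fastforce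
    obtain r where r: "r > 0" "\<And>s. t \<le> s \<Longrightarrow> s < t + r \<Longrightarrow> ?c s = ?c t"
      using cadlag_coarse_right[OF w, of t K] tA AB by (metis order_trans)
    have tS: "?c t \<noteq> ?c A"
    proof
      assume "?c t = ?c A"
      have "t + r \<le> x" if "x \<in> S" for x
      proof (rule ccontr)
        assume "\<not> t + r \<le> x"
        have x: "A \<le> x" "?c x \<noteq> ?c A" using that unfolding S_def by auto
        show False
        proof (cases "x < t")
          case True then show ?thesis using before[OF x(1)] x(2) by blast
        next
          case False
          then have "?c x = ?c t" using \<open>\<not> t + r \<le> x\<close> by (intro r(2)) auto
          then show ?thesis using x(2) \<open>?c t = ?c A\<close> by simp
        qed
      qed
      then have "t + r \<le> t" unfolding t_def[symmetric] using \<open>S \<noteq> {}\<close> by (subst (2) t_def) (rule cInf_greatest)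
      then show False using r by simp
    qed
    have "A < t" using tS tA by (cases "t = A") auto
    have "\<forall>s\<in>{A..<t}. ?c s = ?c A" by (auto intro: before)
    then have "\<not> (\<forall>s\<in>{t..B}. ?c s = ?c B)" using nt[of t, folded A_def B_def] \<open>A < t\<close> tB by blast
    then obtain u where u: "t \<le> u" "u \<le> B" "?c u \<noteq> ?c B" by auto
    have "\<exists>u. t < u \<and> u \<le> B \<and> ?c u \<noteq> ?c t"
    proof (cases "?c u = ?c t")
      case True
      then have "?c B \<noteq> ?c t" using u(3) by simp
      moreover from this have "t < B" using tB by (cases "t = B") auto
      ultimately show ?thesis by blast
    next
      case False
      then have "t < u" using u(1) by (cases "t = u") auto
      with False u(2) show ?thesis by blast
    qed
    then show ?thesis using \<open>A < t\<close> tS by (metis order_refl)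
  qed
  then obtain s t u where stu: "A \<le> s" "s < t" "t < u" "u \<le> B" "?c s \<noteq> ?c t" "?c t \<noteq> ?c u" by blast
  obtain r1 where r1: "r1 > 0" "\<And>x. s \<le> x \<Longrightarrow> x < s + r1 \<Longrightarrow> ?c x = ?c s"
    using cadlag_coarse_right[OF w, of s K] stu AB by (metis order_trans)
  obtain r2 where r2: "r2 > 0" "\<And>x. t \<le> x \<Longrightarrow> x < t + r2 \<Longrightarrow> ?c x = ?c t"
    using cadlag_coarse_right[OF w, of t K] stu AB by (metis order_trans less_imp_le)
  obtain r3 where r3: "r3 > 0" "\<And>x. u \<le> x \<Longrightarrow> x < u + r3 \<Longrightarrow> ?c x = ?c u"
    using cadlag_coarse_right[OF w, of u K] stu AB by (metis order_trans less_imp_le)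
  \<comment> \<open>Each of the three values persists for a time \<open>\<epsilon>\<close> and the
    gaps are at least as long, so rounding up to the grid keeps values and order.\<close>
  define \<epsilon> where "\<epsilon> = min (min r1 r2) (min r3 (min (t - s) (u - t)))"
  have \<epsilon>: "\<epsilon> > 0" using r1(1) r2(1) r3(1) stu(2,3) by (simp add: \<epsilon>_def)
  obtain r :: nat where r: "h / \<epsilon> < 2 ^ r" using real_arch_pow[of 2 "h / \<epsilon>"] by auto
  define L :: nat where "L = 2 ^ r"
  define \<eta> where "\<eta> = h / real L"
  have L: "L > 0" by (simp add: L_def)
  have \<eta>: "\<eta> > 0" "\<eta> < \<epsilon>" using r \<epsilon> h by (auto simp: \<eta>_def L_def field_simps)
  define i where "i x = nat \<lceil>x / \<eta>\<rceil>" for x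
  have i: "x \<le> real (i x) * \<eta>" "real (i x) * \<eta> < x + \<eta>" if "x \<ge> 0" for x
  proof -
    have "x / \<eta> \<ge> 0" using that \<eta> by simp
    then have "x / \<eta> \<le> real (i x)" "real (i x) < x / \<eta> + 1" unfolding i_def by linarith+
    then show "x \<le> real (i x) * \<eta>" "real (i x) * \<eta> < x + \<eta>" using \<eta> by (auto simp: field_simps)
  qed
  have AL: "A = real (l * L) * \<eta>" and BL: "B = real (Suc l * L) * \<eta>"
    using L by (simp_all add: A_def B_def \<eta>_def del: of_nat_Suc mult_Suc)
  have \<eta>r: "\<eta> < r1" "\<eta> < r2" "\<eta> < r3" "\<eta> < t - s" "\<eta> < u - t" using \<eta>(2) by (auto simp: \<epsilon>_def)
  have s0: "s \<ge> 0" "t \<ge> 0" "u \<ge> 0" using stu AB by auto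
  have less: "i x < i y" if "real (i x) * \<eta> < real (i y) * \<eta>" for x y using that \<eta> by simp
  have "l * L \<le> i s" 
  proof -
    have "real (l * L) * \<eta> \<le> real (i s) * \<eta>" using i(1)[OF s0(1)] stu AL by simp
    then have "real (l * L) \<le> real (i s)" by (rule mult_right_le_imp_le) (rule \<eta>(1))
    then show ?thesis by (simp only: of_nat_le_iff)
  qed
  moreover have "i s < i t"
  proof (rule less)
    show "real (i s) * \<eta> < real (i t) * \<eta>" using i(2)[OF s0(1)] i(1)[OF s0(2)] \<eta>r by linarith
  qed
  moreover have "i t < i u"
  proof (rule less)
    show "real (i t) * \<eta> < real (i u) * \<eta>" using i(2)[OF s0(2)] i(1)[OF s0(3)] \<eta>r by linarith
  qed
  \<comment> \<open>\<open>B\<close> is itself a grid point, so rounding \<open>u\<close> up does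
    not leave the cell.\<close>
  moreover have "i u \<le> Suc l * L"
  proof -
    have "u / \<eta> \<le> real (Suc l * L)" using stu(4) \<eta>(1) unfolding BL by (simp only: pos_divide_le_eq)
    then show ?thesis unfolding i_def by (simp add: nat_le_iff ceiling_le_iff del: of_nat_mult mult_Suc)
  qed
  moreover have "?c (real (i s) * \<eta>) = ?c s" using i[OF s0(1)] \<eta>r by (intro r1(2)) auto
  moreover have "?c (real (i t) * \<eta>) = ?c t" using i[OF s0(2)] \<eta>r by (intro r2(2)) auto
  moreover have "?c (real (i u) * \<eta>) = ?c u" using i[OF s0(3)] \<eta>r by (intro r3(2)) auto
  moreover note stu(5,6)
  ultimately have "l * L \<le> i s \<and> i s < i t \<and> i t < i u \<and> i u \<le> Suc l * L \<and>
      ?c (real (i s) * \<eta>) \<noteq> ?c (real (i t) * \<eta>) \<and> ?c (real (i t) * \<eta>) \<noteq> ?c (real (i u) * \<eta>)" by metis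
  then have "two_jumps_grid K h N L w"
    unfolding two_jumps_grid_def \<eta>_def[symmetric] using l by blast
  then show ?thesis unfolding L_def by blast
qed

section \<open>Two jumps in one cell\<close>

definition core :: "nat \<Rightarrow> state set" where "core K = Pt ` {..K}"

definition leave :: "nat \<Rightarrow> state \<Rightarrow> state \<Rightarrow> bool" where
  "leave K x y \<longleftrightarrow> x \<in> core K \<and> y \<noteq> x"

definition arrive :: "nat \<Rightarrow> state \<Rightarrow> state \<Rightarrow> bool" where
  "arrive K x y \<longleftrightarrow> x \<notin> core K \<and> y \<in> core K"

definition neighbours :: "nat \<Rightarrow> state set" where
  "neighbours i = {Pt i, Pt (Suc i)} \<union> (if i = 0 then {} else {Pt (i - 1)})"

text \<open>Covers killing and several jumps between two grid times as well as a jump past a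
  neighbour.\<close>

definition skip :: "nat \<Rightarrow> state \<Rightarrow> state \<Rightarrow> bool" where
  "skip K x y \<longleftrightarrow> (\<exists>i\<le>K. x = Pt i \<and> y \<notin> neighbours i)"

definition revive :: "state \<Rightarrow> state \<Rightarrow> bool" where
  "revive x y \<longleftrightarrow> x = Cemetery \<and> y \<noteq> Cemetery"

lemma change_step:
  fixes y :: "nat \<Rightarrow> 'a"
  assumes "m \<le> n" "Q (y m)" "\<not> Q (y n)"
  obtains r where "m \<le> r" "r < n" "Q (y r)" "\<not> Q (y (Suc r))"
proof -
  have "\<exists>r. m \<le> r \<and> r < n \<and> Q (y r) \<and> \<not> Q (y (Suc r))"
    using assms(1,3)
  proof (induction n rule: dec_induct)
    case base then show ?case using assms(2) by simp
  next
    case (step n)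
    then show ?case by (cases "Q (y n)") (auto intro: less_SucI)
  qed
  then show ?thesis using that by blast
qed

text \<open>The path can leave the coarse point at infinity again within a cell only after either
  a stay in \<open>K + 1\<close>, at which it has to arrive if it does not skip states, or an arrival in \<open>core K\<close> from outside.\<close>

lemma two_changes_events:
  assumes ijk: "i < j" "j < k" and c: "coarse K (y i) \<noteq> coarse K (y j)" "coarse K (y j) \<noteq> coarse K (y k)"
  shows "(\<exists>r. i \<le> r \<and> r < k \<and> (skip K (y r) (y (Suc r)) \<or> revive (y r) (y (Suc r)))) \<or>
    (\<exists>r r'. i \<le> r \<and> r < r' \<and> r' < k \<and> leave (Suc K) (y r') (y (Suc r')) \<and>
       (leave (Suc K) (y r) (y (Suc r)) \<or> arrive K (y r) (y (Suc r))))"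
proof -
  have coreS: "core K \<subseteq> core (Suc K)" by (auto simp: core_def)
  \<comment> \<open>The middle value decides: in the core it has to be entered and left, from the
    cemetery the path would have to revive, and otherwise the value is merged with infinity.\<close>
  consider "y j \<in> core K" | "y j = Cemetery" | "y j \<notin> core K" "y j \<noteq> Cemetery" by blast
  then show ?thesis
  proof cases
    case 1
    have "y i \<noteq> y j" "y k \<noteq> y j" using c by auto
    obtain r' where r': "j \<le> r'" "r' < k" "y r' = y j" "y (Suc r') \<noteq> y j"
      using change_step[of j k "\<lambda>x. x = y j" y] ijk \<open>y k \<noteq> y j\<close> by auto
    obtain r where r: "i \<le> r" "r < j" "y r \<noteq> y j" "y (Suc r) = y j"
      using change_step[of i j "\<lambda>x. x \<noteq> y j" y] ijk \<open>y i \<noteq> y j\<close> by auto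
    have "leave (Suc K) (y r') (y (Suc r'))" using r' 1 coreS by (auto simp: leave_def)
    moreover have "leave (Suc K) (y r) (y (Suc r)) \<or> arrive K (y r) (y (Suc r))"
      using r 1 coreS by (auto simp: leave_def arrive_def)
    moreover have "r < r'" using r r' by simp
    ultimately show ?thesis using r(1) r'(2) by blast
  next
    case 2
    then have "y k \<noteq> Cemetery" using c by auto
    then obtain r where "j \<le> r" "r < k" "y r = Cemetery" "y (Suc r) \<noteq> Cemetery"
      using change_step[of j k "\<lambda>x. x = Cemetery" y] ijk 2 by auto
    then have "i \<le> r \<and> r < k \<and> revive (y r) (y (Suc r))" using ijk by (auto simp: revive_def)
    then show ?thesis by blast
  next
    case 3
    then have cj: "coarse K (y j) = Infty" by (cases "y j") (auto simp: core_def)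
    \<comment> \<open>\<open>Pt (Suc K)\<close> is merged with infinity, so a path that sits there
      has to leave it before the coarse value can change.\<close>
    have yk: "y k \<noteq> Pt (Suc K)" using c cj by auto
    show ?thesis
    proof (cases "y i = Cemetery")
      case True
      then obtain r where "i \<le> r" "r < j" "y r = Cemetery" "y (Suc r) \<noteq> Cemetery"
        using change_step[of i j "\<lambda>x. x = Cemetery" y] ijk 3 by auto
      then have "i \<le> r \<and> r < k \<and> revive (y r) (y (Suc r))" using ijk by (auto simp: revive_def)
      then show ?thesis by blast
    next
      case False
      then have "y i \<in> core K" using c cj by (cases "y i") (auto simp: core_def split: if_splits)
      then obtain r where r: "i \<le> r" "r < j" "y r \<in> core K" "y (Suc r) \<notin> core K"
        using change_step[of i j "\<lambda>x. x \<in> core K" y] ijk 3 by auto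
      then obtain m where m: "m \<le> K" "y r = Pt m" by (auto simp: core_def)
      show ?thesis
      proof (cases "y (Suc r) \<in> neighbours m")
        case False
        then have "skip K (y r) (y (Suc r))" using m by (auto simp: skip_def)
        then show ?thesis using r ijk by (meson less_trans)
      next
        case True
        \<comment> \<open>\<open>Pt (Suc K)\<close> is the only state outside the core that
          neighbours a core state.\<close>
        then have ys: "y (Suc r) = Pt (Suc K)"
          using r(4) m(1) by (auto simp: neighbours_def core_def image_iff split: if_splits)
        obtain r' where r': "Suc r \<le> r'" "r' < k" "y r' = Pt (Suc K)" "y (Suc r') \<noteq> Pt (Suc K)"
          using change_step[of "Suc r" k "\<lambda>x. x = Pt (Suc K)" y] ijk r ys yk by auto
        have "leave (Suc K) (y r') (y (Suc r'))" using r' by (auto simp: leave_def core_def)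
        moreover have "leave (Suc K) (y r) (y (Suc r))" using r coreS by (auto simp: leave_def)
        ultimately show ?thesis using r r' by (meson Suc_le_lessD)
      qed
    qed
  qed
qed

section \<open>The law of a chain on a time grid\<close>

locale chain_law = Q_trans +
  fixes l :: "state measure" and P :: "(real \<Rightarrow> state) measure"
  assumes l: "l \<in> prob_measures_N_cem" and law: "process_law p l P"
begin

sublocale P: prob_space P using law by (simp add: process_law_def)

sublocale l: prob_space l using l by (simp add: prob_measures_N_cem_def)

lemma sets_P: "sets P = sets path_space" and space_P: "space P = cadlag_paths"
  using law sets_eq_imp_space_eq[of P path_space] by (auto simp: process_law_def space_path_space)

lemma fdd:
  assumes "t 0 = 0" "\<And>k. k < m \<Longrightarrow> t k < t (Suc k)" "\<And>k. k \<le> m \<Longrightarrow> x k \<in> N_cem"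
  shows "measure P {w \<in> space P. \<forall>k\<le>m. w (t k) = x k} =
        measure l {x 0} * (\<Prod>k<m. ext_transition p (x k) (x (Suc k)) (t (Suc k) - t k))"
  using law assms unfolding process_law_def by blast

lemma samples_P: "\<eta> \<ge> 0 \<Longrightarrow> samples \<eta> R \<in> measurable P (count_space UNIV)"
  using samples_measurable[of \<eta> R] measurable_cong_sets[OF sets_P refl] by blast

lemma sets_samples: assumes "\<eta> \<ge> 0" shows "{w \<in> space P. Q (samples \<eta> R w)} \<in> sets P"
proof -
  have "samples \<eta> R -` {xs. Q xs} \<inter> space P \<in> sets P"
    by (rule measurable_sets[OF samples_P[OF assms]]) simp
  also have "samples \<eta> R -` {xs. Q xs} \<inter> space P = {w \<in> space P. Q (samples \<eta> R w)}" by auto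
  finally show ?thesis .
qed

lemma sets_l: "A \<subseteq> N_cem \<Longrightarrow> A \<in> sets l"
  using l by (auto simp: prob_measures_N_cem_def)

lemma space_l: "space l = N_cem"
  using l sets_eq_imp_space_eq[of l "count_space N_cem"] by (auto simp: prob_measures_N_cem_def)

lemma ext_nonneg: "t \<ge> 0 \<Longrightarrow> ext_transition p x y t \<ge> 0"
  by (cases x; cases y) (auto simp: nonneg row_le_1)

lemma nn_integral_state:
  "(\<integral>\<^sup>+y. f y \<partial>count_space UNIV) = (\<Sum>j. f (Pt j)) + (f Infty + f Cemetery)" for f :: "state \<Rightarrow> ennreal"
proof -
  have "(\<integral>\<^sup>+y. f y \<partial>count_space UNIV) = (\<integral>\<^sup>+y. f y * indicator (range Pt) y + f y * indicator {Infty, Cemetery} y \<partial>count_space UNIV)"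
  proof (rule nn_integral_cong)
    fix y show "f y = f y * indicator (range Pt) y + f y * indicator {Infty, Cemetery} y"
      by (cases y) (auto simp: indicator_def)
  qed
  also have "\<dots> = (\<integral>\<^sup>+y. f y * indicator (range Pt) y \<partial>count_space UNIV) + (\<integral>\<^sup>+y. f y * indicator {Infty, Cemetery} y \<partial>count_space UNIV)"
    by (rule nn_integral_add) auto
  also have "(\<integral>\<^sup>+y. f y * indicator (range Pt) y \<partial>count_space UNIV) = (\<integral>\<^sup>+y. f y \<partial>count_space (range Pt))"
    by (simp add: nn_integral_count_space_indicator)
  also have "\<dots> = (\<integral>\<^sup>+j. f (Pt j) \<partial>count_space UNIV)"
    by (rule nn_integral_bij_count_space[symmetric]) (auto simp: bij_betw_def inj_on_def)
  also have "\<dots> = (\<Sum>j. f (Pt j))" by (rule nn_integral_count_space_nat)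
  also have "(\<integral>\<^sup>+y. f y * indicator {Infty, Cemetery} y \<partial>count_space UNIV) = (\<integral>\<^sup>+y. f y \<partial>count_space {Infty, Cemetery})"
    by (simp add: nn_integral_count_space_indicator)
  also have "\<dots> = f Infty + f Cemetery"
    by (simp add: nn_integral_count_space_finite)
  finally show ?thesis .
qed

lemma ext_sum:
  assumes "t \<ge> 0" "x \<in> N_cem"
  shows "(\<integral>\<^sup>+y. ennreal (ext_transition p x y t) \<partial>count_space UNIV) = 1"
proof (cases x)
  case (Pt i)
  have "(\<Sum>j. ennreal (p i j t)) = ennreal (\<Sum>j. p i j t)"
    using nonneg[OF assms(1)] row_summable[OF assms(1)] by (simp add: suminf_ennreal2)
  moreover have "ennreal (\<Sum>j. p i j t) + ennreal (1 - (\<Sum>j. p i j t)) = ennreal ((\<Sum>j. p i j t) + (1 - (\<Sum>j. p i j t)))"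
    using row_le_1[OF assms(1), of i] suminf_nonneg[OF row_summable[OF assms(1)], of i] nonneg[OF assms(1)]
    by (intro ennreal_plus[symmetric]) auto
  ultimately show ?thesis using Pt by (simp add: nn_integral_state)
next
  case Infty then show ?thesis using assms(2) by (auto simp: N_cem_def)
next
  case Cemetery then show ?thesis by (simp add: nn_integral_state)
qed

lemma initial_sum: "(\<integral>\<^sup>+x. ennreal (measure l {x}) \<partial>count_space UNIV) = 1"
proof -
  have "(\<integral>\<^sup>+x. ennreal (measure l {x}) \<partial>count_space UNIV) = (\<integral>\<^sup>+x. ennreal (measure l {x}) * indicator N_cem x \<partial>count_space UNIV)"
  proof (rule nn_integral_cong)
    fix x
    have "measure l {x} = 0" if "x \<notin> N_cem"
      using that l by (intro measure_notin_sets) (auto simp: prob_measures_N_cem_def)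
    then show "ennreal (measure l {x}) = ennreal (measure l {x}) * indicator N_cem x"
      by (auto simp: indicator_def)
  qed
  also have "\<dots> = (\<integral>\<^sup>+x. ennreal (measure l {x}) \<partial>count_space N_cem)"
    by (simp add: nn_integral_count_space_indicator N_cem_def)
  also have "\<dots> = (\<integral>\<^sup>+x. emeasure l {x} \<partial>count_space N_cem)" by (simp add: l.emeasure_eq_measure)
  also have "\<dots> = emeasure l N_cem"
    by (rule emeasure_countable_singleton[symmetric]) (auto intro!: sets_l)
  also have "\<dots> = 1" using l.emeasure_space_1 by (simp add: space_l)
  finally show ?thesis .
qed

lemma sets_coord: "t \<ge> 0 \<Longrightarrow> {w \<in> space P. w t = x} \<in> sets P"
  using sets_coordinate[of t x] sets_P space_P space_path_space by simp

text \<open>The prescribed probabilities concern states of \<open>N_cem\<close> only, but they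
  already add up to 1, so nothing is left for \<open>Infty\<close>.\<close>

lemma coord_N_cem:
  assumes "t \<ge> 0" shows "AE w in P. w t \<in> N_cem"
proof -
  have "1 \<le> emeasure P {w \<in> space P. w t \<in> N_cem}"
  proof (cases "t = 0")
    \<comment> \<open>The formula with two times requires \<open>0 < t\<close>; at time 0 the
      initial law takes its place.\<close>
    case True
    let ?W = "\<lambda>x. {w \<in> space P. w 0 = x \<and> x \<in> N_cem}"
    have S: "?W x \<in> sets P" for x
      using sets_coord[of 0 x] by (cases "x \<in> N_cem") auto
    have "ennreal (measure l {x}) = emeasure P (?W x)" for x
    proof (cases "x \<in> N_cem")
      case True
      then show ?thesis using fdd[of "\<lambda>_. 0" 0 "\<lambda>_. x"] by (simp add: P.emeasure_eq_measure)
    next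
      case False
      then have "measure l {x} = 0" using l by (intro measure_notin_sets) (auto simp: prob_measures_N_cem_def)
      then show ?thesis using False by simp
    qed
    then have "1 = (\<integral>\<^sup>+x. emeasure P (?W x) \<partial>count_space UNIV)" using initial_sum by simp
    also have "\<dots> = emeasure P (\<Union>x. ?W x)"
      by (rule emeasure_UN_countable[symmetric]) (use S in \<open>auto simp: disjoint_family_on_def\<close>)
    also have "\<dots> \<le> emeasure P {w \<in> space P. w t \<in> N_cem}"
      using sets_samples[of t "\<lambda>xs. xs ! 1 \<in> N_cem" 1] assms True by (intro emeasure_mono) (auto simp: nth_samples)
    finally show ?thesis .
  next
    case False
    then have t: "t > 0" using assms by simp
    let ?W = "\<lambda>z. {w \<in> space P. w 0 = fst z \<and> w t = snd z \<and> fst z \<in> N_cem \<and> snd z \<in> N_cem}"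
    have S: "?W z \<in> sets P" for z
    proof -
      have "{w \<in> space P. samples t 1 w ! 0 = fst z \<and> samples t 1 w ! 1 = snd z \<and> fst z \<in> N_cem \<and> snd z \<in> N_cem} \<in> sets P"
        using assms by (rule sets_samples)
      then show ?thesis by (simp add: nth_samples)
    qed
    have W: "ennreal (measure l {x} * ext_transition p x y t) = emeasure P (?W (x, y))" for x y
    proof (cases "x \<in> N_cem \<and> y \<in> N_cem")
      case True
      let ?t = "\<lambda>k::nat. if k = 0 then 0 else t" and ?x = "\<lambda>k::nat. if k = 0 then x else y"
      have "measure P {w \<in> space P. \<forall>k\<le>1. w (?t k) = ?x k} =
        measure l {?x 0} * (\<Prod>k<1. ext_transition p (?x k) (?x (Suc k)) (?t (Suc k) - ?t k))"
        by (rule fdd) (use t True in auto)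
      moreover have "{w \<in> space P. \<forall>k\<le>1. w (?t k) = ?x k} = ?W (x, y)"
        using True by (auto simp: le_Suc_eq)
      ultimately show ?thesis by (simp add: P.emeasure_eq_measure)
    next
      case False
      have "measure l {x} = 0" if "x \<notin> N_cem"
        using that l by (intro measure_notin_sets) (auto simp: prob_measures_N_cem_def)
      moreover have "ext_transition p x y t = 0" if "y \<notin> N_cem"
        using that by (cases x; cases y) (auto simp: N_cem_def)
      ultimately have "measure l {x} * ext_transition p x y t = 0" using False by auto
      then show ?thesis using False by auto
    qed
    have "1 = (\<integral>\<^sup>+x. ennreal (measure l {x}) * (\<integral>\<^sup>+y. ennreal (ext_transition p x y t) \<partial>count_space UNIV) \<partial>count_space UNIV)"
    proof -
      have "ennreal (measure l {x}) * (\<integral>\<^sup>+y. ennreal (ext_transition p x y t) \<partial>count_space UNIV) = ennreal (measure l {x})" for x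
      proof (cases "x \<in> N_cem")
        case False
        then have "measure l {x} = 0" using l by (intro measure_notin_sets) (auto simp: prob_measures_N_cem_def)
        then show ?thesis by simp
      qed (simp add: ext_sum[OF assms])
      then show ?thesis using initial_sum by simp
    qed
    also have "\<dots> = (\<integral>\<^sup>+x. \<integral>\<^sup>+y. emeasure P (?W (x, y)) \<partial>count_space UNIV \<partial>count_space UNIV)"
      unfolding W[symmetric] using ext_nonneg[OF assms]
      by (intro nn_integral_cong) (simp add: ennreal_mult nn_integral_cmult)
    also have "\<dots> = (\<integral>\<^sup>+z. emeasure P (?W z) \<partial>count_space UNIV)"
      by (rule nn_integral_fst_count_space)
    also have "\<dots> = emeasure P (\<Union>z. ?W z)"
      by (rule emeasure_UN_countable[symmetric]) (use S in \<open>auto simp: disjoint_family_on_def\<close>)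
    also have "\<dots> \<le> emeasure P {w \<in> space P. w t \<in> N_cem}"
      using sets_samples[of t "\<lambda>xs. xs ! 1 \<in> N_cem" 1] assms by (intro emeasure_mono) (auto simp: nth_samples)
    finally show ?thesis .
  qed
  then have fin: "emeasure P {w \<in> space P. w t \<in> N_cem} = 1"
    by (intro antisym) (simp_all add: P.emeasure_le_1)
  have S: "{w \<in> space P. w t \<in> N_cem} \<in> sets P"
    using sets_samples[of t "\<lambda>xs. xs ! 1 \<in> N_cem" 1] assms by (simp add: nth_samples)
  show ?thesis using P.prob_Collect_eq_1[OF S] fin by (simp add: P.emeasure_eq_measure)
qed

lemma samples_N_cem:
  assumes "\<eta> \<ge> 0" shows "AE w in P. set (samples \<eta> R w) \<subseteq> N_cem"
proof -
  have "AE w in P. \<forall>k\<in>{..R}. w (real k * \<eta>) \<in> N_cem"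
    using assms by (intro AE_finite_allI coord_N_cem) auto
  then show ?thesis by eventually_elim (auto simp: samples_def less_Suc_eq_le simp del: upt_Suc)
qed

lemma prob_samples:
  assumes "\<eta> > 0" "length xs = Suc R" "set xs \<subseteq> N_cem"
  shows "P.prob {w \<in> space P. samples \<eta> R w = xs} = measure l {xs ! 0} * (\<Prod>k<R. ext_transition p (xs ! k) (xs ! Suc k) \<eta>)"
proof -
  have "samples \<eta> R w = xs \<longleftrightarrow> (\<forall>k\<le>R. w (real k * \<eta>) = xs ! k)" for w
    using assms by (auto simp: list_eq_iff_nth_eq length_samples nth_samples less_Suc_eq_le)
  then have "P.prob {w \<in> space P. samples \<eta> R w = xs} = P.prob {w \<in> space P. \<forall>k\<le>R. w (real k * \<eta>) = xs ! k}" by simp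
  also have "\<dots> = measure l {xs ! 0} * (\<Prod>k<R. ext_transition p (xs ! k) (xs ! Suc k) (real (Suc k) * \<eta> - real k * \<eta>))"
  proof (rule fdd)
    show "xs ! k \<in> N_cem" if "k \<le> R" for k using assms that nth_mem[of k xs] by auto
  qed (use assms in auto)
  finally show ?thesis by (simp add: algebra_simps)
qed

lemma samples_Suc: "samples \<eta> (Suc R) w = samples \<eta> R w @ [w (real (Suc R) * \<eta>)]"
  by (simp add: samples_def)

text \<open>The Markov property on the grid, read off from the product formula.\<close>

lemma prob_samples_Suc:
  assumes "\<eta> > 0" "length xs = Suc R" "set xs \<subseteq> N_cem" "y \<in> N_cem"
  shows "P.prob {w \<in> space P. samples \<eta> R w = xs \<and> w (real (Suc R) * \<eta>) = y} =
    P.prob {w \<in> space P. samples \<eta> R w = xs} * ext_transition p (xs ! R) y \<eta>"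
proof -
  have "P.prob {w \<in> space P. samples \<eta> R w = xs \<and> w (real (Suc R) * \<eta>) = y} =
     P.prob {w \<in> space P. samples \<eta> (Suc R) w = xs @ [y]}" by (simp add: samples_Suc)
  also have "\<dots> = measure l {(xs @ [y]) ! 0} * (\<Prod>k<Suc R. ext_transition p ((xs @ [y]) ! k) ((xs @ [y]) ! Suc k) \<eta>)"
    by (rule prob_samples) (use assms in auto)
  also have "\<dots> = (measure l {xs ! 0} * (\<Prod>k<R. ext_transition p (xs ! k) (xs ! Suc k) \<eta>)) * ext_transition p (xs ! R) y \<eta>"
    using assms by (simp add: nth_append)
  finally show ?thesis unfolding prob_samples[OF assms(1-3)] .
qed

lemma sets_coord_pred: 
  assumes "\<eta> \<ge> 0" shows "{w \<in> space P. Q (samples \<eta> R w) (w (real (Suc R) * \<eta>))} \<in> sets P"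
  using sets_samples[OF assms, of "\<lambda>xs. Q (take (Suc R) xs) (xs ! Suc R)" "Suc R"]
  by (simp add: samples_Suc length_samples nth_append)

text \<open>Given the samples up to \<open>R\<close>, the next one misses \<open>B x\<close> with
  probability at most \<open>\<kappa>\<close>, whatever the past. Since \<open>B x\<close> is
  finite, hitting it has a finite sum of transition probabilities; since lists of samples are
  countable, the bound can be summed over all pasts that satisfy \<open>Q\<close>.\<close>

lemma escape_bound:
  assumes \<eta>: "\<eta> > 0" and \<kappa>: "\<kappa> \<ge> 0"
    and B: "\<And>x. x \<in> D \<Longrightarrow> finite (B x)" "\<And>x. x \<in> D \<Longrightarrow> B x \<subseteq> N_cem"
    and bound: "\<And>x. x \<in> D \<Longrightarrow> 1 - (\<Sum>y\<in>B x. ext_transition p x y \<eta>) \<le> \<kappa>"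
  shows "P.prob {w \<in> space P. Q (samples \<eta> R w) \<and> w (real R * \<eta>) \<in> D \<and> w (real (Suc R) * \<eta>) \<notin> B (w (real R * \<eta>))}
     \<le> \<kappa> * P.prob {w \<in> space P. Q (samples \<eta> R w)}"
proof -
  let ?E = "\<lambda>xs. {w \<in> space P. samples \<eta> R w = xs \<and> w (real R * \<eta>) \<in> D \<and> w (real (Suc R) * \<eta>) \<notin> B (w (real R * \<eta>))}"
  let ?F = "\<lambda>xs. {w \<in> space P. samples \<eta> R w = xs}"
  have last: "w (real R * \<eta>) = samples \<eta> R w ! R" for w by (simp add: nth_samples)
  have sE: "?E xs \<in> sets P" for xs unfolding last using \<eta> by (intro sets_coord_pred) simp
  have sF: "?F xs \<in> sets P" for xs using \<eta> by (intro sets_samples) simp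
  have single: "P.prob (?E xs) \<le> \<kappa> * P.prob (?F xs)" for xs
  proof (cases "length xs = Suc R \<and> set xs \<subseteq> N_cem \<and> xs ! R \<in> D")
    case True
    let ?G = "\<lambda>y. {w \<in> space P. samples \<eta> R w = xs \<and> w (real (Suc R) * \<eta>) = y}"
    have sG: "?G y \<in> sets P" for y using \<eta> by (intro sets_coord_pred) simp
    have "P.prob (\<Union>y\<in>B (xs ! R). ?G y) = (\<Sum>y\<in>B (xs ! R). P.prob (?G y))"
      using B True sG by (intro P.finite_measure_finite_Union) (auto simp: disjoint_family_on_def)
    also have "\<dots> = (\<Sum>y\<in>B (xs ! R). P.prob (?F xs) * ext_transition p (xs ! R) y \<eta>)"
      using True \<eta> B by (intro sum.cong prob_samples_Suc refl) auto
    finally have 1: "P.prob (\<Union>y\<in>B (xs ! R). ?G y) = P.prob (?F xs) * (\<Sum>y\<in>B (xs ! R). ext_transition p (xs ! R) y \<eta>)"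
      by (simp add: sum_distrib_left)
    have "?E xs = ?F xs - (\<Union>y\<in>B (xs ! R). ?G y)" using True by (auto simp: last)
    then have "P.prob (?E xs) = P.prob (?F xs) - P.prob (\<Union>y\<in>B (xs ! R). ?G y)"
      using B True sG sF by (auto intro!: P.finite_measure_Diff)
    also have "\<dots> = P.prob (?F xs) * (1 - (\<Sum>y\<in>B (xs ! R). ext_transition p (xs ! R) y \<eta>))"
      unfolding 1 by (simp add: algebra_simps)
    also have "\<dots> \<le> P.prob (?F xs) * \<kappa>" using bound True by (intro mult_left_mono) auto
    finally show ?thesis by (simp add: mult.commute)
  next
    case False
    \<comment> \<open>Lists through \<open>Infty\<close> have probability 0; for a wrong length or a
      last state outside \<open>D\<close> the event is empty.\<close>
    show ?thesis
    proof (cases "xs ! R \<in> D \<and> length xs = Suc R")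
      case True
      with False have n: "\<not> set xs \<subseteq> N_cem" by simp
      have "AE w in P. w \<notin> ?E xs" using samples_N_cem[of \<eta> R] \<eta> n by (auto elim!: eventually_mono)
      then have "P.prob (?E xs) = 0" using sE by (simp add: P.prob_eq_0)
      then show ?thesis using \<kappa> by simp
    next
      case False
      then have e: "?E xs = {}" by (auto simp: last length_samples)
      show ?thesis unfolding e using \<kappa> by simp
    qed
  qed
  have "emeasure P (\<Union>xs\<in>{xs. Q xs}. ?E xs) = (\<integral>\<^sup>+xs. emeasure P (?E xs) \<partial>count_space {xs. Q xs})"
    by (rule emeasure_UN_countable) (use sE in \<open>auto simp: disjoint_family_on_def\<close>)
  also have "\<dots> \<le> (\<integral>\<^sup>+xs. ennreal \<kappa> * emeasure P (?F xs) \<partial>count_space {xs. Q xs})"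
    using single \<kappa> by (intro nn_integral_mono) (simp add: P.emeasure_eq_measure ennreal_mult[symmetric] ennreal_leI)
  also have "\<dots> = ennreal \<kappa> * (\<integral>\<^sup>+xs. emeasure P (?F xs) \<partial>count_space {xs. Q xs})"
    by (rule nn_integral_cmult) simp
  also have "(\<integral>\<^sup>+xs. emeasure P (?F xs) \<partial>count_space {xs. Q xs}) = emeasure P (\<Union>xs\<in>{xs. Q xs}. ?F xs)"
    by (rule emeasure_UN_countable[symmetric]) (use sF in \<open>auto simp: disjoint_family_on_def\<close>)
  finally have "ennreal (P.prob (\<Union>xs\<in>{xs. Q xs}. ?E xs)) \<le> ennreal (\<kappa> * P.prob (\<Union>xs\<in>{xs. Q xs}. ?F xs))"
    using \<kappa> by (simp add: P.emeasure_eq_measure ennreal_mult)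
  then have "P.prob (\<Union>xs\<in>{xs. Q xs}. ?E xs) \<le> \<kappa> * P.prob (\<Union>xs\<in>{xs. Q xs}. ?F xs)"
    using \<kappa> by (subst (asm) ennreal_le_iff) auto
  moreover have "(\<Union>xs\<in>{xs. Q xs}. ?E xs) = {w \<in> space P. Q (samples \<eta> R w) \<and> w (real R * \<eta>) \<in> D \<and> w (real (Suc R) * \<eta>) \<notin> B (w (real R * \<eta>))}"
    by auto
  moreover have "(\<Union>xs\<in>{xs. Q xs}. ?F xs) = {w \<in> space P. Q (samples \<eta> R w)}" by auto
  ultimately show ?thesis by simp
qed

text \<open>A bound for all rates up to \<open>Suc K\<close> that depends only on \<open>a\<close>,
  \<open>b\<close> and \<open>K\<close>, hence the same constant for all processes under
  comparison.\<close>

definition rate :: "nat \<Rightarrow> real" where "rate K = (\<Sum>i\<le>Suc K. a i + b i)"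

lemma rate_nonneg: "rate K \<ge> 0"
  unfolding rate_def by (intro sum_nonneg add_nonneg_nonneg a_nonneg less_imp_le[OF b_pos])

lemma rate_le: "i \<le> Suc K \<Longrightarrow> a i + b i \<le> rate K"
  unfolding rate_def by (intro member_le_sum add_nonneg_nonneg a_nonneg less_imp_le[OF b_pos]) auto

lemma leave_bound_prob:
  assumes \<eta>: "\<eta> > 0"
  shows "P.prob {w \<in> space P. Q (samples \<eta> R w) \<and> leave (Suc K) (w (real R * \<eta>)) (w (real (Suc R) * \<eta>))}
    \<le> (rate K * \<eta>) * P.prob {w \<in> space P. Q (samples \<eta> R w)}"
proof -
  have "P.prob {w \<in> space P. Q (samples \<eta> R w) \<and> w (real R * \<eta>) \<in> core (Suc K) \<and> w (real (Suc R) * \<eta>) \<notin> {w (real R * \<eta>)}}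
    \<le> (rate K * \<eta>) * P.prob {w \<in> space P. Q (samples \<eta> R w)}"
  proof (rule escape_bound[OF \<eta>])
    show "0 \<le> rate K * \<eta>" using rate_nonneg \<eta> by simp
    fix x assume "x \<in> core (Suc K)"
    then obtain i where i: "i \<le> Suc K" "x = Pt i" by (auto simp: core_def)
    show "finite {x}" "{x} \<subseteq> N_cem" using i by (auto simp: N_cem_def)
    have "1 - p i i \<eta> \<le> (a i + b i) * \<eta>" using leave_bound[of \<eta> i] \<eta> by simp
    also have "\<dots> \<le> rate K * \<eta>" using rate_le[OF i(1)] \<eta> by (intro mult_right_mono) auto
    finally show "1 - (\<Sum>y\<in>{x}. ext_transition p x y \<eta>) \<le> rate K * \<eta>" using i by simp
  qed
  then show ?thesis by (simp add: leave_def)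
qed

definition skip_total :: "nat \<Rightarrow> real \<Rightarrow> real" where "skip_total K t = (\<Sum>i\<le>K. skip_prob i t)"

lemma skip_total_nonneg: "t \<ge> 0 \<Longrightarrow> skip_total K t \<ge> 0"
  unfolding skip_total_def by (intro sum_nonneg skip_prob_nonneg)

lemma skip_total_small: "((\<lambda>t. skip_total K t / t) \<longlongrightarrow> 0) (at_right 0)"
proof -
  have "((\<lambda>t. \<Sum>i\<le>K. skip_prob i t / t) \<longlongrightarrow> (\<Sum>i\<le>K. 0)) (at_right 0)"
    by (intro tendsto_sum skip_prob_small)
  then show ?thesis by (simp add: skip_total_def sum_divide_distrib)
qed

lemma skip_bound_prob:
  assumes \<eta>: "\<eta> > 0"
  shows "P.prob {w \<in> space P. skip K (w (real R * \<eta>)) (w (real (Suc R) * \<eta>))} \<le> skip_total K \<eta>"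
proof -
  \<comment> \<open>\<open>escape_bound\<close> takes a set depending on the state;
    \<open>THE\<close> recovers the index from it.\<close>
  let ?B = "\<lambda>x. neighbours (THE i. x = Pt i)"
  have "P.prob {w \<in> space P. True \<and> w (real R * \<eta>) \<in> core K \<and> w (real (Suc R) * \<eta>) \<notin> ?B (w (real R * \<eta>))}
    \<le> skip_total K \<eta> * P.prob {w \<in> space P. True}"
  proof (rule escape_bound[OF \<eta>])
    show "0 \<le> skip_total K \<eta>" using skip_total_nonneg \<eta> by simp
    fix x assume "x \<in> core K"
    then obtain i where i: "i \<le> K" "x = Pt i" by (auto simp: core_def)
    show "finite (?B x)" "?B x \<subseteq> N_cem" by (auto simp: N_cem_def neighbours_def)
    have "(\<Sum>y\<in>?B x. ext_transition p x y \<eta>) = p i i \<eta> + p i (Suc i) \<eta> + (if i = 0 then 0 else p i (i - 1) \<eta>)"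
      using i by (cases i) (auto simp: neighbours_def)
    then have "1 - (\<Sum>y\<in>?B x. ext_transition p x y \<eta>) = skip_prob i \<eta>" by (simp add: skip_prob_def)
    also have "\<dots> \<le> skip_total K \<eta>"
      unfolding skip_total_def using i \<eta> by (intro member_le_sum skip_prob_nonneg) auto
    finally show "1 - (\<Sum>y\<in>?B x. ext_transition p x y \<eta>) \<le> skip_total K \<eta>" .
  qed
  also have "{w \<in> space P. True \<and> w (real R * \<eta>) \<in> core K \<and> w (real (Suc R) * \<eta>) \<notin> ?B (w (real R * \<eta>))} =
     {w \<in> space P. skip K (w (real R * \<eta>)) (w (real (Suc R) * \<eta>))}"
    by (auto simp: skip_def core_def)
  finally show ?thesis by (simp add: P.prob_space)
qed

text \<open>The cemetery is absorbing, so \<open>escape_bound\<close> applies with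
  \<open>\<kappa> = 0\<close>.\<close>

lemma revive_prob:
  assumes \<eta>: "\<eta> > 0"
  shows "P.prob {w \<in> space P. revive (w (real R * \<eta>)) (w (real (Suc R) * \<eta>))} = 0"
proof -
  have "P.prob {w \<in> space P. True \<and> w (real R * \<eta>) \<in> {Cemetery} \<and> w (real (Suc R) * \<eta>) \<notin> {w (real R * \<eta>)}}
    \<le> 0 * P.prob {w \<in> space P. True}"
    by (rule escape_bound[OF \<eta>]) (auto simp: N_cem_def)
  also have "{w \<in> space P. True \<and> w (real R * \<eta>) \<in> {Cemetery} \<and> w (real (Suc R) * \<eta>) \<notin> {w (real R * \<eta>)}} =
     {w \<in> space P. revive (w (real R * \<eta>)) (w (real (Suc R) * \<eta>))}"
    by (auto simp: revive_def)
  finally show ?thesis using measure_nonneg[of P] by (simp add: antisym)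
qed

lemma sets_pair: "\<eta> \<ge> 0 \<Longrightarrow> {w \<in> space P. Q (w (real r * \<eta>)) (w (real r' * \<eta>))} \<in> sets P"
  using sets_samples[of \<eta> "\<lambda>xs. Q (xs ! r) (xs ! r')" "max r r'"] by (simp add: nth_samples)

text \<open>An arrival raises the indicator of the core by 1 and a departure lowers it by 1. The
  probabilities of being in the core telescope, so departures, each of probability at most
  \<open>rate K * \<eta>\<close>, control the arrivals.\<close>

lemma arrivals_bound:
  assumes \<eta>: "\<eta> > 0"
  shows "(\<Sum>r<R. P.prob {w \<in> space P. arrive K (w (real r * \<eta>)) (w (real (Suc r) * \<eta>))}) \<le> 1 + real R * (rate K * \<eta>)"
proof -
  let ?C = "\<lambda>r. P.prob {w \<in> space P. w (real r * \<eta>) \<in> core K}"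
  have step: "P.prob {w \<in> space P. arrive K (w (real r * \<eta>)) (w (real (Suc r) * \<eta>))} \<le> ?C (Suc r) - ?C r + rate K * \<eta>" for r
  proof -
    let ?both = "{w \<in> space P. w (real r * \<eta>) \<in> core K \<and> w (real (Suc r) * \<eta>) \<in> core K}"
    let ?arr = "{w \<in> space P. arrive K (w (real r * \<eta>)) (w (real (Suc r) * \<eta>))}"
    let ?dep = "{w \<in> space P. w (real r * \<eta>) \<in> core K \<and> w (real (Suc r) * \<eta>) \<notin> core K}"
    have S: "?both \<in> sets P" "?arr \<in> sets P" "?dep \<in> sets P"
      using \<eta> by (intro sets_pair; simp)+
    have "{w \<in> space P. w (real (Suc r) * \<eta>) \<in> core K} = ?both \<union> ?arr" by (auto simp: arrive_def)
    then have 1: "?C (Suc r) = P.prob ?both + P.prob ?arr"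
      using S by (simp add: P.finite_measure_Union[symmetric] arrive_def disjoint_iff)
    have "{w \<in> space P. w (real r * \<eta>) \<in> core K} = ?both \<union> ?dep" by auto
    then have 2: "?C r = P.prob ?both + P.prob ?dep"
      using S by (simp add: P.finite_measure_Union[symmetric] disjoint_iff)
    have "P.prob ?dep \<le> P.prob {w \<in> space P. True \<and> leave (Suc K) (w (real r * \<eta>)) (w (real (Suc r) * \<eta>))}"
      using sets_pair[of \<eta> "\<lambda>x y. True \<and> leave (Suc K) x y" r "Suc r"] \<eta>
      by (intro P.finite_measure_mono) (auto simp: leave_def core_def)
    also have "\<dots> \<le> rate K * \<eta>"
      using leave_bound_prob[OF \<eta>, of "\<lambda>_. True" r K] by (simp add: P.prob_space)
    finally show ?thesis using 1 2 by linarith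
  qed
  have "(\<Sum>r<R. P.prob {w \<in> space P. arrive K (w (real r * \<eta>)) (w (real (Suc r) * \<eta>))}) \<le> (\<Sum>r<R. ?C (Suc r) - ?C r + rate K * \<eta>)"
    by (rule sum_mono) (rule step)
  also have "\<dots> = ?C R - ?C 0 + real R * (rate K * \<eta>)"
    by (simp only: sum.distrib sum_lessThan_telescope[of ?C]) simp
  also have "\<dots> \<le> 1 + real R * (rate K * \<eta>)"
    using P.prob_le_1[of "{w \<in> space P. w (real R * \<eta>) \<in> core K}"] measure_nonneg[of P "{w \<in> space P. w (real 0 * \<eta>) \<in> core K}"] by linarith
  finally show ?thesis .
qed

lemma two_jumps_grid_sets:
  assumes "h > 0" shows "{w \<in> space P. two_jumps_grid K h N L w} \<in> sets P"
proof -
  let ?Q = "\<lambda>xs. \<exists>l<N. \<exists>i j k. l * L \<le> i \<and> i < j \<and> j < k \<and> k \<le> Suc l * L \<and>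
     coarse K (xs ! i) \<noteq> coarse K (xs ! j) \<and> coarse K (xs ! j) \<noteq> coarse K (xs ! k)"
  have eq: "two_jumps_grid K h N L w \<longleftrightarrow> ?Q (samples (h / real L) (N * L) w)" for w
  proof -
    have nth: "samples (h / real L) (N * L) w ! k = w (real k * (h / real L))" if "k \<le> N * L" for k
      using that by (rule nth_samples)
    have le: "k \<le> N * L" if "l < N" "k \<le> Suc l * L" for k l
      using that mult_le_mono1[of "Suc l" N L] by linarith
    show ?thesis
    proof
      assume "two_jumps_grid K h N L w"
      then obtain l i j k where *: "l < N" "l * L \<le> i" "i < j" "j < k" "k \<le> Suc l * L"
        "coarse K (w (real i * (h / real L))) \<noteq> coarse K (w (real j * (h / real L)))"
        "coarse K (w (real j * (h / real L))) \<noteq> coarse K (w (real k * (h / real L)))"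
        unfolding two_jumps_grid_def by blast
      have "i \<le> N * L" "j \<le> N * L" "k \<le> N * L" using le[OF *(1,5)] *(3,4) by linarith+
      then show "?Q (samples (h / real L) (N * L) w)"
        using * by (intro exI[of _ l] exI[of _ i] exI[of _ j] exI[of _ k] conjI) (simp_all only: nth not_False_eq_True)
    next
      assume "?Q (samples (h / real L) (N * L) w)"
      then obtain l i j k where *: "l < N" "l * L \<le> i" "i < j" "j < k" "k \<le> Suc l * L"
        "coarse K (samples (h / real L) (N * L) w ! i) \<noteq> coarse K (samples (h / real L) (N * L) w ! j)"
        "coarse K (samples (h / real L) (N * L) w ! j) \<noteq> coarse K (samples (h / real L) (N * L) w ! k)"
        by blast
      have b: "i \<le> N * L" "j \<le> N * L" "k \<le> N * L" using le[OF *(1,5)] *(3,4) by linarith+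
      note w' = *(2-7)[unfolded nth[OF b(1)] nth[OF b(2)] nth[OF b(3)]]
      show "two_jumps_grid K h N L w"
        unfolding two_jumps_grid_def
      proof (rule exI[of _ l], rule conjI[OF *(1)], rule exI[of _ i], rule exI[of _ j], rule exI[of _ k], intro conjI)
      qed (fact w')+
    qed
  qed
  show ?thesis unfolding eq by (rule sets_samples[where Q = ?Q]) (use assms in simp)
qed

text \<open>A union bound over pairs of grid steps in one cell. Two departures: at most
  \<open>N * L * L\<close> pairs, each of probability at most \<open>(rate K * h / L)^2\<close>. An
  arrival and a later departure: at most \<open>L\<close> later steps, each with conditional
  probability at most \<open>rate K * h / L\<close>, for an expected number of at most
  \<open>1 + N * rate K * h\<close> arrivals. Only the skip term still depends on
  \<open>L\<close>.\<close>

lemma two_jumps_grid_prob: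
  assumes h: "h > 0" and L: "L > 0"
  shows "P.prob {w \<in> space P. two_jumps_grid K h N L w} \<le>
    real N * (rate K * h)\<^sup>2 + rate K * h * (1 + real N * (rate K * h)) + real N * (real L * skip_total K (h / real L))"
proof -
  define \<eta> where "\<eta> = h / real L"
  define R where "R = N * L"
  define \<theta> where "\<theta> = rate K * \<eta>"
  have \<eta>: "\<eta> > 0" using h L by (simp add: \<eta>_def)
  have \<theta>: "\<theta> \<ge> 0" using rate_nonneg \<eta> by (simp add: \<theta>_def)
  have L\<theta>: "real L * \<theta> = rate K * h" using L by (simp add: \<theta>_def \<eta>_def)
  let ?y = "\<lambda>w r. w (real r * \<eta>) :: state"
  define A1 where "A1 r = {w \<in> space P. skip K (?y w r) (?y w (Suc r))}" for r
  define A2 where "A2 r = {w \<in> space P. revive (?y w r) (?y w (Suc r))}" for r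
  define B where "B r r' = {w \<in> space P. leave (Suc K) (?y w r) (?y w (Suc r)) \<and> leave (Suc K) (?y w r') (?y w (Suc r'))}" for r r'
  define C where "C r r' = {w \<in> space P. arrive K (?y w r) (?y w (Suc r)) \<and> leave (Suc K) (?y w r') (?y w (Suc r'))}" for r r'
  \<comment> \<open>The steps after \<open>r\<close> within the cell of \<open>r\<close>.\<close>
  define I where "I r = {r<..<Suc (r div L) * L}" for r
  have four: "{w \<in> space P. Q (?y w r) (?y w (Suc r)) (?y w r') (?y w (Suc r'))} \<in> sets P" for Q r r'
    using sets_samples[of \<eta> "\<lambda>xs. Q (xs ! r) (xs ! Suc r) (xs ! r') (xs ! Suc r')" "max (Suc r) (Suc r')"] \<eta>
    by (simp add: nth_samples del: of_nat_Suc)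
  have sA1: "A1 r \<in> sets P" and sA2: "A2 r \<in> sets P" for r
    unfolding A1_def A2_def using \<eta> by (intro sets_pair; simp)+
  have sB: "B r r' \<in> sets P" and sC: "C r r' \<in> sets P" for r r'
    unfolding B_def C_def by (rule four)+
  have I: "finite (I r)" "card (I r) \<le> L" for r
  proof -
    have "r div L * L \<le> r" by simp
    moreover have "card (I r) = L + r div L * L - Suc r" by (simp add: I_def)
    ultimately show "card (I r) \<le> L" by linarith
    show "finite (I r)" by (simp add: I_def)
  qed
  have incl: "{w \<in> space P. two_jumps_grid K h N L w} \<subseteq>
     (\<Union>r<R. A1 r \<union> A2 r) \<union> (\<Union>r<R. \<Union>r'\<in>I r. B r r' \<union> C r r')"
  proof
    fix w assume "w \<in> {w \<in> space P. two_jumps_grid K h N L w}"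
    then obtain l i j k where w: "w \<in> space P" and *: "l < N" "l * L \<le> i" "i < j" "j < k" "k \<le> Suc l * L"
      "coarse K (?y w i) \<noteq> coarse K (?y w j)" "coarse K (?y w j) \<noteq> coarse K (?y w k)"
      unfolding two_jumps_grid_def \<eta>_def by blast
    have kR: "k \<le> R" unfolding R_def using *(1,5) mult_le_mono1[of "Suc l" N L] by linarith
    have cell: "r div L = l" if "i \<le> r" "r < k" for r
    proof (rule div_nat_eqI)
      show "L * l \<le> r" using that *(2) by (simp add: mult.commute)
      show "r < L * Suc l" using that *(5) by (simp add: mult.commute del: mult_Suc mult_Suc_right)
    qed
    from two_changes_events[OF *(3,4,6,7)]
    show "w \<in> (\<Union>r<R. A1 r \<union> A2 r) \<union> (\<Union>r<R. \<Union>r'\<in>I r. B r r' \<union> C r r')"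
    proof (elim disjE exE conjE)
      fix r assume r: "i \<le> r" "r < k" and "skip K (?y w r) (?y w (Suc r))"
      then have "w \<in> A1 r" using w by (simp add: A1_def)
      then show ?thesis using r kR by auto
    next
      fix r assume r: "i \<le> r" "r < k" and "revive (?y w r) (?y w (Suc r))"
      then have "w \<in> A2 r" using w by (simp add: A2_def)
      then show ?thesis using r kR by auto
    next
      fix r r' assume r: "i \<le> r" "r < r'" "r' < k" and "leave (Suc K) (?y w r') (?y w (Suc r'))" "leave (Suc K) (?y w r) (?y w (Suc r))"
      then have "w \<in> B r r'" using w by (simp add: B_def)
      moreover have "r' \<in> I r" using r *(5) cell[of r] by (simp add: I_def del: mult_Suc)
      ultimately show ?thesis using r kR by auto
    next
      fix r r' assume r: "i \<le> r" "r < r'" "r' < k" and "leave (Suc K) (?y w r') (?y w (Suc r'))" "arrive K (?y w r) (?y w (Suc r))"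
      then have "w \<in> C r r'" using w by (simp add: C_def)
      moreover have "r' \<in> I r" using r *(5) cell[of r] by (simp add: I_def del: mult_Suc)
      ultimately show ?thesis using r kR by auto
    qed
  qed
  let ?arr = "\<lambda>r. P.prob {w \<in> space P. arrive K (?y w r) (?y w (Suc r))}"
  have lv: "P.prob {w \<in> space P. leave (Suc K) (?y w r) (?y w (Suc r))} \<le> \<theta>" for r
    using leave_bound_prob[OF \<eta>, of "\<lambda>_. True" r K] by (simp add: P.prob_space \<theta>_def)
  \<comment> \<open>What happens in step \<open>r\<close> is determined by the samples up to
    \<open>r'\<close>, so the departure at \<open>r'\<close> costs another factor
    \<open>\<theta>\<close>.\<close>
  have PB: "P.prob (B r r') \<le> \<theta> * \<theta>" if "r < r'" for r r'
  proof -
    have "P.prob (B r r') \<le> \<theta> * P.prob {w \<in> space P. leave (Suc K) (?y w r) (?y w (Suc r))}"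
      using leave_bound_prob[OF \<eta>, of "\<lambda>xs. leave (Suc K) (xs ! r) (xs ! Suc r)" r' K] that
      by (simp add: nth_samples B_def \<theta>_def del: of_nat_Suc)
    also have "\<dots> \<le> \<theta> * \<theta>" using \<theta> lv by (intro mult_left_mono)
    finally show ?thesis .
  qed
  have PC: "P.prob (C r r') \<le> \<theta> * ?arr r" if "r < r'" for r r'
    using leave_bound_prob[OF \<eta>, of "\<lambda>xs. arrive K (xs ! r) (xs ! Suc r)" r' K] that
    by (simp add: nth_samples C_def \<theta>_def del: of_nat_Suc)
  have U1: "P.prob (\<Union>r<R. A1 r \<union> A2 r) \<le> real R * skip_total K \<eta>"
  proof -
    have "P.prob (\<Union>r<R. A1 r \<union> A2 r) \<le> (\<Sum>r<R. P.prob (A1 r \<union> A2 r))"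
      by (rule P.finite_measure_subadditive_finite) (use sA1 sA2 in auto)
    also have "\<dots> \<le> (\<Sum>r<R. skip_total K \<eta>)"
    proof (rule sum_mono)
      fix r
      have "P.prob (A1 r \<union> A2 r) \<le> P.prob (A1 r) + P.prob (A2 r)" by (rule measure_Un_le[OF sA1 sA2])
      also have "\<dots> \<le> skip_total K \<eta> + 0"
        unfolding A1_def A2_def by (intro add_mono skip_bound_prob[OF \<eta>]) (simp only: revive_prob[OF \<eta>] order_refl)
      finally show "P.prob (A1 r \<union> A2 r) \<le> skip_total K \<eta>" by simp
    qed
    finally show ?thesis by simp
  qed
  have U2: "P.prob (\<Union>r<R. \<Union>r'\<in>I r. B r r' \<union> C r r') \<le> (\<Sum>r<R. real L * (\<theta> * \<theta> + \<theta> * ?arr r))"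
  proof -
    have "P.prob (\<Union>r<R. \<Union>r'\<in>I r. B r r' \<union> C r r') \<le> (\<Sum>r<R. P.prob (\<Union>r'\<in>I r. B r r' \<union> C r r'))"
      by (rule P.finite_measure_subadditive_finite) (use sB sC I in auto)
    also have "\<dots> \<le> (\<Sum>r<R. real L * (\<theta> * \<theta> + \<theta> * ?arr r))"
    proof (rule sum_mono)
      fix r
      have "P.prob (\<Union>r'\<in>I r. B r r' \<union> C r r') \<le> (\<Sum>r'\<in>I r. P.prob (B r r' \<union> C r r'))"
        by (rule P.finite_measure_subadditive_finite) (use sB sC I in auto)
      also have "\<dots> \<le> (\<Sum>r'\<in>I r. \<theta> * \<theta> + \<theta> * ?arr r)"
      proof (rule sum_mono)
        fix r' assume "r' \<in> I r"
        then have "r < r'" by (simp add: I_def)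
        then show "P.prob (B r r' \<union> C r r') \<le> \<theta> * \<theta> + \<theta> * ?arr r"
          using measure_Un_le[OF sB sC, of r r' r r'] PB PC by (meson add_mono order_trans)
      qed
      also have "\<dots> = real (card (I r)) * (\<theta> * \<theta> + \<theta> * ?arr r)" by simp
      also have "\<dots> \<le> real L * (\<theta> * \<theta> + \<theta> * ?arr r)"
        using I(2)[of r] \<theta> by (intro mult_right_mono add_nonneg_nonneg mult_nonneg_nonneg) auto
      finally show "P.prob (\<Union>r'\<in>I r. B r r' \<union> C r r') \<le> real L * (\<theta> * \<theta> + \<theta> * ?arr r)" .
    qed
    finally show ?thesis .
  qed
  have "P.prob {w \<in> space P. two_jumps_grid K h N L w} \<le>
     P.prob ((\<Union>r<R. A1 r \<union> A2 r) \<union> (\<Union>r<R. \<Union>r'\<in>I r. B r r' \<union> C r r'))"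
    using incl sA1 sA2 sB sC I by (intro P.finite_measure_mono) auto
  also have "\<dots> \<le> P.prob (\<Union>r<R. A1 r \<union> A2 r) + P.prob (\<Union>r<R. \<Union>r'\<in>I r. B r r' \<union> C r r')"
    using sA1 sA2 sB sC I by (intro measure_Un_le) auto
  also have "\<dots> \<le> real R * skip_total K \<eta> + (\<Sum>r<R. real L * (\<theta> * \<theta> + \<theta> * ?arr r))"
    by (intro add_mono U1 U2)
  also have "(\<Sum>r<R. real L * (\<theta> * \<theta> + \<theta> * ?arr r)) = real R * (real L * (\<theta> * \<theta>)) + real L * \<theta> * (\<Sum>r<R. ?arr r)"
    by (simp add: distrib_left sum.distrib sum_distrib_left mult.assoc)
  also have "real R * skip_total K \<eta> + (real R * (real L * (\<theta> * \<theta>)) + real L * \<theta> * (\<Sum>r<R. ?arr r)) \<le>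
     real R * skip_total K \<eta> + (real R * (real L * (\<theta> * \<theta>)) + real L * \<theta> * (1 + real R * \<theta>))"
    using arrivals_bound[OF \<eta>, of K R] \<theta> unfolding \<theta>_def[symmetric]
    by (intro add_left_mono mult_left_mono) auto
  also have "\<dots> = real N * (real L * skip_total K \<eta>) + (real N * (real L * \<theta>)\<^sup>2 + real L * \<theta> * (1 + real N * (real L * \<theta>)))"
    by (simp add: R_def power2_eq_square algebra_simps)
  finally show ?thesis unfolding L\<theta> \<eta>_def[symmetric] by (simp add: algebra_simps)
qed

text \<open>The events increase under dyadic refinement, so the probability of their union is a
  limit. Along it \<open>2 ^ r * skip_total K (h / 2 ^ r)\<close> tends to 0, as
  \<open>skip_total K t\<close> is \<open>o(t)\<close>.\<close>

lemma two_jumps_prob: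
  assumes h: "h > 0"
  shows "{w \<in> space P. \<exists>r. two_jumps_grid K h N (2 ^ r) w} \<in> sets P"
    and "P.prob {w \<in> space P. \<exists>r. two_jumps_grid K h N (2 ^ r) w} \<le>
       real N * (rate K * h)\<^sup>2 + rate K * h * (1 + real N * (rate K * h))"
proof -
  let ?E = "\<lambda>r. {w \<in> space P. two_jumps_grid K h N (2 ^ r) w}"
  have U: "{w \<in> space P. \<exists>r. two_jumps_grid K h N (2 ^ r) w} = (\<Union>r. ?E r)" by auto
  have S: "?E r \<in> sets P" for r by (rule two_jumps_grid_sets[OF h])
  show "{w \<in> space P. \<exists>r. two_jumps_grid K h N (2 ^ r) w} \<in> sets P" unfolding U using S by auto
  have inc: "incseq ?E"
    using two_jumps_grid_mono[of K h N "2 ^ r" _ 2 for r] by (intro incseq_SucI) auto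
  have l1: "(\<lambda>r. P.prob (?E r)) \<longlonglongrightarrow> P.prob (\<Union>r. ?E r)"
    using S inc by (intro P.finite_Lim_measure_incseq) auto
  have f: "filterlim (\<lambda>r. h / 2 ^ r) (at_right 0) sequentially"
    unfolding filterlim_at
  proof (intro conjI)
    have "(\<lambda>r. h * (1/2) ^ r) \<longlonglongrightarrow> h * 0" by (intro tendsto_mult tendsto_const LIMSEQ_power_zero) auto
    then show "(\<lambda>r. h / 2 ^ r) \<longlonglongrightarrow> 0" by (simp add: power_divide)
    show "\<forall>\<^sub>F r in sequentially. h / 2 ^ r \<in> {0<..} \<and> h / 2 ^ r \<noteq> 0" using h by simp
  qed
  have "(\<lambda>r. h * (skip_total K (h / 2 ^ r) / (h / 2 ^ r))) \<longlonglongrightarrow> h * 0"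
    by (intro tendsto_mult tendsto_const filterlim_compose[OF skip_total_small f])
  then have l2: "(\<lambda>r. 2 ^ r * skip_total K (h / 2 ^ r)) \<longlonglongrightarrow> 0" using h by (simp add: mult.commute)
  have "(\<lambda>r. real N * (rate K * h)\<^sup>2 + rate K * h * (1 + real N * (rate K * h)) + real N * (2 ^ r * skip_total K (h / 2 ^ r)))
    \<longlonglongrightarrow> real N * (rate K * h)\<^sup>2 + rate K * h * (1 + real N * (rate K * h)) + real N * 0"
    by (intro tendsto_add tendsto_mult tendsto_const l2)
  then have "P.prob (\<Union>r. ?E r) \<le> real N * (rate K * h)\<^sup>2 + rate K * h * (1 + real N * (rate K * h)) + real N * 0"
    by (rule LIMSEQ_le[OF l1]) (use two_jumps_grid_prob[OF h, of "2 ^ _" K N] in auto)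
  then show "P.prob {w \<in> space P. \<exists>r. two_jumps_grid K h N (2 ^ r) w} \<le>
       real N * (rate K * h)\<^sup>2 + rate K * h * (1 + real N * (rate K * h))" unfolding U by simp
qed

text \<open>The bound depends on the process only through the transition rates; this makes the tightness uniform.\<close>

lemma one_jump_likely:
  assumes h: "h > 0"
  obtains E where "E \<in> sets P" "P.prob E \<le> 2 * real N * (rate K * h)\<^sup>2 + rate K * h" "\<And>w. w \<in> space P \<Longrightarrow> w \<notin> E \<Longrightarrow> one_jump K h N w"
proof -
  let ?E = "{w \<in> space P. \<exists>r. two_jumps_grid K h N (2 ^ r) w}"
  have "one_jump K h N w" if "w \<in> space P" "w \<notin> ?E" for w
    using not_one_jump_imp_grid[of w h K N] that h by (auto simp: space_P)
  moreover have "P.prob ?E \<le> 2 * real N * (rate K * h)\<^sup>2 + rate K * h"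
    using two_jumps_prob(2)[OF h, of K N] by (simp add: power2_eq_square algebra_simps)
  ultimately show ?thesis using that[of ?E] two_jumps_prob(1)[OF h] by blast
qed

end

section \<open>Weak convergence\<close>

lemma (in prob_space) discrete_integral:
  fixes f :: "'a \<Rightarrow> nat" and g :: "nat \<Rightarrow> real"
  assumes f: "f \<in> measurable M (count_space UNIV)" and g: "\<And>m. \<bar>g m\<bar> \<le> 1"
  shows "(\<lambda>m. prob {w \<in> space M. f w = m}) sums 1"
    and "(\<integral>w. g (f w) \<partial>M) = (\<Sum>m. prob {w \<in> space M. f w = m} * g m)"
proof -
  let ?A = "\<lambda>m. {w \<in> space M. f w = m}"
  have S: "?A m \<in> events" for m
  proof -
    have "f -` {m} \<inter> space M \<in> events" by (rule measurable_sets[OF f]) simp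
    also have "f -` {m} \<inter> space M = ?A m" by auto
    finally show ?thesis .
  qed
  have "(\<lambda>m. prob (?A m)) sums prob (\<Union>m. ?A m)"
    using S by (intro finite_measure_UNION) (auto simp: disjoint_family_on_def)
  also have "(\<Union>m. ?A m) = space M" by auto
  finally show sums: "(\<lambda>m. prob (?A m)) sums 1" by (simp add: prob_space)
  let ?f = "\<lambda>m w. indicator (?A m) w * g m"
  have "(\<integral>w. g (f w) \<partial>M) = (\<integral>w. (\<Sum>m. ?f m w) \<partial>M)"
  proof (rule Bochner_Integration.integral_cong[OF refl])
    fix w assume "w \<in> space M"
    then have "(\<Sum>m. ?f m w) = (\<Sum>m\<in>{f w}. ?f m w)" by (intro suminf_finite) auto
    then show "g (f w) = (\<Sum>m. ?f m w)" using \<open>w \<in> space M\<close> by simp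
  qed
  also have "\<dots> = (\<Sum>m. \<integral>w. ?f m w \<partial>M)"
  proof (rule integral_suminf)
    show "integrable M (?f m)" for m using S by (intro integrable_mult_left integrable_real_indicator) (auto simp: emeasure_eq_measure)
    have "summable (\<lambda>m. norm (?f m w))" if "w \<in> space M" for w
    proof (rule summable_finite)
      show "finite {f w}" by simp
      show "norm (?f m w) = 0" if "m \<notin> {f w}" for m using that by simp
    qed
    then show "AE w in M. summable (\<lambda>m. norm (?f m w))" by auto
    have eq: "(\<integral>w. norm (?f m w) \<partial>M) = prob (?A m) * \<bar>g m\<bar>" for m
      using S[of m] by (simp add: abs_mult)
    show "summable (\<lambda>m. \<integral>w. norm (?f m w) \<partial>M)"
      unfolding eq
    proof (rule summable_comparison_test'[OF sums_summable[OF sums], of 0])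
      show "norm (prob (?A m) * \<bar>g m\<bar>) \<le> prob (?A m)" for m
        using g[of m] by (simp add: abs_mult mult_left_le)
    qed
  qed
  also have "(\<lambda>m. \<integral>w. ?f m w \<partial>M) = (\<lambda>m. prob (?A m) * g m)" using S by simp
  finally show "(\<integral>w. g (f w) \<partial>M) = (\<Sum>m. prob (?A m) * g m)" .
qed

section \<open>From convergence of the samples to convergence of the laws\<close>

locale chain_convergence =
  fixes a b :: "nat \<Rightarrow> real" and p l P ps ls Ps
  assumes limit: "chain_law a b p l P"
    and approx: "\<And>n. n \<ge> 1 \<Longrightarrow> chain_law a b (ps n) (ls n) (Ps n)"
    and initial: "\<And>x. (\<lambda>n. measure (ls n) {x}) \<longlonglongrightarrow> measure l {x}"
    and transitions: "\<And>x y t. t \<ge> 0 \<Longrightarrow> (\<lambda>n. ext_transition (ps n) x y t) \<longlonglongrightarrow> ext_transition p x y t"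
begin

sublocale lim: chain_law a b p l P by (rule limit)

text \<open>On lists in \<open>N_cem\<close> both sides are products of convergent factors; all
  other lists have probability 0.\<close>

lemma samples_prob_tendsto:
  assumes \<eta>: "\<eta> > 0"
  shows "(\<lambda>n. measure (Ps n) {w \<in> space (Ps n). samples \<eta> R w = xs}) \<longlonglongrightarrow> measure P {w \<in> space P. samples \<eta> R w = xs}"
proof (cases "length xs = Suc R \<and> set xs \<subseteq> N_cem")
  case True
  have l: "(\<lambda>n. measure (ls n) {xs ! 0} * (\<Prod>k<R. ext_transition (ps n) (xs ! k) (xs ! Suc k) \<eta>))
     \<longlonglongrightarrow> measure l {xs ! 0} * (\<Prod>k<R. ext_transition p (xs ! k) (xs ! Suc k) \<eta>)"
    using \<eta> by (intro tendsto_mult tendsto_prod initial transitions) simp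
  have e: "measure (Ps n) {w \<in> space (Ps n). samples \<eta> R w = xs} =
      measure (ls n) {xs ! 0} * (\<Prod>k<R. ext_transition (ps n) (xs ! k) (xs ! Suc k) \<eta>)" if "n \<ge> 1" for n
    using chain_law.prob_samples[OF approx[OF that] \<eta>] True by blast
  show ?thesis
    unfolding lim.prob_samples[OF \<eta> conjunct1[OF True] conjunct2[OF True]]
    by (rule Lim_transform_eventually[OF l]) (rule eventually_sequentiallyI[of 1], rule e[symmetric])
next
  case False
  have zero: "measure P {w \<in> space P. samples \<eta> R w = xs} = 0" if "chain_law a b p l P" for p l P
  proof -
    interpret c: chain_law a b p l P by (rule that)
    have "AE w in P. w \<notin> {w \<in> space P. samples \<eta> R w = xs}"
      using c.samples_N_cem[of \<eta> R] \<eta> False by (auto elim!: eventually_mono simp: length_samples)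
    moreover have "{w \<in> space P. samples \<eta> R w = xs} \<in> sets P" using \<eta> by (intro c.sets_samples) simp
    ultimately show ?thesis by (simp add: c.P.prob_eq_0)
  qed
  then show ?thesis
    by (intro tendsto_eventually eventually_sequentiallyI[of 1]) (simp add: zero[OF approx] zero[OF limit])
qed

text \<open>The samples take countably many values and the limit has total mass 1, so no mass
  escapes and \<open>g\<close> can be arbitrary between 0 and 1. The infima of \<open>F\<close> to
  which this is applied carry no continuity.\<close>

lemma samples_integral_tendsto:
  fixes g :: "state list \<Rightarrow> real"
  assumes \<eta>: "\<eta> > 0" and g: "\<And>xs. 0 \<le> g xs" "\<And>xs. g xs \<le> 1"
  shows "(\<lambda>n. \<integral>w. g (samples \<eta> R w) \<partial>Ps n) \<longlonglongrightarrow> (\<integral>w. g (samples \<eta> R w) \<partial>P)"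
proof -
  define G :: "nat \<Rightarrow> real" where "G m = g (from_nat m)" for m
  define f :: "(real \<Rightarrow> state) \<Rightarrow> nat" where "f w = to_nat (samples \<eta> R w)" for w
  have gG: "g (samples \<eta> R w) = G (f w)" for w by (simp add: G_def f_def)
  have G: "0 \<le> G m" "G m \<le> 1" "\<bar>G m\<bar> \<le> 1" for m using g by (auto simp: G_def)
  have f: "f \<in> measurable P (count_space UNIV)" if "chain_law a b p l P" for p l P
    unfolding f_def by (rule measurable_compose[OF chain_law.samples_P[OF that less_imp_le[OF \<eta>]]]) simp
  have ps: "prob_space P" if "chain_law a b p l P" for p l P using that by (simp add: chain_law_def chain_law_axioms_def process_law_def)
  note di = prob_space.discrete_integral[OF ps f G(3)]
  have eq: "{w \<in> S. f w = m} = (if m \<in> range (to_nat :: state list \<Rightarrow> nat) then {w \<in> S. samples \<eta> R w = from_nat m} else {})" for m S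
    by (auto simp: f_def)
  have "(\<lambda>n. \<Sum>m. measure (Ps n) {w \<in> space (Ps n). f w = m} * G m) \<longlonglongrightarrow> (\<Sum>m. measure P {w \<in> space P. f w = m} * G m)"
  proof (rule scheffe_series)
    show "\<forall>\<^sub>F n in sequentially. summable (\<lambda>m. measure (Ps n) {w \<in> space (Ps n). f w = m})"
      by (rule eventually_sequentiallyI[of 1]) (use di(1)[OF approx approx] in \<open>auto simp: sums_iff\<close>)
    show "summable (\<lambda>m. measure P {w \<in> space P. f w = m})"
      using di(1)[OF limit limit] by (simp add: sums_iff)
    show "(\<lambda>n. measure (Ps n) {w \<in> space (Ps n). f w = m}) \<longlonglongrightarrow> measure P {w \<in> space P. f w = m}" for m
      unfolding eq using samples_prob_tendsto[OF \<eta>] by simp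
    show "(\<lambda>n. \<Sum>m. measure (Ps n) {w \<in> space (Ps n). f w = m}) \<longlonglongrightarrow> (\<Sum>m. measure P {w \<in> space P. f w = m})"
      by (intro tendsto_eventually eventually_sequentiallyI[of 1])
         (use di(1)[OF approx approx] di(1)[OF limit limit] in \<open>auto simp: sums_iff\<close>)
  qed (use G in auto)
  note l = this
  have e: "(\<integral>w. g (samples \<eta> R w) \<partial>Ps n) = (\<Sum>m. measure (Ps n) {w \<in> space (Ps n). f w = m} * G m)" if "n \<ge> 1" for n
    unfolding gG by (rule di(2)[OF approx[OF that] approx[OF that]])
  have e': "(\<integral>w. g (samples \<eta> R w) \<partial>P) = (\<Sum>m. measure P {w \<in> space P. f w = m} * G m)"
    unfolding gG by (rule di(2)[OF limit limit])
  show ?thesis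
    unfolding e' by (rule Lim_transform_eventually[OF l]) (rule eventually_sequentiallyI[of 1], rule e[symmetric])
qed

text \<open>On a path with at most one jump per cell, the infimum of \<open>F\<close> over a neighbourhood of the sampled
  path is a lower bound for \<open>F\<close>; it depends only on finitely many values of the path.\<close>

lemma integral_lower:
  assumes F: "continuous_map skorohod euclideanreal F"
    and F0: "\<And>w. w \<in> cadlag_paths \<Longrightarrow> 0 \<le> F w" and F1: "\<And>w. w \<in> cadlag_paths \<Longrightarrow> F w \<le> 1"
    and \<epsilon>: "\<epsilon> > 0"
  shows "\<forall>\<^sub>F n in sequentially. (\<integral>w. F w \<partial>P) - \<epsilon> < (\<integral>w. F w \<partial>Ps n)"
proof -
  \<comment> \<open>The mesh will be \<open>1 / M\<close>. The first condition keeps the time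
    changes below \<open>e k\<close>, the second the exceptional probability; \<open>k + 3\<close>
    is the time covered by the grid.\<close>
  have "\<exists>M::nat. M > 0 \<and> 2 / real M < 1 / (real k + 1) \<and>
      (2 * (real k + 3) * (lim.rate k)\<^sup>2 + lim.rate k) / real M < 1 / (real k + 1)" for k
  proof -
    define c where "c = max 2 (2 * (real k + 3) * (lim.rate k)\<^sup>2 + lim.rate k)"
    obtain M :: nat where M: "real M > c * (real k + 1)" using reals_Archimedean2 by blast
    have "c * (real k + 1) > 0" by (simp add: c_def)
    then have M0: "real M > 0" using M by linarith
    have "c / real M < 1 / (real k + 1)" using M M0 by (simp add: field_simps)
    moreover have "2 / real M \<le> c / real M" "(2 * (real k + 3) * (lim.rate k)\<^sup>2 + lim.rate k) / real M \<le> c / real M"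
      using M0 by (auto simp: c_def intro!: divide_right_mono)
    ultimately show ?thesis using M0 by (intro exI[of _ M]) auto
  qed
  then obtain M :: "nat \<Rightarrow> nat" where M: "\<And>k. M k > 0" "\<And>k. 2 / real (M k) < 1 / (real k + 1)"
    "\<And>k. (2 * (real k + 3) * (lim.rate k)\<^sup>2 + lim.rate k) / real (M k) < 1 / (real k + 1)"
    by metis
  define h where "h k = 1 / real (M k)" for k
  \<comment> \<open>The grid reaches beyond the horizon \<open>T k\<close>, and both grow with
    \<open>k\<close> while \<open>e k\<close> tends to 0.\<close>
  define N where "N k = (k + 3) * M k" for k
  define e where "e k = 1 / (real k + 1)" for k
  define T where "T k = real k + 1" for k
  have h: "h k > 0" "2 * h k < e k" for k using M(1,2)[of k] by (simp_all add: h_def e_def)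
  have Nh: "real (N k) * h k = real k + 3" for k using M(1)[of k] by (simp add: N_def h_def)
  have e: "e k > 0" for k by (simp add: e_def)
  have small: "2 * real (N k) * (lim.rate k * h k)\<^sup>2 + lim.rate k * h k \<le> e k" for k
  proof -
    have "2 * real (N k) * (lim.rate k * h k)\<^sup>2 + lim.rate k * h k = 2 * (real (N k) * h k) * (lim.rate k)\<^sup>2 * h k + lim.rate k * h k"
      by (simp add: power2_eq_square mult_ac)
    also have "\<dots> = (2 * (real k + 3) * (lim.rate k)\<^sup>2 + lim.rate k) / real (M k)"
      unfolding Nh by (simp add: h_def add_divide_distrib)
    finally show ?thesis using M(3)[of k] by (simp add: e_def)
  qed
  define S where "S k = (\<lambda>w :: real \<Rightarrow> state. samples (h k) (N k) w)" for k
  define V where "V k xs = skorohod_nbhd (step (h k) (N k) xs) (T k) (e k)" for k and xs :: "state list"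
  define L where "L k xs = Inf (F ` V k xs)" for k xs
  have V: "V k xs \<subseteq> cadlag_paths" "step (h k) (N k) xs \<in> V k xs" for k xs
  proof -
    show "V k xs \<subseteq> cadlag_paths" by (auto simp: V_def skorohod_nbhd_def)
    show "step (h k) (N k) xs \<in> V k xs" unfolding V_def by (rule skorohod_nbhd_refl[OF step_cadlag[OF h(1)] e])
  qed
  have bdd: "bdd_below (F ` V k xs)" for k xs using V(1) F0 by (auto intro!: bdd_belowI[of _ 0])
  have L0: "0 \<le> L k xs" for k xs
    unfolding L_def
  proof (rule cInf_greatest)
    show "F ` V k xs \<noteq> {}" using V(2)[of k xs] by blast
    show "0 \<le> y" if "y \<in> F ` V k xs" for y using that V(1)[of k xs] F0 by blast
  qed
  have L_le: "L k xs \<le> F v" if "v \<in> V k xs" for k xs v unfolding L_def using that bdd by (intro cInf_lower) auto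
  have L1: "L k xs \<le> 1" for k xs using L_le[OF V(2), of k xs] F1 V by (meson order_trans subsetD)
  \<comment> \<open>Outside the exceptional event the path lies in \<open>V k (S k w)\<close>, hence
    \<open>L \<le> F\<close>; on that event \<open>L \<le> 1\<close> is used. The error
    \<open>e k\<close> is the same for all laws because \<open>rate\<close> depends on
    \<open>a\<close> and \<open>b\<close> only.\<close>
  have bound: "(\<integral>w. L k (S k w) \<partial>P) \<le> (\<integral>w. F w \<partial>P) + e k" if "chain_law a b p l P" for p l P k
  proof -
    interpret c: chain_law a b p l P by (rule that)
    obtain E where E: "E \<in> sets P" "c.P.prob E \<le> 2 * real (N k) * (c.rate k * h k)\<^sup>2 + c.rate k * h k"
       "\<And>w. w \<in> space P \<Longrightarrow> w \<notin> E \<Longrightarrow> one_jump k (h k) (N k) w"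
      by (rule c.one_jump_likely[OF h(1), where K = k and N = "N k"]) blast
    have Fm: "F \<in> borel_measurable P"
      using continuous_imp_measurable[OF F] measurable_cong_sets[OF c.sets_P refl] by blast
    have iF: "integrable P F"
      by (rule c.P.integrable_const_bound[of _ 1]) (use F0 F1 Fm in \<open>auto simp: c.space_P\<close>)
    have iE: "integrable P (\<lambda>w. indicator E w :: real)" using E(1) by (simp add: c.P.emeasure_eq_measure)
    have Lm: "(\<lambda>w. L k (S k w)) \<in> borel_measurable P"
      unfolding S_def using h(1)[of k] by (intro measurable_compose[OF c.samples_P]) auto
    have iL: "integrable P (\<lambda>w. L k (S k w))"
      by (rule c.P.integrable_const_bound[of _ 1]) (use L0 L1 Lm in auto)
    have "(\<integral>w. L k (S k w) \<partial>P) \<le> (\<integral>w. F w + indicator E w \<partial>P)"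
    proof (rule integral_mono[OF iL Bochner_Integration.integrable_add[OF iF iE]])
      fix w assume w: "w \<in> space P"
      show "L k (S k w) \<le> F w + indicator E w"
      proof (cases "w \<in> E")
        case True
        then show ?thesis using L1[of k "S k w"] F0[of w] w by (simp add: c.space_P)
      next
        case False
        have "w \<in> V k (S k w)" unfolding V_def S_def
          by (rule one_jump_nbhd_step[OF h(1) h(2) _ E(3)[OF w False]])
             (use w c.space_P Nh[of k] in \<open>auto simp: e_def T_def\<close>)
        then show ?thesis using L_le False by simp
      qed
    qed
    also have "\<dots> = (\<integral>w. F w \<partial>P) + c.P.prob E"
      using iF iE E(1) by simp
    finally show ?thesis using E(2) small[of k] by linarith
  qed
  \<comment> \<open>The step path approaches \<open>w\<close> and the radius \<open>e k\<close>
    shrinks, so \<open>V k (S k w)\<close> eventually lies in a neighbourhood of \<open>w\<close> on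
    which \<open>F\<close> varies little.\<close>
  have pointwise: "(\<lambda>k. L k (S k w)) \<longlonglongrightarrow> F w" if w: "w \<in> cadlag_paths" for w
  proof (rule tendstoI)
    fix r :: real assume r: "r > 0"
    obtain T' d where T': "T' > 0" "d > 0" "\<And>v. v \<in> skorohod_nbhd w T' d \<Longrightarrow> \<bar>F v - F w\<bar> < r/2"
      using skorohod_continuousD[OF F w, of "r/2"] r by auto
    obtain \<delta> where \<delta>: "\<delta> > 0" "\<And>h N. 0 < h \<Longrightarrow> h < \<delta> \<Longrightarrow> T' + 2 \<le> real N * h \<Longrightarrow> step h N (samples h N w) \<in> skorohod_nbhd w T' (d/2)"
      using step_samples_converge[OF w, of "d/2" T'] T' by (metis half_gt_zero less_imp_le)
    have "\<forall>\<^sub>F k in sequentially. e k < min \<delta> (d/2)"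
      using order_tendstoD(2)[OF LIMSEQ_inverse_real_of_nat, of "min \<delta> (d/2)"] \<delta>(1) T'(2)
      by (auto simp: e_def inverse_eq_divide add.commute)
    moreover have "\<forall>\<^sub>F k in sequentially. T' + d \<le> real k"
      by (rule eventually_ge_at_top[THEN eventually_compose_filterlim, OF filterlim_real_sequentially])
    ultimately show "\<forall>\<^sub>F k in sequentially. dist (L k (S k w)) (F w) < r"
    proof eventually_elim
      case (elim k)
      have D: "step (h k) (N k) (S k w) \<in> skorohod_nbhd w T' (d/2)"
        unfolding S_def using elim h[of k] Nh[of k] T'(2) by (intro \<delta>(2)) auto
      have near: "\<bar>F v - F w\<bar> < r/2" if "v \<in> V k (S k w)" for v
      proof (rule T'(3))
        have "v \<in> skorohod_nbhd w T' (e k + d/2)"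
          using that elim T' unfolding V_def by (intro skorohod_nbhd_trans[OF _ D]) (auto simp: T_def)
        then show "v \<in> skorohod_nbhd w T' d"
          using skorohod_nbhd_mono[of T' T' "e k + d/2" d w] elim by auto
      qed
      have "F w - r/2 \<le> L k (S k w)"
        unfolding L_def
      proof (rule cInf_greatest)
        show "F ` V k (S k w) \<noteq> {}" using V(2)[of k "S k w"] by blast
        show "F w - r/2 \<le> y" if "y \<in> F ` V k (S k w)" for y
        proof -
          obtain v where "v \<in> V k (S k w)" "y = F v" using \<open>y \<in> F ` V k (S k w)\<close> by blast
          then show ?thesis using near[of v] by linarith
        qed
      qed
      moreover have "L k (S k w) \<le> F w + r/2"
        using L_le[OF V(2), of k "S k w"] near[OF V(2)] by linarith
      ultimately show ?case using r by (simp add: dist_real_def abs_less_iff)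
    qed
  qed
  have "(\<lambda>k. \<integral>w. L k (S k w) \<partial>P) \<longlonglongrightarrow> (\<integral>w. F w \<partial>P)"
  proof (rule integral_dominated_convergence[where w = "\<lambda>_. 1"])
    show "F \<in> borel_measurable P"
      using continuous_imp_measurable[OF F] measurable_cong_sets[OF lim.sets_P refl] by blast
    show "(\<lambda>w. L k (S k w)) \<in> borel_measurable P" for k
      unfolding S_def using h(1)[of k] by (intro measurable_compose[OF lim.samples_P]) auto
  qed (use pointwise L0 L1 in \<open>auto simp: lim.space_P\<close>)
  then have "\<forall>\<^sub>F k in sequentially. (\<integral>w. F w \<partial>P) - \<epsilon>/3 < (\<integral>w. L k (S k w) \<partial>P)"
    by (rule order_tendstoD(1)) (use \<epsilon> in simp)
  moreover have "\<forall>\<^sub>F k in sequentially. e k < \<epsilon>/3"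
    using order_tendstoD(2)[OF LIMSEQ_inverse_real_of_nat, of "\<epsilon>/3"] \<epsilon>
    by (auto simp: e_def inverse_eq_divide add.commute)
  ultimately have "\<forall>\<^sub>F k in sequentially. (\<integral>w. F w \<partial>P) - \<epsilon>/3 < (\<integral>w. L k (S k w) \<partial>P) \<and> e k < \<epsilon>/3"
    by (rule eventually_conj)
  then obtain k where k: "(\<integral>w. F w \<partial>P) - \<epsilon>/3 < (\<integral>w. L k (S k w) \<partial>P)" "e k < \<epsilon>/3"
    by (auto dest: eventually_happens)
  have "(\<lambda>n. \<integral>w. L k (S k w) \<partial>Ps n) \<longlonglongrightarrow> (\<integral>w. L k (S k w) \<partial>P)"
    unfolding S_def by (rule samples_integral_tendsto[OF h(1) L0 L1])
  then have "\<forall>\<^sub>F n in sequentially. (\<integral>w. L k (S k w) \<partial>P) - \<epsilon>/3 < (\<integral>w. L k (S k w) \<partial>Ps n)"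
    by (rule order_tendstoD(1)) (use \<epsilon> in simp)
  then show ?thesis using eventually_ge_at_top[of 1]
  proof eventually_elim
    case (elim n)
    then show ?case using bound[OF approx[OF elim(2)], of k] k by linarith
  qed
qed

text \<open>The lower bound is applied to \<open>F\<close> and to \<open>-F\<close>, both mapped
  affinely into \<open>[0, 1]\<close>.\<close>

theorem weak_convergence:
  assumes F: "continuous_map skorohod euclideanreal F" and bF: "bounded (F ` cadlag_paths)"
  shows "(\<lambda>n. \<integral>w. F w \<partial>Ps n) \<longlonglongrightarrow> (\<integral>w. F w \<partial>P)"
proof -
  obtain B where B: "B > 0" "\<And>w. w \<in> cadlag_paths \<Longrightarrow> \<bar>F w\<bar> \<le> B"
    using bF unfolding bounded_pos by auto
  define H where "H s w = (B + s * F w) / (2 * B)" for s w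
  have Hc: "continuous_map skorohod euclideanreal (H s)" for s
    unfolding H_def divide_inverse by (intro continuous_map_real_mult continuous_map_add F) auto
  have H01: "0 \<le> H s w" "H s w \<le> 1" if "w \<in> cadlag_paths" "s = 1 \<or> s = -1" for s w
    using B(1) B(2)[OF that(1)] that(2) by (auto simp: H_def abs_le_iff)
  have int: "(\<integral>w. H s w \<partial>P) = (B + s * (\<integral>w. F w \<partial>P)) / (2 * B)" if "chain_law a b p l P" for p l P s
  proof -
    interpret c: chain_law a b p l P by (rule that)
    have Fm: "F \<in> borel_measurable P"
      using continuous_imp_measurable[OF F] measurable_cong_sets[OF c.sets_P refl] by blast
    have "integrable P F"
      by (rule c.P.integrable_const_bound[of _ B]) (use B Fm in \<open>auto simp: c.space_P\<close>)
    then show ?thesis by (simp add: H_def c.P.prob_space)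
  qed
  show ?thesis
  proof (rule tendstoI)
    fix r :: real assume r: "r > 0"
    have r': "r / (2 * B) > 0" using r B by simp
    have "\<forall>\<^sub>F n in sequentially. (\<integral>w. H s w \<partial>P) - r / (2 * B) < (\<integral>w. H s w \<partial>Ps n)" if "s = 1 \<or> s = -1" for s
    proof (rule integral_lower[OF Hc _ _ r'])
      show "0 \<le> H s w" "H s w \<le> 1" if "w \<in> cadlag_paths" for w
        using H01[OF that \<open>s = 1 \<or> s = -1\<close>] by blast+
    qed
    from this[of 1] this[of "-1"]
    have "\<forall>\<^sub>F n in sequentially. (\<integral>w. H 1 w \<partial>P) - r / (2 * B) < (\<integral>w. H 1 w \<partial>Ps n)"
      "\<forall>\<^sub>F n in sequentially. (\<integral>w. H (-1) w \<partial>P) - r / (2 * B) < (\<integral>w. H (-1) w \<partial>Ps n)" by auto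
    then show "\<forall>\<^sub>F n in sequentially. dist (\<integral>w. F w \<partial>Ps n) (\<integral>w. F w \<partial>P) < r"
      using eventually_ge_at_top[of 1]
    proof eventually_elim
      case (elim n)
      have "(B + (\<integral>w. F w \<partial>P) - r) / (2 * B) < (B + (\<integral>w. F w \<partial>Ps n)) / (2 * B)"
        using elim(1) unfolding int[OF limit] int[OF approx[OF elim(3)]] by (simp add: diff_divide_distrib)
      moreover have "(B - (\<integral>w. F w \<partial>P) - r) / (2 * B) < (B - (\<integral>w. F w \<partial>Ps n)) / (2 * B)"
        using elim(2) unfolding int[OF limit] int[OF approx[OF elim(3)]] by (simp add: diff_divide_distrib)
      ultimately show ?case using B(1) by (simp add: divide_less_cancel dist_real_def abs_less_iff)
    qed
  qed
qed

end

theorem theorem5p7: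
  fixes a b :: "nat \<Rightarrow> real"
    and pmin p :: "nat \<Rightarrow> nat \<Rightarrow> real \<Rightarrow> real"
    and ps :: "nat \<Rightarrow> nat \<Rightarrow> nat \<Rightarrow> real \<Rightarrow> real"
    and X :: triple
    and Xs :: "nat \<Rightarrow> triple"
    and l :: "state measure"
    and ls :: "nat \<Rightarrow> state measure"
    and P :: "(real \<Rightarrow> state) measure"
    and Ps :: "nat \<Rightarrow> (real \<Rightarrow> state) measure"
    and F :: "(real \<Rightarrow> state) \<Rightarrow> real"
  assumes "birth_death a b"
    and "infinity_regular a b \<or> infinity_exit a b"
    and "minimal_transition a b pmin"
    and "\<And>n. n \<ge> 1 \<Longrightarrow> Xs n \<in> triples a b"
    and "X \<in> triples_F a b"
    and "triple_tendsto pmin Xs X"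
    and "\<And>n. n \<ge> 1 \<Longrightarrow> Q_process_of a b pmin (Xs n) (ps n)"
    and "Q_process_of a b pmin X p"
    and "\<And>n. n \<ge> 1 \<Longrightarrow> ls n \<in> prob_measures_N_cem"
    and "l \<in> prob_measures_N_cem"
    and "weakly_tendsto_N_cem ls l"
    and "\<And>n. n \<ge> 1 \<Longrightarrow> process_law (ps n) (ls n) (Ps n)"
    and "process_law p l P"
    and "continuous_map skorohod euclideanreal F"
    and "bounded (F ` cadlag_paths)"
  shows "(\<lambda>n. \<integral>w. F w \<partial>Ps n) \<longlonglongrightarrow> (\<integral>w. F w \<partial>P)"
proof -
  interpret bd_minimal a b pmin
    using assms(1-3) by unfold_locales (auto simp: infinity_regular_def infinity_exit_def)
  have X: "X \<in> triples a b" using assms(5) by (simp add: triples_F_def)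
  have init: "(\<lambda>n. measure (ls n) {x}) \<longlonglongrightarrow> measure l {x}" for x
  proof -
    \<comment> \<open>The indicator of \<open>{x}\<close> is a bounded test function, so weak
      convergence yields the convergence of all point masses. For \<open>x\<close> outside
      \<open>N_cem\<close> both sides are 0.\<close>
    have m: "(\<integral>y. indicator {x} y \<partial>m) = measure m {x}" if "m \<in> prob_measures_N_cem" for m
    proof (cases "x \<in> N_cem")
      case True
      then have "{x} \<in> sets m" using that by (auto simp: prob_measures_N_cem_def)
      then show ?thesis by simp
    next
      case False
      have "space m = N_cem" using that sets_eq_imp_space_eq[of m "count_space N_cem"] by (auto simp: prob_measures_N_cem_def)
      then have "(\<integral>y. indicator {x} y \<partial>m) = (\<integral>y. (0::real) \<partial>m)"
        using False by (intro Bochner_Integration.integral_cong) (auto simp: indicator_def)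
      moreover have "measure m {x} = 0" using that False by (intro measure_notin_sets) (auto simp: prob_measures_N_cem_def)
      ultimately show ?thesis by simp
    qed
    have "bounded ((indicator {x} :: state \<Rightarrow> real) ` N_cem)"
      by (rule boundedI[of _ 1]) (auto simp: indicator_def)
    then have "(\<lambda>n. \<integral>y. indicator {x} y \<partial>ls n) \<longlonglongrightarrow> (\<integral>y. indicator {x} y \<partial>l :: real)"
      using assms(11) unfolding weakly_tendsto_N_cem_def by blast
    then show ?thesis
      unfolding m[OF assms(10)]
      by (rule Lim_transform_eventually) (rule eventually_sequentiallyI[of 1], rule m[OF assms(9)])
  qed
  have Q: "Q_trans a b p'" if "Q_process_of a b pmin Y p'" for Y p'
    using that assms(1) by (simp add: Q_process_of_def Q_trans_def Q_trans_axioms_def bd_matrix_def)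
  have 1: "chain_law a b p l P"
    using Q[OF assms(8)] assms(10,13) by (simp add: chain_law_def chain_law_axioms_def)
  have 2: "chain_law a b (ps n) (ls n) (Ps n)" if "n \<ge> 1" for n
    using Q[OF assms(7)[OF that]] assms(9)[OF that] assms(12)[OF that] by (simp add: chain_law_def chain_law_axioms_def)
  have 3: "(\<lambda>n. ext_transition (ps n) x y t) \<longlonglongrightarrow> ext_transition p x y t" if "t \<ge> 0" for x y t
    by (rule ext_transition_tendsto[OF X assms(4) assms(2) assms(6) assms(8) assms(7) that])
  interpret chain_convergence a b p l P ps ls Ps
    by (rule chain_convergence.intro[OF 1 2 init 3])
  show ?thesis by (rule weak_convergence[OF assms(14,15)])
qed

end
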